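(* Let $\mathcal{C}$ be a pita 2-category and let $X\in\mathcal{C}$ be an object with finite limits. Then for any finite pbt sketch $J$ there exists a strict cotensor $X^J$ of $X$ with $J$.
   Context: Conventions. 2-categories are strict. Composition is in diagrammatic order: $fg$ means first $f$, then $g$. For $f:X\to Y$ and an object $A$, $f_*:\mathcal{C}(A,X)\to\mathcal{C}(A,Y)$ and $f^*:\mathcal{C}(Y,A)\to\mathcal{C}(X,A)$ are given by composition with $f$. Pita 2-categories. A functor $F$ is an isofibration if every isomorphism $Fx\to b$ lifts to an isomorphism with domain $x$; a morphism $f$ of $\mathcal{C}$ is an isofibration if $f_*:\mathcal{C}(A,X)\to\mathcal{C}(A,Y)$ is one for all $A$. A commutative square with vertex $P$ over a cospan $X\to Z\leftarrow Y$ is a strict pullback if $\mathcal{C}(B,P)\to\mathcal{C}(B,X)\times_{\mathcal{C}(B,Z)}\mathcal{C}(B,Y)$ is an isomorphism of categories for all $B$. A strict terminal object $\mathbf 1$ has $\mathcal{C}(A,\mathbf 1)$ the one-morphism category for all $A$. A strict arrow object of $X$ is an object $X^\to$ with a 2-cell $\partial$ between morphisms $X^\to\to X$ inducing isomorphisms of categories $\mathcal{C}(A,X^\to)\cong\mathcal{C}(A,X)^\to$ for all $A$. $\mathcal{C}$ is pita if it has a strict terminal object, strict arrow objects, and strict pullbacks of isofibrations along arbitrary morphisms. Finite limits. $X\in\mathcal{C}$ has finite limits if each $\mathcal{C}(A,X)$ has finite limits and each $f^*:\mathcal{C}(A,X)\to\mathcal{C}(A',X)$, $f:A'\to A$, preserves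 them. A limit of a diagram in $\mathcal{C}(A,X)$ is stable if it is preserved by $f^*$ for all $f:A'\to A$ in $\mathcal{C}$. Sketches. A pbt sketch $J=(|J|,P,T)$ is a category $|J|$ with a set $P$ of commutative squares in $|J|$ and a set $T$ of objects of $|J|$; it is finite if $|J|$ is finite. A model of $J$ in a category $\mathbf D$ is a functor $|J|\to\mathbf D$ taking each square in $P$ to a pullback square and each object in $T$ to a terminal object. A stable model $J\to\mathcal{C}(A,X)$ is a model taking each square in $P$ to a stable pullback square and each object in $T$ to a stable terminal object. Cotensors. A strict cotensor of $X$ with a pbt sketch $J$ is an object $X^J$ with a stable model $\mathrm{ev}:J\to\mathcal{C}(X^J,X)$ such that for each $A\in\mathcal{C}$ the functor $\mathcal{C}(A,X^J)\to\mathrm{Fun}(|J|,\mathcal{C}(A,X))$, sending $f$ to the composite of $\mathrm{ev}$ with $f^*:\mathcal{C}(X^J,X)\to\mathcal{C}(A,X)$ (and similarly on 2-cells), is an isomorphism onto the full subcategory of stable models $J\to\mathcal{C}(A,X)$. *)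

theory Defs
  imports "HOL-Library.FuncSet"
begin

section \<open>Categories and functors\<close>

text \<open>Composition is diagrammatic throughout: \<open>Comp C a b\<close> is first \<open>a\<close>, then \<open>b\<close>.\<close>

record ('o, 'a) cat =
  Ob :: "'o set"
  Ar :: "'a set"
  Dom :: "'a \<Rightarrow> 'o"
  Cod :: "'a \<Rightarrow> 'o"
  Idn :: "'o \<Rightarrow> 'a"
  Comp :: "'a \<Rightarrow> 'a \<Rightarrow> 'a"

definition in_hom :: "('o, 'a, 'z) cat_scheme \<Rightarrow> 'a \<Rightarrow> 'o \<Rightarrow> 'o \<Rightarrow> bool" where
  "in_hom C a x y \<longleftrightarrow> a \<in> Ar C \<and> Dom C a = x \<and> Cod C a = y"

locale category =
  fixes C :: "('o, 'a, 'z) cat_scheme"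
  assumes Dom_Ob: "a \<in> Ar C \<Longrightarrow> Dom C a \<in> Ob C"
    and Cod_Ob: "a \<in> Ar C \<Longrightarrow> Cod C a \<in> Ob C"
    and Idn_in_hom: "x \<in> Ob C \<Longrightarrow> in_hom C (Idn C x) x x"
    and Comp_in_hom: "in_hom C a x y \<Longrightarrow> in_hom C b y z \<Longrightarrow> in_hom C (Comp C a b) x z"
    and Comp_Idn_left: "in_hom C a x y \<Longrightarrow> Comp C (Idn C x) a = a"
    and Comp_Idn_right: "in_hom C a x y \<Longrightarrow> Comp C a (Idn C y) = a"
    and Comp_assoc: "in_hom C a w x \<Longrightarrow> in_hom C b x y \<Longrightarrow> in_hom C c y z \<Longrightarrow>
      Comp C (Comp C a b) c = Comp C a (Comp C b c)"

definition finite_category :: "('o, 'a, 'z) cat_scheme \<Rightarrow> bool" where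
  "finite_category C \<longleftrightarrow> category C \<and> finite (Ob C) \<and> finite (Ar C)"

definition is_iso :: "('o, 'a, 'z) cat_scheme \<Rightarrow> 'a \<Rightarrow> bool" where
  "is_iso C a \<longleftrightarrow> a \<in> Ar C \<and>
    (\<exists>b. in_hom C b (Cod C a) (Dom C a) \<and>
      Comp C a b = Idn C (Dom C a) \<and> Comp C b a = Idn C (Cod C a))"

definition full_subcat :: "('o, 'a) cat \<Rightarrow> 'o set \<Rightarrow> ('o, 'a) cat" where
  "full_subcat C S = C\<lparr>Ob := S, Ar := {a \<in> Ar C. Dom C a \<in> S \<and> Cod C a \<in> S}\<rparr>"

record ('o, 'p, 'a, 'b) ftor =
  fob :: "'o \<Rightarrow> 'p"
  far :: "'a \<Rightarrow> 'b"

definition is_functor ::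
  "('o, 'a, 'y) cat_scheme \<Rightarrow> ('p, 'b, 'z) cat_scheme \<Rightarrow> ('o, 'p, 'a, 'b) ftor \<Rightarrow> bool" where
  "is_functor C D F \<longleftrightarrow>
    (\<forall>x \<in> Ob C. fob F x \<in> Ob D) \<and>
    (\<forall>a \<in> Ar C. in_hom D (far F a) (fob F (Dom C a)) (fob F (Cod C a))) \<and>
    (\<forall>x \<in> Ob C. far F (Idn C x) = Idn D (fob F x)) \<and>
    (\<forall>a \<in> Ar C. \<forall>b \<in> Ar C. Cod C a = Dom C b \<longrightarrow>
      far F (Comp C a b) = Comp D (far F a) (far F b))"

text \<open>Only the values of a functor on objects and arrows of its domain matter; where functors
  are compared for equality (as objects of \<open>Fun_cat\<close>) they are taken to be extensional.\<close>

definition ftor_comp ::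
  "('o, 'a, 'z) cat_scheme \<Rightarrow> ('o, 'p, 'a, 'b) ftor \<Rightarrow> ('p, 'q, 'b, 'c) ftor \<Rightarrow> ('o, 'q, 'a, 'c) ftor"
where
  "ftor_comp C F G =
    \<lparr>fob = (\<lambda>x \<in> Ob C. fob G (fob F x)), far = (\<lambda>a \<in> Ar C. far G (far F a))\<rparr>"

definition is_cat_iso :: "('o, 'a) cat \<Rightarrow> ('p, 'b) cat \<Rightarrow> ('o, 'p, 'a, 'b) ftor \<Rightarrow> bool" where
  "is_cat_iso C D F \<longleftrightarrow> is_functor C D F \<and>
    (\<exists>G. is_functor D C G \<and>
      (\<forall>x \<in> Ob C. fob G (fob F x) = x) \<and> (\<forall>a \<in> Ar C. far G (far F a) = a) \<and>
      (\<forall>y \<in> Ob D. fob F (fob G y) = y) \<and> (\<forall>b \<in> Ar D. far F (far G b) = b))"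

definition functor_isofibration :: "('o, 'a) cat \<Rightarrow> ('p, 'b) cat \<Rightarrow> ('o, 'p, 'a, 'b) ftor \<Rightarrow> bool"
where
  "functor_isofibration C D F \<longleftrightarrow> is_functor C D F \<and>
    (\<forall>x \<in> Ob C. \<forall>b. is_iso D b \<and> Dom D b = fob F x \<longrightarrow>
      (\<exists>a. is_iso C a \<and> Dom C a = x \<and> far F a = b))"

record ('o, 'p, 'a, 'b) ntrans =
  nt_dom :: "('o, 'p, 'a, 'b) ftor"
  nt_at :: "'o \<Rightarrow> 'b"
  nt_cod :: "('o, 'p, 'a, 'b) ftor"

definition functors :: "('o, 'a) cat \<Rightarrow> ('p, 'b) cat \<Rightarrow> ('o, 'p, 'a, 'b) ftor set" where
  "functors J D =
    {F. is_functor J D F \<and> fob F \<in> extensional (Ob J) \<and> far F \<in> extensional (Ar J)}"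

definition Fun_cat ::
  "('o, 'a) cat \<Rightarrow> ('p, 'b) cat \<Rightarrow> (('o, 'p, 'a, 'b) ftor, ('o, 'p, 'a, 'b) ntrans) cat" where
  "Fun_cat J D = \<lparr>
    Ob = functors J D,
    Ar = {\<alpha>. nt_dom \<alpha> \<in> functors J D \<and> nt_cod \<alpha> \<in> functors J D \<and> nt_at \<alpha> \<in> extensional (Ob J) \<and>
      (\<forall>j \<in> Ob J. in_hom D (nt_at \<alpha> j) (fob (nt_dom \<alpha>) j) (fob (nt_cod \<alpha>) j)) \<and>
      (\<forall>u \<in> Ar J. Comp D (far (nt_dom \<alpha>) u) (nt_at \<alpha> (Cod J u)) =
        Comp D (nt_at \<alpha> (Dom J u)) (far (nt_cod \<alpha>) u))},
    Dom = nt_dom,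
    Cod = nt_cod,
    Idn = (\<lambda>F. \<lparr>nt_dom = F, nt_at = (\<lambda>j \<in> Ob J. Idn D (fob F j)), nt_cod = F\<rparr>),
    Comp = (\<lambda>\<alpha> \<beta>. \<lparr>nt_dom = nt_dom \<alpha>,
      nt_at = (\<lambda>j \<in> Ob J. Comp D (nt_at \<alpha> j) (nt_at \<beta> j)), nt_cod = nt_cod \<beta>\<rparr>)\<rparr>"

text \<open>An arrow of \<open>arrow_cat D\<close> from \<open>a\<close> to \<open>b\<close> is \<open>(a, u, v, b)\<close>, where \<open>u\<close> and \<open>v\<close> are the
  components at the domain and at the codomain.\<close>

definition arrow_cat :: "('o, 'a) cat \<Rightarrow> ('a, 'a \<times> 'a \<times> 'a \<times> 'a) cat" where
  "arrow_cat D = \<lparr>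
    Ob = Ar D,
    Ar = {(a, u, v, b). a \<in> Ar D \<and> b \<in> Ar D \<and>
      in_hom D u (Dom D a) (Dom D b) \<and> in_hom D v (Cod D a) (Cod D b) \<and>
      Comp D u b = Comp D a v},
    Dom = (\<lambda>(a, u, v, b). a),
    Cod = (\<lambda>(a, u, v, b). b),
    Idn = (\<lambda>a. (a, Idn D (Dom D a), Idn D (Cod D a), a)),
    Comp = (\<lambda>(a, u, v, b) (a', u', v', b'). (a, Comp D u u', Comp D v v', b'))\<rparr>"

definition cat_pullback ::
  "('o, 'a) cat \<Rightarrow> ('p, 'b) cat \<Rightarrow> ('o, 'q, 'a, 'c) ftor \<Rightarrow> ('p, 'q, 'b, 'c) ftor \<Rightarrow>
    ('o \<times> 'p, 'a \<times> 'b) cat" where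
  "cat_pullback D E F G = \<lparr>
    Ob = {(x, y). x \<in> Ob D \<and> y \<in> Ob E \<and> fob F x = fob G y},
    Ar = {(a, b). a \<in> Ar D \<and> b \<in> Ar E \<and> far F a = far G b},
    Dom = (\<lambda>(a, b). (Dom D a, Dom E b)),
    Cod = (\<lambda>(a, b). (Cod D a, Cod E b)),
    Idn = (\<lambda>(x, y). (Idn D x, Idn E y)),
    Comp = (\<lambda>(a, b) (a', b'). (Comp D a a', Comp E b b'))\<rparr>"

definition one_morphism_category :: "('o, 'a) cat \<Rightarrow> bool" where
  "one_morphism_category D \<longleftrightarrow> (\<exists>x a. Ob D = {x} \<and> Ar D = {a})"

section \<open>Limits\<close>

definition is_cone ::
  "('j, 'k) cat \<Rightarrow> ('o, 'a) cat \<Rightarrow> ('j, 'o, 'k, 'a) ftor \<Rightarrow> 'o \<Rightarrow> ('j \<Rightarrow> 'a) \<Rightarrow> bool" where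
  "is_cone J D F l \<pi> \<longleftrightarrow> l \<in> Ob D \<and>
    (\<forall>j \<in> Ob J. in_hom D (\<pi> j) l (fob F j)) \<and>
    (\<forall>u \<in> Ar J. Comp D (\<pi> (Dom J u)) (far F u) = \<pi> (Cod J u))"

definition is_limit ::
  "('j, 'k) cat \<Rightarrow> ('o, 'a) cat \<Rightarrow> ('j, 'o, 'k, 'a) ftor \<Rightarrow> 'o \<Rightarrow> ('j \<Rightarrow> 'a) \<Rightarrow> bool" where
  "is_limit J D F l \<pi> \<longleftrightarrow> is_cone J D F l \<pi> \<and>
    (\<forall>l' \<pi>'. is_cone J D F l' \<pi>' \<longrightarrow>
      (\<exists>!h. in_hom D h l' l \<and> (\<forall>j \<in> Ob J. Comp D h (\<pi> j) = \<pi>' j)))"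

text \<open>Every finite category is isomorphic to one whose objects and arrows are natural numbers,
  so it suffices to let the shape of a finite diagram range over these.\<close>

definition cat_has_finite_limits :: "('o, 'a) cat \<Rightarrow> bool" where
  "cat_has_finite_limits D \<longleftrightarrow>
    (\<forall>(J :: (nat, nat) cat) F. finite_category J \<and> is_functor J D F \<longrightarrow>
      (\<exists>l \<pi>. is_limit J D F l \<pi>))"

definition preserves_finite_limits ::
  "('o, 'a) cat \<Rightarrow> ('p, 'b) cat \<Rightarrow> ('o, 'p, 'a, 'b) ftor \<Rightarrow> bool" where
  "preserves_finite_limits D E G \<longleftrightarrow>
    (\<forall>(J :: (nat, nat) cat) F l \<pi>. finite_category J \<and> is_functor J D F \<and> is_limit J D F l \<pi> \<longrightarrow>
      is_limit J E (ftor_comp J F G) (fob G l) (\<lambda>j. far G (\<pi> j)))"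

definition is_terminal :: "('o, 'a) cat \<Rightarrow> 'o \<Rightarrow> bool" where
  "is_terminal D t \<longleftrightarrow> t \<in> Ob D \<and> (\<forall>x \<in> Ob D. \<exists>!a. in_hom D a x t)"

text \<open>A square \<open>(p, q, f, g)\<close> consists of a cospan \<open>f : x \<rightarrow> z\<close>, \<open>g : y \<rightarrow> z\<close> and a span
  \<open>p : w \<rightarrow> x\<close>, \<open>q : w \<rightarrow> y\<close> over it.\<close>

type_synonym 'a square = "'a \<times> 'a \<times> 'a \<times> 'a"

definition commutative_square :: "('o, 'a, 'z) cat_scheme \<Rightarrow> 'a square \<Rightarrow> bool" where
  "commutative_square D = (\<lambda>(p, q, f, g). {p, q, f, g} \<subseteq> Ar D \<and>
    Dom D p = Dom D q \<and> Cod D p = Dom D f \<and> Cod D q = Dom D g \<and> Cod D f = Cod D g \<and>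
    Comp D p f = Comp D q g)"

definition pullback_square :: "('o, 'a) cat \<Rightarrow> 'a square \<Rightarrow> bool" where
  "pullback_square D = (\<lambda>(p, q, f, g). commutative_square D (p, q, f, g) \<and>
    (\<forall>p' q'. commutative_square D (p', q', f, g) \<longrightarrow>
      (\<exists>!h. in_hom D h (Dom D p') (Dom D p) \<and> Comp D h p = p' \<and> Comp D h q = q')))"

definition map_square :: "('o, 'p, 'a, 'b) ftor \<Rightarrow> 'a square \<Rightarrow> 'b square" where
  "map_square F = (\<lambda>(p, q, f, g). (far F p, far F q, far F f, far F g))"

section \<open>2-categories\<close>

text \<open>The underlying category of \<open>C\<close> is \<open>C\<close> itself, regarded as a \<open>cat\<close>. The category \<open>Cells C\<close>
  has the 1-cells as objects and the 2-cells as arrows, with vertical composition; it is the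
  disjoint union of the hom-categories. \<open>HComp\<close> is horizontal composition of 2-cells.\<close>

record ('o, 'm, 'c) twocat = "('o, 'm) cat" +
  Cells :: "('m, 'c) cat"
  HComp :: "'c \<Rightarrow> 'c \<Rightarrow> 'c"

definition hcomposable :: "('o, 'm, 'c) twocat \<Rightarrow> 'c \<Rightarrow> 'c \<Rightarrow> bool" where
  "hcomposable C \<phi> \<psi> \<longleftrightarrow> \<phi> \<in> Ar (Cells C) \<and> \<psi> \<in> Ar (Cells C) \<and>
    Cod C (Dom (Cells C) \<phi>) = Dom C (Dom (Cells C) \<psi>)"

locale two_category = category C + vert: category "Cells C"
  for C :: "('o, 'm, 'c) twocat" +
  assumes Ob_Cells: "Ob (Cells C) = Ar C"
    and parallel_Dom: "\<phi> \<in> Ar (Cells C) \<Longrightarrow>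
      Dom C (Dom (Cells C) \<phi>) = Dom C (Cod (Cells C) \<phi>)"
    and parallel_Cod: "\<phi> \<in> Ar (Cells C) \<Longrightarrow>
      Cod C (Dom (Cells C) \<phi>) = Cod C (Cod (Cells C) \<phi>)"
    and HComp_in_hom: "hcomposable C \<phi> \<psi> \<Longrightarrow>
      in_hom (Cells C) (HComp C \<phi> \<psi>)
        (Comp C (Dom (Cells C) \<phi>) (Dom (Cells C) \<psi>))
        (Comp C (Cod (Cells C) \<phi>) (Cod (Cells C) \<psi>))"
    and HComp_Idn: "in_hom C f x y \<Longrightarrow> in_hom C g y z \<Longrightarrow>
      HComp C (Idn (Cells C) f) (Idn (Cells C) g) = Idn (Cells C) (Comp C f g)"
    and interchange: "hcomposable C \<phi> \<psi> \<Longrightarrow> hcomposable C \<phi>' \<psi>' \<Longrightarrow>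
      Cod (Cells C) \<phi> = Dom (Cells C) \<phi>' \<Longrightarrow> Cod (Cells C) \<psi> = Dom (Cells C) \<psi>' \<Longrightarrow>
      HComp C (Comp (Cells C) \<phi> \<phi>') (Comp (Cells C) \<psi> \<psi>') =
      Comp (Cells C) (HComp C \<phi> \<psi>) (HComp C \<phi>' \<psi>')"
    and HComp_unit_left: "\<phi> \<in> Ar (Cells C) \<Longrightarrow>
      HComp C (Idn (Cells C) (Idn C (Dom C (Dom (Cells C) \<phi>)))) \<phi> = \<phi>"
    and HComp_unit_right: "\<phi> \<in> Ar (Cells C) \<Longrightarrow>
      HComp C \<phi> (Idn (Cells C) (Idn C (Cod C (Dom (Cells C) \<phi>)))) = \<phi>"
    and HComp_assoc: "hcomposable C \<phi> \<psi> \<Longrightarrow> hcomposable C \<psi> \<chi> \<Longrightarrow>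
      HComp C (HComp C \<phi> \<psi>) \<chi> = HComp C \<phi> (HComp C \<psi> \<chi>)"

definition hom_cat :: "('o, 'm, 'c) twocat \<Rightarrow> 'o \<Rightarrow> 'o \<Rightarrow> ('m, 'c) cat" where
  "hom_cat C A B = full_subcat (Cells C) {f. in_hom C f A B}"

text \<open>\<open>postcomp C f\<close> is \<open>f\<^sub>*\<close> and \<open>precomp C f\<close> is the functor written with a superscript star.\<close>

definition postcomp :: "('o, 'm, 'c) twocat \<Rightarrow> 'm \<Rightarrow> ('m, 'm, 'c, 'c) ftor" where
  "postcomp C f =
    \<lparr>fob = (\<lambda>g. Comp C g f), far = (\<lambda>\<phi>. HComp C \<phi> (Idn (Cells C) f))\<rparr>"

definition precomp :: "('o, 'm, 'c) twocat \<Rightarrow> 'm \<Rightarrow> ('m, 'm, 'c, 'c) ftor" where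
  "precomp C f =
    \<lparr>fob = (\<lambda>g. Comp C f g), far = (\<lambda>\<phi>. HComp C (Idn (Cells C) f) \<phi>)\<rparr>"

section \<open>Pita 2-categories\<close>

definition isofibration :: "('o, 'm, 'c) twocat \<Rightarrow> 'm \<Rightarrow> bool" where
  "isofibration C f \<longleftrightarrow> f \<in> Ar C \<and>
    (\<forall>A \<in> Ob C. functor_isofibration (hom_cat C A (Dom C f)) (hom_cat C A (Cod C f)) (postcomp C f))"

definition strict_pullback :: "('o, 'm, 'c) twocat \<Rightarrow> 'm square \<Rightarrow> bool" where
  "strict_pullback C = (\<lambda>(p, q, f, g). commutative_square C (p, q, f, g) \<and>
    (\<forall>B \<in> Ob C. is_cat_iso
      (hom_cat C B (Dom C p))
      (cat_pullback (hom_cat C B (Dom C f)) (hom_cat C B (Dom C g)) (postcomp C f) (postcomp C g))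
      \<lparr>fob = (\<lambda>h. (fob (postcomp C p) h, fob (postcomp C q) h)),
       far = (\<lambda>\<phi>. (far (postcomp C p) \<phi>, far (postcomp C q) \<phi>))\<rparr>))"

definition strict_terminal :: "('o, 'm, 'c) twocat \<Rightarrow> 'o \<Rightarrow> bool" where
  "strict_terminal C T \<longleftrightarrow> T \<in> Ob C \<and> (\<forall>A \<in> Ob C. one_morphism_category (hom_cat C A T))"

definition strict_arrow_object :: "('o, 'm, 'c) twocat \<Rightarrow> 'o \<Rightarrow> 'o \<Rightarrow> 'c \<Rightarrow> bool" where
  "strict_arrow_object C X Y \<delta> \<longleftrightarrow> Y \<in> Ob C \<and> \<delta> \<in> Ar (hom_cat C Y X) \<and>
    (\<forall>A \<in> Ob C. is_cat_iso
      (hom_cat C A Y)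
      (arrow_cat (hom_cat C A X))
      \<lparr>fob = (\<lambda>f. far (precomp C f) \<delta>),
       far = (\<lambda>\<phi>.
         (far (precomp C (Dom (Cells C) \<phi>)) \<delta>,
          far (postcomp C (Dom (Cells C) \<delta>)) \<phi>,
          far (postcomp C (Cod (Cells C) \<delta>)) \<phi>,
          far (precomp C (Cod (Cells C) \<phi>)) \<delta>))\<rparr>)"

definition pita :: "('o, 'm, 'c) twocat \<Rightarrow> bool" where
  "pita C \<longleftrightarrow> two_category C \<and>
    (\<exists>T. strict_terminal C T) \<and>
    (\<forall>X \<in> Ob C. \<exists>Y \<delta>. strict_arrow_object C X Y \<delta>) \<and>
    (\<forall>f g. isofibration C f \<and> g \<in> Ar C \<and> Cod C g = Cod C f \<longrightarrow>
      (\<exists>p q. strict_pullback C (p, q, f, g)))"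

definition has_finite_limits :: "('o, 'm, 'c) twocat \<Rightarrow> 'o \<Rightarrow> bool" where
  "has_finite_limits C X \<longleftrightarrow>
    (\<forall>A \<in> Ob C. cat_has_finite_limits (hom_cat C A X)) \<and>
    (\<forall>A \<in> Ob C. \<forall>A' \<in> Ob C. \<forall>f. in_hom C f A' A \<longrightarrow>
      preserves_finite_limits (hom_cat C A X) (hom_cat C A' X) (precomp C f))"

definition stable_pullback_square ::
  "('o, 'm, 'c) twocat \<Rightarrow> 'o \<Rightarrow> 'o \<Rightarrow> 'c square \<Rightarrow> bool" where
  "stable_pullback_square C A X s \<longleftrightarrow> pullback_square (hom_cat C A X) s \<and>
    (\<forall>A' \<in> Ob C. \<forall>f. in_hom C f A' A \<longrightarrow>
      pullback_square (hom_cat C A' X) (map_square (precomp C f) s))"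

definition stable_terminal :: "('o, 'm, 'c) twocat \<Rightarrow> 'o \<Rightarrow> 'o \<Rightarrow> 'm \<Rightarrow> bool" where
  "stable_terminal C A X t \<longleftrightarrow> is_terminal (hom_cat C A X) t \<and>
    (\<forall>A' \<in> Ob C. \<forall>f. in_hom C f A' A \<longrightarrow>
      is_terminal (hom_cat C A' X) (fob (precomp C f) t))"

section \<open>Sketches and strict cotensors\<close>

record ('j, 'k) sketch =
  sk_cat :: "('j, 'k) cat"
  sk_squares :: "'k square set"
  sk_terminals :: "'j set"

definition pbt_sketch :: "('j, 'k) sketch \<Rightarrow> bool" where
  "pbt_sketch J \<longleftrightarrow> category (sk_cat J) \<and>
    (\<forall>s \<in> sk_squares J. commutative_square (sk_cat J) s) \<and>
    sk_terminals J \<subseteq> Ob (sk_cat J)"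

definition finite_pbt_sketch :: "('j, 'k) sketch \<Rightarrow> bool" where
  "finite_pbt_sketch J \<longleftrightarrow> pbt_sketch J \<and> finite_category (sk_cat J)"

definition is_model :: "('j, 'k) sketch \<Rightarrow> ('o, 'a) cat \<Rightarrow> ('j, 'o, 'k, 'a) ftor \<Rightarrow> bool" where
  "is_model J D M \<longleftrightarrow> is_functor (sk_cat J) D M \<and>
    (\<forall>s \<in> sk_squares J. pullback_square D (map_square M s)) \<and>
    (\<forall>t \<in> sk_terminals J. is_terminal D (fob M t))"

definition stable_model ::
  "('o, 'm, 'c) twocat \<Rightarrow> ('j, 'k) sketch \<Rightarrow> 'o \<Rightarrow> 'o \<Rightarrow> ('j, 'm, 'k, 'c) ftor \<Rightarrow> bool" where
  "stable_model C J A X M \<longleftrightarrow> is_model J (hom_cat C A X) M \<and>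
    (\<forall>s \<in> sk_squares J. stable_pullback_square C A X (map_square M s)) \<and>
    (\<forall>t \<in> sk_terminals J. stable_terminal C A X (fob M t))"

definition stable_model_cat ::
  "('o, 'm, 'c) twocat \<Rightarrow> ('j, 'k) sketch \<Rightarrow> 'o \<Rightarrow> 'o \<Rightarrow>
    (('j, 'm, 'k, 'c) ftor, ('j, 'm, 'k, 'c) ntrans) cat" where
  "stable_model_cat C J A X =
    full_subcat (Fun_cat (sk_cat J) (hom_cat C A X))
      {M \<in> functors (sk_cat J) (hom_cat C A X). stable_model C J A X M}"

definition cotensor_comparison ::
  "('o, 'm, 'c) twocat \<Rightarrow> ('j, 'k) sketch \<Rightarrow> ('j, 'm, 'k, 'c) ftor \<Rightarrow>
    ('m, ('j, 'm, 'k, 'c) ftor, 'c, ('j, 'm, 'k, 'c) ntrans) ftor" where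
  "cotensor_comparison C J ev = \<lparr>
    fob = (\<lambda>f. ftor_comp (sk_cat J) ev (precomp C f)),
    far = (\<lambda>\<phi>. \<lparr>
      nt_dom = ftor_comp (sk_cat J) ev (precomp C (Dom (Cells C) \<phi>)),
      nt_at = (\<lambda>j \<in> Ob (sk_cat J). far (postcomp C (fob ev j)) \<phi>),
      nt_cod = ftor_comp (sk_cat J) ev (precomp C (Cod (Cells C) \<phi>))\<rparr>)\<rparr>"

definition strict_cotensor ::
  "('o, 'm, 'c) twocat \<Rightarrow> 'o \<Rightarrow> ('j, 'k) sketch \<Rightarrow> 'o \<Rightarrow> ('j, 'm, 'k, 'c) ftor \<Rightarrow> bool" where
  "strict_cotensor C X J XJ ev \<longleftrightarrow> XJ \<in> Ob C \<and> stable_model C J XJ X ev \<and>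
    (\<forall>A \<in> Ob C. is_cat_iso (hom_cat C A XJ) (stable_model_cat C J A X)
      (cotensor_comparison C J ev))"

end

theory Submission
  imports Defs
begin

text \<open>Inserters into \<open>X\<close> are pullbacks of the isofibration from the arrow object of \<open>X\<close> to
  \<open>X \<times> X\<close>, so starting from a finite power of \<open>X\<close> and inserting a 2-cell for every arrow of the
  sketch gives an object classifying diagrams of the underlying graph. The functor laws are imposed
  by equifiers, pullbacks of the replete embedding of the arrow object into the object of parallel
  pairs of 2-cells. Once they hold, chosen pullbacks and a chosen terminal object are available and
  stable, so the model conditions say that certain comparison 2-cells become invertible. A 2-cell
  is made invertible by inserting a 2-cell in the other direction and imposing two equations.\<close>

section \<open>Categories\<close>

text \<open>The obstacle is that strict pullbacks are given only along isofibrations, so an equation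
  between 1-cells cannot simply be imposed; each stage has to find a map along which invertible
  2-cells lift. Conjugation by invertible 2-cells at both ends transports an arrow, which makes the
  arrow object isofibred over \<open>X \<times> X\<close>. A condition invariant under invertible
  2-cells makes the embedding that classifies it an isofibration. The functor laws precede the model
  conditions because a comparison with a chosen pullback exists only once the square commutes.
  Finite limits enter only there: a limit is chosen for the universal diagram, restriction preserves
  it, and the comparison for any other diagram is a restriction of the universal one. Stability is
  then automatic, since whiskering preserves invertibility. All constructions are strict on 1-cells
  and 2-cells, so the outcome is an isomorphism of categories and not just an equivalence.\<close>

context category
begin

lemma Comp_simps [simp]:
  assumes "a \<in> Ar C" "b \<in> Ar C" "Cod C a = Dom C b"
  shows "Comp C a b \<in> Ar C" "Dom C (Comp C a b) = Dom C a" "Cod C (Comp C a b) = Cod C b"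
  using Comp_in_hom[of a "Dom C a" "Cod C a" b "Cod C b"] assms by (simp_all add: in_hom_def)

lemma Idn_simps [simp]:
  assumes "x \<in> Ob C"
  shows "Idn C x \<in> Ar C" "Dom C (Idn C x) = x" "Cod C (Idn C x) = x"
  using Idn_in_hom[OF assms] by (simp_all add: in_hom_def)

lemma Comp_Idn_simps [simp]:
  "a \<in> Ar C \<Longrightarrow> Dom C a = x \<Longrightarrow> Comp C (Idn C x) a = a"
  "a \<in> Ar C \<Longrightarrow> Cod C a = y \<Longrightarrow> Comp C a (Idn C y) = a"
  using Comp_Idn_left Comp_Idn_right by (auto simp: in_hom_def)

lemma Comp_assoc_simp [simp]:
  "a \<in> Ar C \<Longrightarrow> b \<in> Ar C \<Longrightarrow> c \<in> Ar C \<Longrightarrow> Cod C a = Dom C b \<Longrightarrow> Cod C b = Dom C c \<Longrightarrow>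
    Comp C (Comp C a b) c = Comp C a (Comp C b c)"
  using Comp_assoc by (auto simp: in_hom_def)

lemmas Dom_Cod_Ob [simp] = Dom_Ob Cod_Ob

lemma is_isoI:
  assumes "in_hom C a x y" "in_hom C b y x" "Comp C a b = Idn C x" "Comp C b a = Idn C y"
  shows "is_iso C a"
  using assms by (auto simp: is_iso_def in_hom_def)

lemma inverse_unique:
  assumes a: "in_hom C a x y" and b: "in_hom C b y x" "Comp C b a = Idn C y"
    and c: "in_hom C c y x" "Comp C a c = Idn C x"
  shows "b = c"
proof -
  have "b = Comp C b (Comp C a c)" using c(2) Comp_Idn_right[OF b(1)] by simp
  also have "\<dots> = Comp C (Comp C b a) c" by (rule Comp_assoc[OF b(1) a c(1), symmetric])
  also have "\<dots> = c" using b(2) Comp_Idn_left[OF c(1)] by simp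
  finally show ?thesis .
qed

lemma is_isoE:
  assumes "is_iso C a" "in_hom C a x y"
  obtains b where "in_hom C b y x" "Comp C a b = Idn C x" "Comp C b a = Idn C y"
  using assms by (auto simp: is_iso_def in_hom_def)

lemma iso_cancel_left:
  assumes "is_iso C a" "in_hom C b (Cod C a) y" "in_hom C c (Cod C a) y"
    and "Comp C a b = Comp C a c"
  shows "b = c"
proof -
  have a: "in_hom C a (Dom C a) (Cod C a)"
    using assms(1) by (simp add: is_iso_def in_hom_def)
  from is_isoE[OF assms(1) a] obtain d where d: "in_hom C d (Cod C a) (Dom C a)"
    "Comp C d a = Idn C (Cod C a)" by metis
  have "b = Comp C (Comp C d a) b" using d(2) Comp_Idn_left[OF assms(2)] by simp
  also have "\<dots> = Comp C d (Comp C a b)" by (rule Comp_assoc[OF d(1) a assms(2)])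
  also have "\<dots> = Comp C (Comp C d a) c"
    unfolding assms(4) by (rule Comp_assoc[OF d(1) a assms(3), symmetric])
  also have "\<dots> = c" using d(2) Comp_Idn_left[OF assms(3)] by simp
  finally show ?thesis .
qed

end

section \<open>Isomorphisms of categories through unique lifts of objects and arrows\<close>

lemma is_cat_iso_Ob:
  assumes "is_cat_iso D E F" "y \<in> Ob E"
  shows "\<exists>!x. x \<in> Ob D \<and> fob F x = y"
  using assms unfolding is_cat_iso_def is_functor_def by metis

lemma is_cat_iso_hom:
  assumes F: "is_cat_iso D E F" and x: "x \<in> Ob D" "x' \<in> Ob D"
    and b: "in_hom E b (fob F x) (fob F x')"
  shows "\<exists>!a. in_hom D a x x' \<and> far F a = b"
proof -
  from F obtain G where G: "is_functor E D G" "\<forall>x \<in> Ob D. fob G (fob F x) = x"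
    "\<forall>a \<in> Ar D. far G (far F a) = a" "\<forall>b \<in> Ar E. far F (far G b) = b"
    unfolding is_cat_iso_def by auto
  have "in_hom D (far G b) x x'"
    using G(1,2) x b unfolding is_functor_def in_hom_def by auto
  moreover have "far F (far G b) = b" using G(4) b by (simp add: in_hom_def)
  moreover have "a = far G b" if "in_hom D a x x'" "far F a = b" for a
    using G(3) that by (auto simp: in_hom_def)
  ultimately show ?thesis by blast
qed

text \<open>The inverse is built by definite description, and its functoriality follows because
  \<open>F\<close> is functorial and injective on arrows with fixed ends. For \<open>E\<close> only
  the ends of arrows are asked to be objects, so the criterion applies to
  \<open>stable_model_cat\<close> without a proof of its category laws.\<close>

lemma is_cat_isoI:
  assumes D: "category D" and F: "is_functor D E F"
    and E: "\<And>b. b \<in> Ar E \<Longrightarrow> Dom E b \<in> Ob E \<and> Cod E b \<in> Ob E"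
    and ob: "\<And>y. y \<in> Ob E \<Longrightarrow> \<exists>!x. x \<in> Ob D \<and> fob F x = y"
    and hom: "\<And>x x' b. x \<in> Ob D \<Longrightarrow> x' \<in> Ob D \<Longrightarrow> in_hom E b (fob F x) (fob F x') \<Longrightarrow>
      \<exists>!a. in_hom D a x x' \<and> far F a = b"
  shows "is_cat_iso D E F"
proof -
  interpret category D by (rule D)
  define g where "g y = (THE x. x \<in> Ob D \<and> fob F x = y)" for y
  \<comment> \<open>Lifts are unique only between given ends, so the ends are part of the
    description.\<close>
  define h where "h b = (THE a. in_hom D a (g (Dom E b)) (g (Cod E b)) \<and> far F a = b)" for b
  have g: "g y \<in> Ob D" "fob F (g y) = y" if "y \<in> Ob E" for y
    using theI'[OF ob[OF that]] unfolding g_def by auto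
  have g_eq: "g (fob F x) = x" if "x \<in> Ob D" for x
    using that F ob g unfolding is_functor_def by metis
  have hom': "\<exists>!a. in_hom D a (g (Dom E b)) (g (Cod E b)) \<and> far F a = b" if "b \<in> Ar E" for b
    using hom[of "g (Dom E b)" "g (Cod E b)" b] E[OF that] that g by (simp add: in_hom_def)
  have h: "in_hom D (h b) (g (Dom E b)) (g (Cod E b))" "far F (h b) = b" if "b \<in> Ar E" for b
    using theI'[OF hom'[OF that]] unfolding h_def by auto
  have Fhom: "in_hom E (far F a) (fob F (Dom D a)) (fob F (Cod D a))" if "a \<in> Ar D" for a
    using F that unfolding is_functor_def by blast
  have h_eq: "h (far F a) = a" if "a \<in> Ar D" for a
  proof -
    have "in_hom D a (g (Dom E (far F a))) (g (Cod E (far F a)))"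
      using Fhom[OF that] that g_eq by (simp add: in_hom_def)
    then show ?thesis using h hom' Fhom[OF that] unfolding in_hom_def by metis
  qed
  have "is_functor E D \<lparr>fob = g, far = h\<rparr>"
    unfolding is_functor_def
  proof (intro conjI ballI impI; simp)
    fix y assume "y \<in> Ob E"
    then show "g y \<in> Ob D" by (rule g)
    have "far F (Idn D (g y)) = Idn E y"
      using F g[OF \<open>y \<in> Ob E\<close>] unfolding is_functor_def by metis
    then show "h (Idn E y) = Idn D (g y)" 
      using h_eq[of "Idn D (g y)"] g[OF \<open>y \<in> Ob E\<close>] by simp
  next
    fix b assume "b \<in> Ar E"
    then show "in_hom D (h b) (g (Dom E b)) (g (Cod E b))" by (rule h)
  next
    fix a b assume ab: "a \<in> Ar E" "b \<in> Ar E" "Cod E a = Dom E b"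
    then have c: "h a \<in> Ar D" "h b \<in> Ar D" "Cod D (h a) = Dom D (h b)"
      using h by (simp_all add: in_hom_def)
    then have "far F (Comp D (h a) (h b)) = Comp E a b"
      using F h ab unfolding is_functor_def by metis
    then show "h (Comp E a b) = Comp D (h a) (h b)"
      using h_eq[of "Comp D (h a) (h b)"] c by simp
  qed
  then show ?thesis
    unfolding is_cat_iso_def using F g g_eq h h_eq
    by (intro conjI exI[of _ "\<lparr>fob = g, far = h\<rparr>"]) auto
qed

lemma is_functor_comp:
  assumes C: "category C" and F: "is_functor C D F" and G: "is_functor D E G"
  shows "is_functor C E (ftor_comp C F G)"
proof -
  interpret category C by (rule C)
  show ?thesis
    using assms(2,3) unfolding is_functor_def ftor_comp_def in_hom_def by simp
qed

lemma functor_commutative_square: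
  assumes "is_functor D E G" "commutative_square D s"
  shows "commutative_square E (map_square G s)"
proof (cases s)
  case (fields p q f g)
  have arr: "p \<in> Ar D" "q \<in> Ar D" "f \<in> Ar D" "g \<in> Ar D" "Dom D p = Dom D q" "Cod D p = Dom D f"
    "Cod D q = Dom D g" "Cod D f = Cod D g" "Comp D p f = Comp D q g"
    using assms(2) by (simp_all add: fields commutative_square_def)
  have hom: "in_hom E (far G a) (fob G (Dom D a)) (fob G (Cod D a))" if "a \<in> Ar D" for a
    using assms(1) that unfolding is_functor_def by blast
  have "Comp E (far G p) (far G f) = Comp E (far G q) (far G g)"
    using assms(1) arr unfolding is_functor_def by metis
  then show ?thesis
    using hom[OF arr(1)] hom[OF arr(2)] hom[OF arr(3)] hom[OF arr(4)] arr(5-8)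
    by (simp add: fields map_square_def commutative_square_def in_hom_def)
qed

lemma category_full_subcat:
  fixes C :: "('o, 'a) cat"
  assumes C: "category C" and "S \<subseteq> Ob C"
  shows "category (full_subcat C S)"
proof -
  interpret category C by (rule C)
  show ?thesis
    using assms(2) by unfold_locales (auto simp: full_subcat_def in_hom_def)
qed

section \<open>Pullbacks and terminal objects\<close>

text \<open>The shape \<open>0 \<rightarrow> 2 \<leftarrow> 1\<close>. The arrows 0, 1, 2 are the
  identities, named like their objects, and 3, 4 are the two legs. After a leg only an identity can
  follow, and otherwise the first factor is an identity, which explains \<open>Comp\<close>. Natural
  numbers are forced by \<open>cat_has_finite_limits\<close>.\<close>

definition cospan :: "(nat, nat) cat" where
  "cospan = \<lparr>Ob = {0, 1, 2}, Ar = {0, 1, 2, 3, 4},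
    Dom = (\<lambda>a. if a = 3 then 0 else if a = 4 then 1 else a),
    Cod = (\<lambda>a. if a = 3 \<or> a = 4 then 2 else a),
    Idn = (\<lambda>x. x), Comp = (\<lambda>a b. if a = 3 \<or> a = 4 then a else b)\<rparr>"

lemma finite_category_cospan: "finite_category cospan"
  unfolding finite_category_def category_def
  by (auto simp: cospan_def in_hom_def)

lemma cospan_functor:
  assumes D: "category D" and f: "in_hom D f x z" and g: "in_hom D g y z"
  shows "is_functor cospan D
    \<lparr>fob = (\<lambda>i. if i = 0 then x else if i = 1 then y else z),
     far = (\<lambda>a. if a = 0 then Idn D x else if a = 1 then Idn D y else if a = 2 then Idn D z
       else if a = 3 then f else g)\<rparr>"
proof -
  interpret category D by (rule D)
  have "x \<in> Ob D" "y \<in> Ob D" "z \<in> Ob D" using f g by (auto simp: in_hom_def)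
  then show ?thesis
    using f g by (auto simp: is_functor_def cospan_def in_hom_def)
qed

text \<open>The component of a cone at the vertex 2 is determined by either of the others, so cones
  over the cospan are the same as commutative squares on it, and the condition on a mediating arrow
  at 2 follows from the one at 0.\<close>

lemma cospan_limit_pullback:
  assumes D: "category D" and F: "is_functor cospan D F" and lim: "is_limit cospan D F l \<pi>"
  shows "pullback_square D (\<pi> 0, \<pi> 1, far F 3, far F 4)"
proof -
  interpret category D by (rule D)
  have F3: "in_hom D (far F 3) (fob F 0) (fob F 2)" "in_hom D (far F 4) (fob F 1) (fob F 2)"
    using F unfolding is_functor_def cospan_def by auto
  have FI: "far F 0 = Idn D (fob F 0)" "far F 1 = Idn D (fob F 1)" "far F 2 = Idn D (fob F 2)"
    using F unfolding is_functor_def by (auto simp: cospan_def)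
  have \<pi>: "in_hom D (\<pi> 0) l (fob F 0)" "in_hom D (\<pi> 1) l (fob F 1)" "in_hom D (\<pi> 2) l (fob F 2)"
    "Comp D (\<pi> 0) (far F 3) = \<pi> 2" "Comp D (\<pi> 1) (far F 4) = \<pi> 2"
    using lim unfolding is_limit_def is_cone_def cospan_def by auto
  show ?thesis
    unfolding pullback_square_def prod.case
  proof (intro conjI allI impI)
    show "commutative_square D (\<pi> 0, \<pi> 1, far F 3, far F 4)"
      using F3 \<pi> by (auto simp: commutative_square_def in_hom_def)
  next
    fix p q assume sq: "commutative_square D (p, q, far F 3, far F 4)"
    define \<rho> where "\<rho> = (\<lambda>i::nat. if i = 0 then p else if i = 1 then q else Comp D p (far F 3))"
    have "is_cone cospan D F (Dom D p) \<rho>"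
      using sq F3 FI
      by (auto simp: is_cone_def cospan_def \<rho>_def commutative_square_def in_hom_def)
    then have "\<exists>!h. in_hom D h (Dom D p) l \<and> (\<forall>j \<in> Ob cospan. Comp D h (\<pi> j) = \<rho> j)"
      using lim unfolding is_limit_def by blast
    moreover have "(\<forall>j \<in> Ob cospan. Comp D h (\<pi> j) = \<rho> j) \<longleftrightarrow> Comp D h (\<pi> 0) = p \<and> Comp D h (\<pi> 1) = q"
      if h: "in_hom D h (Dom D p) l" for h
    proof -
      have "Comp D h (\<pi> 2) = Comp D (Comp D h (\<pi> 0)) (far F 3)"
        unfolding \<pi>(4)[symmetric] by (rule Comp_assoc[OF h \<pi>(1) F3(1), symmetric])
      then show ?thesis by (auto simp: cospan_def \<rho>_def)
    qed
    ultimately show "\<exists>!h. in_hom D h (Dom D p) (Dom D (\<pi> 0)) \<and> Comp D h (\<pi> 0) = p \<and> Comp D h (\<pi> 1) = q"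
      using \<pi>(1) unfolding in_hom_def by (metis (no_types, lifting))
  qed
qed

text \<open>The functors \<open>G\<close> are quantified after the choice of \<open>p\<close> and
  \<open>q\<close>: one pullback has to serve all restrictions of the universal cospan at
  once.\<close>

lemma pullback_exists:
  assumes D: "category D" and lim: "cat_has_finite_limits D"
    and f: "in_hom D f x z" and g: "in_hom D g y z"
  shows "\<exists>p q. pullback_square D (p, q, f, g) \<and>
    (\<forall>(E :: ('p, 'b) cat) G. category E \<and> is_functor D E G \<and> preserves_finite_limits D E G \<longrightarrow>
      pullback_square E (map_square G (p, q, f, g)))"
proof -
  define F where "F = \<lparr>fob = (\<lambda>i::nat. if i = 0 then x else if i = 1 then y else z),
     far = (\<lambda>a::nat. if a = 0 then Idn D x else if a = 1 then Idn D y else if a = 2 then Idn D z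
       else if a = 3 then f else g)\<rparr>"
  have F: "is_functor cospan D F" unfolding F_def by (rule cospan_functor[OF D f g])
  have F34: "far F 3 = f" "far F 4 = g" by (simp_all add: F_def)
  obtain l \<pi> where l: "is_limit cospan D F l \<pi>"
    using lim F finite_category_cospan unfolding cat_has_finite_limits_def by blast
  have "pullback_square D (\<pi> 0, \<pi> 1, f, g)"
    using cospan_limit_pullback[OF D F l] by (simp add: F34)
  moreover have "pullback_square E (map_square G (\<pi> 0, \<pi> 1, f, g))"
    if E: "category E" and G: "is_functor D E G" and pres: "preserves_finite_limits D E G"
    for E :: "('p, 'b) cat" and G
  proof -
    have "is_limit cospan E (ftor_comp cospan F G) (fob G l) (\<lambda>j. far G (\<pi> j))"
      using pres F l finite_category_cospan unfolding preserves_finite_limits_def by blast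
    moreover have "is_functor cospan E (ftor_comp cospan F G)"
      using is_functor_comp F G finite_category_cospan unfolding finite_category_def by blast
    ultimately have "pullback_square E (far G (\<pi> 0), far G (\<pi> 1),
        far (ftor_comp cospan F G) 3, far (ftor_comp cospan F G) 4)"
      using cospan_limit_pullback[OF E] by blast
    then show ?thesis by (simp add: map_square_def ftor_comp_def cospan_def F34)
  qed
  ultimately show ?thesis by blast
qed

definition empty_cat :: "(nat, nat) cat" where
  "empty_cat = \<lparr>Ob = {}, Ar = {}, Dom = id, Cod = id, Idn = id, Comp = (\<lambda>a b. a)\<rparr>"

lemma finite_category_empty: "finite_category empty_cat"
  unfolding finite_category_def category_def by (auto simp: empty_cat_def in_hom_def)

lemma empty_limit_terminal: "is_limit empty_cat D F l \<pi> \<longleftrightarrow> is_terminal D l"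
  unfolding is_limit_def is_terminal_def is_cone_def by (auto simp: empty_cat_def)

lemma terminal_exists:
  assumes "cat_has_finite_limits D"
  shows "\<exists>t. is_terminal D t \<and>
    (\<forall>(E :: ('p, 'b) cat) G. preserves_finite_limits D E G \<longrightarrow> is_terminal E (fob G t))"
proof -
  have F: "is_functor empty_cat D F" for F
    by (simp add: is_functor_def empty_cat_def)
  \<comment> \<open>The shape has no objects, so every diagram on it is the same and
    \<open>undefined\<close> serves as one.\<close>
  obtain l \<pi> where l: "is_limit empty_cat D undefined l \<pi>"
    using assms[unfolded cat_has_finite_limits_def, rule_format, OF conjI[OF finite_category_empty F[of undefined]]]
    by auto
  have "is_terminal E (fob G l)" if G: "preserves_finite_limits D E G"
    for E :: "('p, 'b) cat" and G
  proof -
    have "is_limit empty_cat E (ftor_comp empty_cat undefined G) (fob G l) (\<lambda>j. far G (\<pi> j))"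
      using G[unfolded preserves_finite_limits_def] finite_category_empty F[of undefined] l by blast
    then show ?thesis by (simp only: empty_limit_terminal)
  qed
  moreover have "is_terminal D l" using l by (simp only: empty_limit_terminal)
  ultimately show ?thesis by blast
qed

text \<open>Replaces a universal property, which quantifies over all objects, by the invertibility
  of a single arrow. In a hom-category that is a condition an inverter can impose.\<close>

lemma terminal_iff_iso:
  fixes C :: "('o, 'a) cat"
  assumes C: "category C" and t: "is_terminal C t" and h: "in_hom C h x t"
  shows "is_terminal C x \<longleftrightarrow> is_iso C h"
proof -
  interpret category C by (rule C)
  show ?thesis
proof
  assume x: "is_terminal C x"
  have ob: "x \<in> Ob C" "t \<in> Ob C" using t x by (auto simp: is_terminal_def)
  obtain k where k: "in_hom C k t x" using x ob unfolding is_terminal_def by blast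
  have "Comp C h k = Idn C x"
    using x ob Comp_in_hom[OF h k] Idn_in_hom unfolding is_terminal_def by blast
  moreover have "Comp C k h = Idn C t"
    using t ob Comp_in_hom[OF k h] Idn_in_hom unfolding is_terminal_def by blast
  ultimately show "is_iso C h" using h k is_isoI by blast
next
  assume "is_iso C h"
  then obtain k where k: "in_hom C k t x" "Comp C h k = Idn C x" "Comp C k h = Idn C t"
    using h is_isoE by blast
  show "is_terminal C x"
    unfolding is_terminal_def
  proof (intro conjI ballI)
    show "x \<in> Ob C" using h by (auto simp: in_hom_def)
  next
    fix y assume "y \<in> Ob C"
    then obtain a where a: "in_hom C a y t" "\<And>b. in_hom C b y t \<Longrightarrow> b = a"
      using t unfolding is_terminal_def by metis
    have "b = Comp C a k" if b: "in_hom C b y x" for b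
    proof -
      have "b = Comp C b (Comp C h k)" using k(2) Comp_Idn_right[OF b] by simp
      also have "\<dots> = Comp C (Comp C b h) k" by (rule Comp_assoc[OF b h k(1), symmetric])
      also have "Comp C b h = a" by (rule a(2)[OF Comp_in_hom[OF b h]])
      finally show ?thesis .
    qed
    then show "\<exists>!b. in_hom C b y x" using Comp_in_hom[OF a(1) k(1)] by blast
  qed
qed
qed

lemma pullback_square_commutes:
  "pullback_square D (p, q, f, g) \<Longrightarrow> commutative_square D (p, q, f, g)"
  by (simp only: pullback_square_def prod.case)

lemma pullback_square_universal:
  "pullback_square D (p, q, f, g) \<Longrightarrow> commutative_square D (r, s, f, g) \<Longrightarrow>
    \<exists>!h. in_hom D h (Dom D r) (Dom D p) \<and> Comp D h p = r \<and> Comp D h q = s"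
  by (simp only: pullback_square_def prod.case)

text \<open>Two pullbacks of one cospan have mutually inverse comparisons, because composites of
  comparisons and identities fill the same squares. Conversely an invertible comparison carries the
  universal property along. Its use is the same as that of \<open>terminal_iff_iso\<close>.\<close>

lemma pullback_iff_iso:
  fixes D :: "('o, 'a) cat"
  assumes D: "category D"
    and pb: "pullback_square D (p, q, f, g)" and sq: "commutative_square D (p', q', f, g)"
    and h: "in_hom D h (Dom D p') (Dom D p)" "Comp D h p = p'" "Comp D h q = q'"
  shows "pullback_square D (p', q', f, g) \<longleftrightarrow> is_iso D h"
proof -
  interpret category D by (rule D)
  note sq0 = pullback_square_commutes[OF pb] and ex = pullback_square_universal[OF pb]
  show ?thesis
  proof
    assume pb': "pullback_square D (p', q', f, g)"
    note ex' = pullback_square_universal[OF pb']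
    obtain k where k: "in_hom D k (Dom D p) (Dom D p')" "Comp D k p' = p" "Comp D k q' = q"
      using ex'[OF sq0] by blast
    have ty: "p \<in> Ar D" "q \<in> Ar D" "Dom D p = Dom D q" "p' \<in> Ar D" "q' \<in> Ar D" "Dom D p' = Dom D q'"
      using sq sq0 unfolding commutative_square_def by auto
    have "Comp D k h = Idn D (Dom D p)"
    proof -
      have "in_hom D (Comp D k h) (Dom D p) (Dom D p) \<and> Comp D (Comp D k h) p = p \<and>
          Comp D (Comp D k h) q = q"
        using k h ty by (simp add: in_hom_def)
      moreover have "in_hom D (Idn D (Dom D p)) (Dom D p) (Dom D p) \<and>
          Comp D (Idn D (Dom D p)) p = p \<and> Comp D (Idn D (Dom D p)) q = q"
        using ty by (simp add: in_hom_def)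
      ultimately show ?thesis using ex[OF sq0] by blast
    qed
    moreover have "Comp D h k = Idn D (Dom D p')"
    proof -
      have "in_hom D (Comp D h k) (Dom D p') (Dom D p') \<and> Comp D (Comp D h k) p' = p' \<and>
          Comp D (Comp D h k) q' = q'"
        using k h ty by (simp add: in_hom_def)
      moreover have "in_hom D (Idn D (Dom D p')) (Dom D p') (Dom D p') \<and>
          Comp D (Idn D (Dom D p')) p' = p' \<and> Comp D (Idn D (Dom D p')) q' = q'"
        using ty by (simp add: in_hom_def)
      ultimately show ?thesis using ex'[OF sq] by blast
    qed
    ultimately show "is_iso D h" using h(1) k(1) is_isoI by blast
  next
    assume "is_iso D h"
    then obtain k where k: "in_hom D k (Dom D p) (Dom D p')" "Comp D h k = Idn D (Dom D p')"
      "Comp D k h = Idn D (Dom D p)"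
      using h(1) is_isoE by blast
    have ty: "p \<in> Ar D" "q \<in> Ar D" "Dom D p = Dom D q" "p' \<in> Ar D" "q' \<in> Ar D" "Dom D p' = Dom D q'"
      using sq sq0 unfolding commutative_square_def by auto
    have kp: "Comp D k p' = p" "Comp D k q' = q"
    proof -
      have "Comp D k p' = Comp D (Comp D k h) p"
        unfolding h(2)[symmetric] using k(1) h(1) ty by (simp add: in_hom_def)
      then show "Comp D k p' = p" using k ty by simp
      have "Comp D k q' = Comp D (Comp D k h) q"
        unfolding h(3)[symmetric] using k(1) h(1) ty by (simp add: in_hom_def)
      then show "Comp D k q' = q" using k ty by simp
    qed
    show "pullback_square D (p', q', f, g)"
      unfolding pullback_square_def prod.case
    proof (intro conjI allI impI, rule sq)
      fix r s assume rs: "commutative_square D (r, s, f, g)"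
      obtain a where a: "in_hom D a (Dom D r) (Dom D p)" "Comp D a p = r" "Comp D a q = s"
        and uniq: "\<And>b. in_hom D b (Dom D r) (Dom D p) \<Longrightarrow> Comp D b p = r \<Longrightarrow> Comp D b q = s \<Longrightarrow> b = a"
        using ex[OF rs] by metis
      show "\<exists>!b. in_hom D b (Dom D r) (Dom D p') \<and> Comp D b p' = r \<and> Comp D b q' = s"
      proof (rule ex1I[of _ "Comp D a k"])
        show "in_hom D (Comp D a k) (Dom D r) (Dom D p') \<and> Comp D (Comp D a k) p' = r \<and>
            Comp D (Comp D a k) q' = s"
          using a k ty kp by (simp add: in_hom_def)
      next
        fix b assume b: "in_hom D b (Dom D r) (Dom D p') \<and> Comp D b p' = r \<and> Comp D b q' = s"
        then have bh: "Comp D (Comp D b h) p = r" "Comp D (Comp D b h) q = s"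
          "in_hom D (Comp D b h) (Dom D r) (Dom D p)"
          using h ty by (simp_all add: in_hom_def)
        have "b = Comp D b (Comp D h k)" using k b by (simp add: in_hom_def)
        also have "\<dots> = Comp D (Comp D b h) k" using b h k by (simp add: in_hom_def)
        also have "Comp D b h = a" by (rule uniq[OF bh(3,1,2)])
        finally show "b = Comp D a k" .
      qed
    qed
  qed
qed

section \<open>Whiskering\<close>

context two_category
begin

abbreviation comp1 :: "'m \<Rightarrow> 'm \<Rightarrow> 'm" (infixr \<open>\<cdot>\<close> 75) where "f \<cdot> g \<equiv> Comp C f g"
abbreviation vcomp :: "'c \<Rightarrow> 'c \<Rightarrow> 'c" (infixr \<open>\<bullet>\<close> 65) where "\<phi> \<bullet> \<psi> \<equiv> Comp (Cells C) \<phi> \<psi>"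
abbreviation id2 :: "'m \<Rightarrow> 'c" where "id2 f \<equiv> Idn (Cells C) f"

definition lwhisk :: "'m \<Rightarrow> 'c \<Rightarrow> 'c" (infixr \<open>\<triangleright>\<close> 70) where
  "k \<triangleright> \<phi> = HComp C (id2 k) \<phi>"

definition rwhisk :: "'c \<Rightarrow> 'm \<Rightarrow> 'c" (infixl \<open>\<triangleleft>\<close> 70) where
  "\<phi> \<triangleleft> k = HComp C \<phi> (id2 k)"

text \<open>Membership in a hom-set of \<open>Cells C\<close> leaves the 0-cells implicit. This
  typing carries them along and amounts to being an arrow of \<open>hom_cat C A B\<close>, see
  \<open>in_hom_hom_cat\<close>.\<close>

definition cell :: "'o \<Rightarrow> 'o \<Rightarrow> 'm \<Rightarrow> 'm \<Rightarrow> 'c \<Rightarrow> bool" where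
  "cell A B f g \<phi> \<longleftrightarrow> in_hom C f A B \<and> in_hom C g A B \<and> in_hom (Cells C) \<phi> f g"

lemma id2_simps [simp]:
  assumes "f \<in> Ar C"
  shows "id2 f \<in> Ar (Cells C)" "Dom (Cells C) (id2 f) = f" "Cod (Cells C) (id2 f) = f"
  using assms by (simp_all add: Ob_Cells)

lemma cell_one_simps [simp]:
  assumes "\<phi> \<in> Ar (Cells C)"
  shows "Dom (Cells C) \<phi> \<in> Ar C" "Cod (Cells C) \<phi> \<in> Ar C"
    "Dom C (Cod (Cells C) \<phi>) = Dom C (Dom (Cells C) \<phi>)"
    "Cod C (Cod (Cells C) \<phi>) = Cod C (Dom (Cells C) \<phi>)"
  using assms vert.Dom_Ob vert.Cod_Ob parallel_Dom parallel_Cod by (auto simp: Ob_Cells)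

lemma lwhisk_simps [simp]:
  assumes "k \<in> Ar C" "\<phi> \<in> Ar (Cells C)" "Cod C k = Dom C (Dom (Cells C) \<phi>)"
  shows "k \<triangleright> \<phi> \<in> Ar (Cells C)" "Dom (Cells C) (k \<triangleright> \<phi>) = k \<cdot> Dom (Cells C) \<phi>"
    "Cod (Cells C) (k \<triangleright> \<phi>) = k \<cdot> Cod (Cells C) \<phi>"
  using HComp_in_hom[of "id2 k" \<phi>] assms
  by (auto simp: hcomposable_def lwhisk_def in_hom_def)

lemma rwhisk_simps [simp]:
  assumes "k \<in> Ar C" "\<phi> \<in> Ar (Cells C)" "Cod C (Dom (Cells C) \<phi>) = Dom C k"
  shows "\<phi> \<triangleleft> k \<in> Ar (Cells C)" "Dom (Cells C) (\<phi> \<triangleleft> k) = Dom (Cells C) \<phi> \<cdot> k"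
    "Cod (Cells C) (\<phi> \<triangleleft> k) = Cod (Cells C) \<phi> \<cdot> k"
  using HComp_in_hom[of \<phi> "id2 k"] assms
  by (auto simp: hcomposable_def rwhisk_def in_hom_def)

lemma lwhisk_vcomp:
  assumes "k \<in> Ar C" "\<phi> \<in> Ar (Cells C)" "\<psi> \<in> Ar (Cells C)" "Cod C k = Dom C (Dom (Cells C) \<phi>)"
    "Cod (Cells C) \<phi> = Dom (Cells C) \<psi>"
  shows "k \<triangleright> (\<phi> \<bullet> \<psi>) = (k \<triangleright> \<phi>) \<bullet> (k \<triangleright> \<psi>)"
  using interchange[of "id2 k" \<phi> "id2 k" \<psi>] assms cell_one_simps[OF assms(2)]
  by (simp add: hcomposable_def lwhisk_def)

lemma rwhisk_vcomp:
  assumes "k \<in> Ar C" "\<phi> \<in> Ar (Cells C)" "\<psi> \<in> Ar (Cells C)" "Cod C (Dom (Cells C) \<phi>) = Dom C k"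
    "Cod (Cells C) \<phi> = Dom (Cells C) \<psi>"
  shows "(\<phi> \<bullet> \<psi>) \<triangleleft> k = (\<phi> \<triangleleft> k) \<bullet> (\<psi> \<triangleleft> k)"
  using interchange[of \<phi> "id2 k" \<psi> "id2 k"] assms cell_one_simps[OF assms(2)]
  by (simp add: hcomposable_def rwhisk_def)

lemma lwhisk_id2 [simp]:
  "k \<in> Ar C \<Longrightarrow> f \<in> Ar C \<Longrightarrow> Cod C k = Dom C f \<Longrightarrow> k \<triangleright> id2 f = id2 (k \<cdot> f)"
  using HComp_Idn by (simp add: lwhisk_def in_hom_def)

lemma rwhisk_id2 [simp]:
  "k \<in> Ar C \<Longrightarrow> f \<in> Ar C \<Longrightarrow> Cod C f = Dom C k \<Longrightarrow> id2 f \<triangleleft> k = id2 (f \<cdot> k)"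
  using HComp_Idn by (simp add: rwhisk_def in_hom_def)

lemma lwhisk_Idn [simp]:
  "\<phi> \<in> Ar (Cells C) \<Longrightarrow> Dom C (Dom (Cells C) \<phi>) = A \<Longrightarrow> Idn C A \<triangleright> \<phi> = \<phi>"
  using HComp_unit_left by (auto simp: lwhisk_def)

lemma rwhisk_Idn [simp]:
  "\<phi> \<in> Ar (Cells C) \<Longrightarrow> Cod C (Dom (Cells C) \<phi>) = A \<Longrightarrow> \<phi> \<triangleleft> Idn C A = \<phi>"
  using HComp_unit_right by (auto simp: rwhisk_def)

lemma lwhisk_comp1:
  assumes "k \<in> Ar C" "l \<in> Ar C" "\<phi> \<in> Ar (Cells C)" "Cod C k = Dom C l"
    "Cod C l = Dom C (Dom (Cells C) \<phi>)"
  shows "(k \<cdot> l) \<triangleright> \<phi> = k \<triangleright> l \<triangleright> \<phi>"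
  using HComp_assoc[of "id2 k" "id2 l" \<phi>] HComp_Idn[of k _ _ l] assms
  by (simp add: hcomposable_def lwhisk_def in_hom_def)

lemma rwhisk_comp1:
  assumes "k \<in> Ar C" "l \<in> Ar C" "\<phi> \<in> Ar (Cells C)" "Cod C k = Dom C l"
    "Cod C (Dom (Cells C) \<phi>) = Dom C k"
  shows "\<phi> \<triangleleft> (k \<cdot> l) = \<phi> \<triangleleft> k \<triangleleft> l"
  using HComp_assoc[of \<phi> "id2 k" "id2 l"] HComp_Idn[of k _ _ l] assms
  by (simp add: hcomposable_def rwhisk_def in_hom_def)

text \<open>By interchange with identities, both sides are the horizontal composite of \<phi> and
  \<alpha>.\<close>

lemma whisk_exchange:
  assumes \<phi>: "cell A B k k' \<phi>" and \<alpha>: "cell B X f g \<alpha>"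
  shows "(\<phi> \<triangleleft> f) \<bullet> (k' \<triangleright> \<alpha>) = (k \<triangleright> \<alpha>) \<bullet> (\<phi> \<triangleleft> g)"
proof -
  have "(\<phi> \<triangleleft> f) \<bullet> (k' \<triangleright> \<alpha>) = HComp C (\<phi> \<bullet> id2 k') (id2 f \<bullet> \<alpha>)"
    using assms by (subst interchange)
      (auto simp: hcomposable_def rwhisk_def lwhisk_def cell_def in_hom_def)
  also have "\<dots> = HComp C (id2 k \<bullet> \<phi>) (\<alpha> \<bullet> id2 g)"
    using assms by (simp add: cell_def in_hom_def)
  also have "\<dots> = (k \<triangleright> \<alpha>) \<bullet> (\<phi> \<triangleleft> g)"
    using assms by (subst interchange)
      (auto simp: hcomposable_def rwhisk_def lwhisk_def cell_def in_hom_def)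
  finally show ?thesis .
qed

lemma hom1_Comp [intro]: "in_hom C f A B \<Longrightarrow> in_hom C g B D \<Longrightarrow> in_hom C (f \<cdot> g) A D"
  by (rule Comp_in_hom)

lemma cell_lwhisk [intro]:
  "in_hom C k A B \<Longrightarrow> cell B X f g \<phi> \<Longrightarrow> cell A X (k \<cdot> f) (k \<cdot> g) (k \<triangleright> \<phi>)"
  by (auto simp: cell_def in_hom_def)

lemma cell_rwhisk [intro]:
  "cell A B f g \<phi> \<Longrightarrow> in_hom C k B X \<Longrightarrow> cell A X (f \<cdot> k) (g \<cdot> k) (\<phi> \<triangleleft> k)"
  by (auto simp: cell_def in_hom_def)

lemma cell_vcomp [intro]:
  "cell A B f g \<phi> \<Longrightarrow> cell A B g h \<psi> \<Longrightarrow> cell A B f h (\<phi> \<bullet> \<psi>)"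
  by (auto simp: cell_def in_hom_def)

lemma cell_id2 [intro]: "in_hom C f A B \<Longrightarrow> cell A B f f (id2 f)"
  by (auto simp: cell_def in_hom_def)

section \<open>Hom-categories and isofibrations\<close>

lemma hom_cat_simps [simp]:
  "Ob (hom_cat C A B) = {f. in_hom C f A B}" "Dom (hom_cat C A B) = Dom (Cells C)"
  "Cod (hom_cat C A B) = Cod (Cells C)" "Idn (hom_cat C A B) = Idn (Cells C)"
  "Comp (hom_cat C A B) = Comp (Cells C)"
  by (simp_all add: hom_cat_def full_subcat_def)

lemma Ar_hom_cat: 
  "\<phi> \<in> Ar (hom_cat C A B) \<longleftrightarrow> cell A B (Dom (Cells C) \<phi>) (Cod (Cells C) \<phi>) \<phi>"
  by (auto simp: hom_cat_def full_subcat_def cell_def in_hom_def)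

lemma in_hom_hom_cat [simp]: "in_hom (hom_cat C A B) \<phi> f g \<longleftrightarrow> cell A B f g \<phi>"
  by (auto simp: in_hom_def[of "hom_cat C A B"] Ar_hom_cat) (auto simp: cell_def in_hom_def)

lemma category_hom_cat: "category (hom_cat C A B)"
  unfolding hom_cat_def
  by (rule category_full_subcat) (auto simp: Ob_Cells in_hom_def vert.category_axioms)

lemma is_iso_hom_cat: "is_iso (hom_cat C A B) \<phi> \<longleftrightarrow>
  cell A B (Dom (Cells C) \<phi>) (Cod (Cells C) \<phi>) \<phi> \<and> is_iso (Cells C) \<phi>"
  unfolding is_iso_def by (auto simp: Ar_hom_cat) (auto simp: cell_def in_hom_def)

lemma iso_cell_inverse:
  assumes "is_iso (Cells C) \<phi>" "cell A B f g \<phi>"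
  obtains \<psi> where "cell A B g f \<psi>" "\<phi> \<bullet> \<psi> = id2 f" "\<psi> \<bullet> \<phi> = id2 g" "is_iso (Cells C) \<psi>"
proof -
  have \<phi>: "in_hom (Cells C) \<phi> f g" using assms by (simp add: cell_def)
  from vert.is_isoE[OF assms(1) \<phi>] obtain \<psi> where
    "in_hom (Cells C) \<psi> g f" "\<phi> \<bullet> \<psi> = id2 f" "\<psi> \<bullet> \<phi> = id2 g" by metis
  then show thesis using that vert.is_isoI[of \<psi> g f \<phi>] \<phi> assms(2) by (auto simp: cell_def)
qed

lemma is_iso_rwhisk:
  assumes "is_iso (Cells C) \<phi>" "cell A B f g \<phi>" "in_hom C k B X"
  shows "is_iso (Cells C) (\<phi> \<triangleleft> k)"
proof -
  obtain \<psi> where \<psi>: "cell A B g f \<psi>" "\<phi> \<bullet> \<psi> = id2 f" "\<psi> \<bullet> \<phi> = id2 g"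
    using iso_cell_inverse[OF assms(1,2)] .
  have "(\<phi> \<triangleleft> k) \<bullet> (\<psi> \<triangleleft> k) = id2 (f \<cdot> k)" "(\<psi> \<triangleleft> k) \<bullet> (\<phi> \<triangleleft> k) = id2 (g \<cdot> k)"
    using \<psi> assms(2,3) by (simp_all add: rwhisk_vcomp[symmetric] cell_def in_hom_def)
  then show ?thesis
    using cell_rwhisk[OF assms(2,3)] cell_rwhisk[OF \<psi>(1) assms(3)] vert.is_isoI
    unfolding cell_def by blast
qed

lemma is_iso_lwhisk:
  assumes "is_iso (Cells C) \<phi>" "cell A B f g \<phi>" "in_hom C k X A"
  shows "is_iso (Cells C) (k \<triangleright> \<phi>)"
proof -
  obtain \<psi> where \<psi>: "cell A B g f \<psi>" "\<phi> \<bullet> \<psi> = id2 f" "\<psi> \<bullet> \<phi> = id2 g"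
    using iso_cell_inverse[OF assms(1,2)] .
  have "(k \<triangleright> \<phi>) \<bullet> (k \<triangleright> \<psi>) = id2 (k \<cdot> f)" "(k \<triangleright> \<psi>) \<bullet> (k \<triangleright> \<phi>) = id2 (k \<cdot> g)"
    using \<psi> assms(2,3) by (simp_all add: lwhisk_vcomp[symmetric] cell_def in_hom_def)
  then show ?thesis
    using cell_lwhisk[OF assms(3,2)] cell_lwhisk[OF assms(3) \<psi>(1)] vert.is_isoI
    unfolding cell_def by blast
qed

lemma fob_postcomp [simp]: "fob (postcomp C f) g = g \<cdot> f"
  and far_postcomp [simp]: "far (postcomp C f) \<phi> = \<phi> \<triangleleft> f"
  and fob_precomp [simp]: "fob (precomp C f) g = f \<cdot> g"
  and far_precomp [simp]: "far (precomp C f) \<phi> = f \<triangleright> \<phi>"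
  by (simp_all add: postcomp_def precomp_def lwhisk_def rwhisk_def)

lemma is_functor_postcomp:
  "in_hom C f B X \<Longrightarrow> is_functor (hom_cat C A B) (hom_cat C A X) (postcomp C f)"
  unfolding is_functor_def
  by (auto simp: Ar_hom_cat) (auto simp: cell_def in_hom_def rwhisk_vcomp)

lemma is_functor_precomp:
  "in_hom C f A B \<Longrightarrow> is_functor (hom_cat C B X) (hom_cat C A X) (precomp C f)"
  unfolding is_functor_def
  by (auto simp: Ar_hom_cat) (auto simp: cell_def in_hom_def lwhisk_vcomp)

lemma isofibrationI:
  assumes f: "in_hom C f Y Z"
    and lift: "\<And>A k g b. in_hom C k A Y \<Longrightarrow> cell A Z (k \<cdot> f) g b \<Longrightarrow> is_iso (Cells C) b \<Longrightarrow>
      \<exists>k' a. cell A Y k k' a \<and> is_iso (Cells C) a \<and> a \<triangleleft> f = b"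
  shows "isofibration C f"
  unfolding isofibration_def functor_isofibration_def
proof (intro conjI ballI allI impI)
  have D: "Dom C f = Y" "Cod C f = Z" using f by (auto simp: in_hom_def)
  show "f \<in> Ar C" using f by (simp add: in_hom_def)
  fix A
  show "is_functor (hom_cat C A (Dom C f)) (hom_cat C A (Cod C f)) (postcomp C f)"
    using is_functor_postcomp f D by simp
  fix k b
  assume "k \<in> Ob (hom_cat C A (Dom C f))"
    and b: "is_iso (hom_cat C A (Cod C f)) b \<and> Dom (hom_cat C A (Cod C f)) b = fob (postcomp C f) k"
  then have "in_hom C k A Y" "cell A Z (k \<cdot> f) (Cod (Cells C) b) b" "is_iso (Cells C) b"
    using D by (auto simp: is_iso_hom_cat)
  then obtain k' a where "cell A Y k k' a" "is_iso (Cells C) a" "a \<triangleleft> f = b"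
    using lift by blast
  moreover from this have "Dom (Cells C) a = k" "Cod (Cells C) a = k'"
    by (auto simp: cell_def in_hom_def)
  ultimately show "\<exists>a. is_iso (hom_cat C A (Dom C f)) a \<and> Dom (hom_cat C A (Dom C f)) a = k \<and>
      far (postcomp C f) a = b"
    using D by (auto simp: is_iso_hom_cat)
qed

lemma rwhisk_rwhisk:
  "cell A B f g \<phi> \<Longrightarrow> in_hom C k B D \<Longrightarrow> in_hom C l D E \<Longrightarrow> \<phi> \<triangleleft> k \<triangleleft> l = \<phi> \<triangleleft> (k \<cdot> l)"
  by (simp add: rwhisk_comp1 cell_def in_hom_def)

lemma lwhisk_lwhisk:
  "cell D E f g \<phi> \<Longrightarrow> in_hom C k A B \<Longrightarrow> in_hom C l B D \<Longrightarrow> k \<triangleright> l \<triangleright> \<phi> = (k \<cdot> l) \<triangleright> \<phi>"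
  by (simp add: lwhisk_comp1 cell_def in_hom_def)

lemma cell_vcomp_rwhisk:
  "cell A B f g \<phi> \<Longrightarrow> cell A B g h \<psi> \<Longrightarrow> in_hom C k B D \<Longrightarrow> (\<phi> \<bullet> \<psi>) \<triangleleft> k = (\<phi> \<triangleleft> k) \<bullet> (\<psi> \<triangleleft> k)"
  by (simp add: rwhisk_vcomp cell_def in_hom_def)

lemma cell_vcomp_lwhisk:
  "cell A B f g \<phi> \<Longrightarrow> cell A B g h \<psi> \<Longrightarrow> in_hom C k D A \<Longrightarrow> k \<triangleright> (\<phi> \<bullet> \<psi>) = (k \<triangleright> \<phi>) \<bullet> (k \<triangleright> \<psi>)"
  by (simp add: lwhisk_vcomp cell_def in_hom_def)

lemma rwhisk_id2_hom: "in_hom C f A B \<Longrightarrow> in_hom C k B D \<Longrightarrow> id2 f \<triangleleft> k = id2 (f \<cdot> k)"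
  by (simp add: in_hom_def)

lemma lwhisk_id2_hom: "in_hom C k A B \<Longrightarrow> in_hom C f B D \<Longrightarrow> k \<triangleright> id2 f = id2 (k \<cdot> f)"
  by (simp add: in_hom_def)

text \<open>Lets an equation of 2-cells yield equations of 1-cells: from
  \<open>h \<triangleright> \<delta> = \<alpha>\<close> one reads off the composites of
  \<open>h\<close> with both ends of \<delta>.\<close>

lemma cell_unique_ends: "cell A B f g \<phi> \<Longrightarrow> cell A' B' f' g' \<phi> \<Longrightarrow> f = f' \<and> g = g'"
  by (auto simp: cell_def in_hom_def)

section \<open>Limits of 1-cells\<close>

lemma strict_pullback_lift:
  assumes pb: "strict_pullback C (p, q, f, g)"
    and x: "in_hom C x B (Dom C f)" and y: "in_hom C y B (Dom C g)" and eq: "x \<cdot> f = y \<cdot> g"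
  obtains h where "in_hom C h B (Dom C p)" "h \<cdot> p = x" "h \<cdot> q = y"
proof -
  have B: "B \<in> Ob C" using x by (auto simp: in_hom_def)
  note iso = pb[unfolded strict_pullback_def prod.case, THEN conjunct2, rule_format, OF B]
  have "(x, y) \<in> Ob (cat_pullback (hom_cat C B (Dom C f)) (hom_cat C B (Dom C g))
      (postcomp C f) (postcomp C g))"
    using x y eq by (simp add: cat_pullback_def)
  from is_cat_iso_Ob[OF iso this] obtain h where "in_hom C h B (Dom C p)" "h \<cdot> p = x" "h \<cdot> q = y"
    by auto
  then show thesis by (rule that)
qed

lemma strict_pullback_eqI:
  assumes pb: "strict_pullback C (p, q, f, g)"
    and h: "in_hom C h B (Dom C p)" and h': "in_hom C h' B (Dom C p)"
    and eq: "h \<cdot> p = h' \<cdot> p" "h \<cdot> q = h' \<cdot> q"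
  shows "h = h'"
proof -
  have B: "B \<in> Ob C" using h by (auto simp: in_hom_def)
  note iso = pb[unfolded strict_pullback_def prod.case, THEN conjunct2, rule_format, OF B]
  have sq: "commutative_square C (p, q, f, g)" using pb by (simp add: strict_pullback_def)
  have "(h \<cdot> p, h \<cdot> q) \<in> Ob (cat_pullback (hom_cat C B (Dom C f)) (hom_cat C B (Dom C g))
      (postcomp C f) (postcomp C g))"
    using h sq by (auto simp: cat_pullback_def commutative_square_def in_hom_def)
  from is_cat_iso_Ob[OF iso this] show ?thesis using h h' eq by auto
qed

lemma strict_pullback_cell:
  assumes pb: "strict_pullback C (p, q, f, g)"
    and h: "in_hom C h B (Dom C p)" "in_hom C h' B (Dom C p)"
    and c: "cell B (Dom C f) (h \<cdot> p) (h' \<cdot> p) \<phi>" "cell B (Dom C g) (h \<cdot> q) (h' \<cdot> q) \<psi>"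
    and eq: "\<phi> \<triangleleft> f = \<psi> \<triangleleft> g"
  shows "\<exists>!\<chi>. cell B (Dom C p) h h' \<chi> \<and> \<chi> \<triangleleft> p = \<phi> \<and> \<chi> \<triangleleft> q = \<psi>"
proof -
  have B: "B \<in> Ob C" using h by (auto simp: in_hom_def)
  note iso = pb[unfolded strict_pullback_def prod.case, THEN conjunct2, rule_format, OF B]
  have "in_hom (cat_pullback (hom_cat C B (Dom C f)) (hom_cat C B (Dom C g))
      (postcomp C f) (postcomp C g)) (\<phi>, \<psi>) (h \<cdot> p, h \<cdot> q) (h' \<cdot> p, h' \<cdot> q)"
    using c eq by (auto simp: cat_pullback_def in_hom_def[of "cat_pullback _ _ _ _"] Ar_hom_cat)
      (auto simp: cell_def in_hom_def)
  then show ?thesis using is_cat_iso_hom[OF iso, of h h' "(\<phi>, \<psi>)"] h by simp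
qed

lemma strict_pullback_cell_eqI:
  assumes pb: "strict_pullback C (p, q, f, g)"
    and c: "cell B (Dom C p) h h' \<chi>" "cell B (Dom C p) h h' \<chi>'"
    and eq: "\<chi> \<triangleleft> p = \<chi>' \<triangleleft> p" "\<chi> \<triangleleft> q = \<chi>' \<triangleleft> q"
  shows "\<chi> = \<chi>'"
proof -
  have sq: "in_hom C p (Dom C p) (Dom C f)" "in_hom C q (Dom C p) (Dom C g)"
    "in_hom C f (Dom C f) (Cod C f)" "in_hom C g (Dom C g) (Cod C f)" "p \<cdot> f = q \<cdot> g"
    using pb by (auto simp: strict_pullback_def commutative_square_def in_hom_def)
  have h: "in_hom C h B (Dom C p)" "in_hom C h' B (Dom C p)" using c by (auto simp: cell_def)
  have "\<chi> \<triangleleft> p \<triangleleft> f = \<chi> \<triangleleft> q \<triangleleft> g"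
    using rwhisk_rwhisk[OF c(1) sq(1,3)] rwhisk_rwhisk[OF c(1) sq(2,4)] sq(5) by simp
  from strict_pullback_cell[OF pb h cell_rwhisk[OF c(1) sq(1)] cell_rwhisk[OF c(1) sq(2)] this]
  show ?thesis using c eq by auto
qed

end

section \<open>Strict two-dimensional universal properties\<close>

locale binary_product = two_category C for C :: "('o, 'm, 'c) twocat" +
  fixes U V P :: 'o and p q :: 'm
  assumes fst: "in_hom C p P U" and snd: "in_hom C q P V"
    and lift: "in_hom C x B U \<Longrightarrow> in_hom C y B V \<Longrightarrow> \<exists>h. in_hom C h B P \<and> h \<cdot> p = x \<and> h \<cdot> q = y"
    and eqI: "in_hom C h B P \<Longrightarrow> in_hom C h' B P \<Longrightarrow> h \<cdot> p = h' \<cdot> p \<Longrightarrow> h \<cdot> q = h' \<cdot> q \<Longrightarrow> h = h'"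
    and lift_cell: "in_hom C h B P \<Longrightarrow> in_hom C h' B P \<Longrightarrow> cell B U (h \<cdot> p) (h' \<cdot> p) \<phi> \<Longrightarrow>
      cell B V (h \<cdot> q) (h' \<cdot> q) \<psi> \<Longrightarrow> \<exists>\<chi>. cell B P h h' \<chi> \<and> \<chi> \<triangleleft> p = \<phi> \<and> \<chi> \<triangleleft> q = \<psi>"
    and cell_eqI: "cell B P h h' \<chi> \<Longrightarrow> cell B P h h' \<chi>' \<Longrightarrow>
      \<chi> \<triangleleft> p = \<chi>' \<triangleleft> p \<Longrightarrow> \<chi> \<triangleleft> q = \<chi>' \<triangleleft> q \<Longrightarrow> \<chi> = \<chi>'"

locale inserter = two_category C for C :: "('o, 'm, 'c) twocat" +
  fixes A X :: 'o and f g :: 'm and I :: 'o and i :: 'm and \<theta> :: 'c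
  assumes proj: "in_hom C i I A" and inserted: "cell I X (i \<cdot> f) (i \<cdot> g) \<theta>"
    and lift: "in_hom C k B A \<Longrightarrow> cell B X (k \<cdot> f) (k \<cdot> g) \<alpha> \<Longrightarrow>
      \<exists>h. in_hom C h B I \<and> h \<cdot> i = k \<and> h \<triangleright> \<theta> = \<alpha>"
    and eqI: "in_hom C h B I \<Longrightarrow> in_hom C h' B I \<Longrightarrow> h \<cdot> i = h' \<cdot> i \<Longrightarrow> h \<triangleright> \<theta> = h' \<triangleright> \<theta> \<Longrightarrow> h = h'"
    and lift_cell: "in_hom C h B I \<Longrightarrow> in_hom C h' B I \<Longrightarrow> cell B A (h \<cdot> i) (h' \<cdot> i) \<phi> \<Longrightarrow>
      (\<phi> \<triangleleft> f) \<bullet> (h' \<triangleright> \<theta>) = (h \<triangleright> \<theta>) \<bullet> (\<phi> \<triangleleft> g) \<Longrightarrow> \<exists>\<chi>. cell B I h h' \<chi> \<and> \<chi> \<triangleleft> i = \<phi>"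
    and cell_eqI: "cell B I h h' \<chi> \<Longrightarrow> cell B I h h' \<chi>' \<Longrightarrow> \<chi> \<triangleleft> i = \<chi>' \<triangleleft> i \<Longrightarrow> \<chi> = \<chi>'"

text \<open>On every hom-category, composition with \<open>i\<close> is fully faithful and injective
  on objects. Such an \<open>i\<close> is therefore governed by the set of 1-cells that factor
  through it.\<close>

locale embedding = two_category C for C :: "('o, 'm, 'c) twocat" +
  fixes Q P :: 'o and i :: 'm
  assumes arr: "in_hom C i Q P"
    and eqI: "in_hom C k B Q \<Longrightarrow> in_hom C k' B Q \<Longrightarrow> k \<cdot> i = k' \<cdot> i \<Longrightarrow> k = k'"
    and lift_cell: "in_hom C k B Q \<Longrightarrow> in_hom C k' B Q \<Longrightarrow> cell B P (k \<cdot> i) (k' \<cdot> i) \<phi> \<Longrightarrow>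
      \<exists>\<psi>. cell B Q k k' \<psi> \<and> \<psi> \<triangleleft> i = \<phi>"
    and cell_eqI: "cell B Q k k' \<psi> \<Longrightarrow> cell B Q k k' \<psi>' \<Longrightarrow> \<psi> \<triangleleft> i = \<psi>' \<triangleleft> i \<Longrightarrow> \<psi> = \<psi>'"

text \<open>The strict cotensor of \<open>X\<close> with the graph of vertices \<open>V\<close> and
  edges \<open>U\<close>; identities and composites of \<open>K\<close> are not yet respected.
  \<open>V\<close> and \<open>U\<close> are parameters so that vertices and then edges can be added
  one at a time by induction. A 2-cell is given by its components at vertices, the edges
  contributing only naturality.\<close>

locale diagram_object = two_category C for C :: "('o, 'm, 'c) twocat" +
  fixes K :: "('j, 'k) cat" and V :: "'j set" and U :: "'k set" and X P :: 'o
    and m :: "'j \<Rightarrow> 'm" and c :: "'k \<Rightarrow> 'c"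
  assumes obj: "P \<in> Ob C"
    and vertex: "x \<in> V \<Longrightarrow> in_hom C (m x) P X"
    and edge: "u \<in> U \<Longrightarrow> cell P X (m (Dom K u)) (m (Cod K u)) (c u)"
    and lift: "B \<in> Ob C \<Longrightarrow> (\<And>x. x \<in> V \<Longrightarrow> in_hom C (m' x) B X) \<Longrightarrow>
      (\<And>u. u \<in> U \<Longrightarrow> cell B X (m' (Dom K u)) (m' (Cod K u)) (c' u)) \<Longrightarrow>
      \<exists>k. in_hom C k B P \<and> (\<forall>x \<in> V. k \<cdot> m x = m' x) \<and> (\<forall>u \<in> U. k \<triangleright> c u = c' u)"
    and eqI: "in_hom C k B P \<Longrightarrow> in_hom C k' B P \<Longrightarrow> (\<And>x. x \<in> V \<Longrightarrow> k \<cdot> m x = k' \<cdot> m x) \<Longrightarrow>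
      (\<And>u. u \<in> U \<Longrightarrow> k \<triangleright> c u = k' \<triangleright> c u) \<Longrightarrow> k = k'"
    and lift_cell: "in_hom C k B P \<Longrightarrow> in_hom C k' B P \<Longrightarrow>
      (\<And>x. x \<in> V \<Longrightarrow> cell B X (k \<cdot> m x) (k' \<cdot> m x) (\<sigma> x)) \<Longrightarrow>
      (\<And>u. u \<in> U \<Longrightarrow> (k \<triangleright> c u) \<bullet> \<sigma> (Cod K u) = \<sigma> (Dom K u) \<bullet> (k' \<triangleright> c u)) \<Longrightarrow>
      \<exists>\<chi>. cell B P k k' \<chi> \<and> (\<forall>x \<in> V. \<chi> \<triangleleft> m x = \<sigma> x)"
    and cell_eqI: "cell B P k k' \<chi> \<Longrightarrow> cell B P k k' \<chi>' \<Longrightarrow>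
      (\<And>x. x \<in> V \<Longrightarrow> \<chi> \<triangleleft> m x = \<chi>' \<triangleleft> m x) \<Longrightarrow> \<chi> = \<chi>'"

section \<open>Arrow objects, and conditions on 1-cells classified by embeddings\<close>

context two_category
begin

lemma strict_arrow_object_lift:
  assumes Y: "strict_arrow_object C X Y \<delta>" and \<alpha>: "cell B X f g \<alpha>"
  shows "\<exists>!h. in_hom C h B Y \<and> h \<triangleright> \<delta> = \<alpha>"
proof -
  have B: "B \<in> Ob C" using \<alpha> by (auto simp: cell_def in_hom_def)
  note iso = Y[unfolded strict_arrow_object_def, THEN conjunct2, THEN conjunct2, rule_format, OF B]
  have "\<alpha> \<in> Ob (arrow_cat (hom_cat C B X))"
    using \<alpha> by (auto simp: arrow_cat_def Ar_hom_cat) (auto simp: cell_def in_hom_def)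
  from is_cat_iso_Ob[OF iso this] show ?thesis by simp
qed

lemma strict_arrow_object_cell:
  assumes Y: "strict_arrow_object C X Y \<delta>" and \<delta>: "cell Y X s t \<delta>"
    and h: "in_hom C h B Y" "in_hom C h' B Y"
    and uv: "cell B X (h \<cdot> s) (h' \<cdot> s) u" "cell B X (h \<cdot> t) (h' \<cdot> t) v"
    and eq: "u \<bullet> (h' \<triangleright> \<delta>) = (h \<triangleright> \<delta>) \<bullet> v"
  shows "\<exists>!\<chi>. cell B Y h h' \<chi> \<and> \<chi> \<triangleleft> s = u \<and> \<chi> \<triangleleft> t = v"
proof -
  have B: "B \<in> Ob C" using h by (auto simp: in_hom_def)
  note iso = Y[unfolded strict_arrow_object_def, THEN conjunct2, THEN conjunct2, rule_format, OF B]
  have st: "Dom (Cells C) \<delta> = s" "Cod (Cells C) \<delta> = t" using \<delta> by (auto simp: cell_def in_hom_def)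
  have c: "cell B X (h \<cdot> s) (h \<cdot> t) (h \<triangleright> \<delta>)" "cell B X (h' \<cdot> s) (h' \<cdot> t) (h' \<triangleright> \<delta>)"
    using h \<delta> by blast+
  then have "in_hom (arrow_cat (hom_cat C B X)) (h \<triangleright> \<delta>, u, v, h' \<triangleright> \<delta>) (h \<triangleright> \<delta>) (h' \<triangleright> \<delta>)"
    using uv eq by (simp add: arrow_cat_def in_hom_def[of "\<lparr>Ob = _, Ar = _, Dom = _, Cod = _, Idn = _, Comp = _\<rparr>"] Ar_hom_cat)
      (auto simp: cell_def in_hom_def)
  then have "\<exists>!\<chi>. in_hom (hom_cat C B Y) \<chi> h h' \<and>
      (Dom (Cells C) \<chi> \<triangleright> \<delta>, \<chi> \<triangleleft> s, \<chi> \<triangleleft> t, Cod (Cells C) \<chi> \<triangleright> \<delta>) = (h \<triangleright> \<delta>, u, v, h' \<triangleright> \<delta>)"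
    using is_cat_iso_hom[OF iso, of h h' "(h \<triangleright> \<delta>, u, v, h' \<triangleright> \<delta>)"] h by (simp add: st)
  moreover have "Dom (Cells C) \<chi> = h \<and> Cod (Cells C) \<chi> = h'" if "cell B Y h h' \<chi>" for \<chi>
    using that by (simp add: cell_def in_hom_def)
  ultimately show ?thesis by (simp cong: conj_cong)
qed

definition classifies :: "'o \<Rightarrow> 'o \<Rightarrow> 'm \<Rightarrow> ('m \<Rightarrow> bool) \<Rightarrow> bool" where
  "classifies Q P i S \<longleftrightarrow> embedding C Q P i \<and>
    (\<forall>B k. in_hom C k B P \<longrightarrow> (S k \<longleftrightarrow> (\<exists>k'. in_hom C k' B Q \<and> k' \<cdot> i = k)))"

text \<open>A classifier is demanded after every base change \<open>j\<close>, and not over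
  \<open>P\<close> alone. This is what makes conjunctions work: the next condition is classified
  over the classifier of the previous one.\<close>

definition classifiable :: "'o \<Rightarrow> ('m \<Rightarrow> bool) \<Rightarrow> bool" where
  "classifiable P S \<longleftrightarrow> (\<forall>A j. in_hom C j A P \<longrightarrow> (\<exists>Q i. classifies Q A i (\<lambda>k. S (k \<cdot> j))))"

lemma classifiesD:
  assumes "classifies Q P i S"
  shows "embedding C Q P i" "in_hom C i Q P"
    and "in_hom C k B P \<Longrightarrow> S k \<Longrightarrow> \<exists>k'. in_hom C k' B Q \<and> k' \<cdot> i = k"
    and "in_hom C k' B Q \<Longrightarrow> S (k' \<cdot> i)"
proof -
  show e: "embedding C Q P i" using assms by (simp add: classifies_def)
  show i: "in_hom C i Q P" by (rule embedding.arr[OF e])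
  show "\<exists>k'. in_hom C k' B Q \<and> k' \<cdot> i = k" if "in_hom C k B P" "S k"
    using assms that unfolding classifies_def by blast
  show "S (k' \<cdot> i)" if "in_hom C k' B Q"
    using assms that i unfolding classifies_def by blast
qed

lemma classifiesI:
  assumes "embedding C Q P i"
    and "\<And>B k. in_hom C k B P \<Longrightarrow> S k \<Longrightarrow> \<exists>k'. in_hom C k' B Q \<and> k' \<cdot> i = k"
    and "\<And>B k'. in_hom C k' B Q \<Longrightarrow> S (k' \<cdot> i)"
  shows "classifies Q P i S"
  using assms unfolding classifies_def by metis

lemma classifies_cong:
  assumes "classifies Q P i S" and "\<And>B k. in_hom C k B P \<Longrightarrow> S k \<longleftrightarrow> S' k"
  shows "classifies Q P i S'"
  using assms unfolding classifies_def by simp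

lemma classifiable_cong:
  assumes S: "classifiable P S" and eq: "\<And>B k. in_hom C k B P \<Longrightarrow> S k \<longleftrightarrow> S' k"
  shows "classifiable P S'"
  unfolding classifiable_def
proof (intro allI impI)
  fix A j assume j: "in_hom C j A P"
  then obtain Q i where "classifies Q A i (\<lambda>k. S (k \<cdot> j))"
    using S unfolding classifiable_def by blast
  then have "classifies Q A i (\<lambda>k. S' (k \<cdot> j))"
    by (rule classifies_cong) (use j eq in blast)
  then show "\<exists>Q i. classifies Q A i (\<lambda>k. S' (k \<cdot> j))" by blast
qed

lemma classifiable_precomp:
  assumes S: "classifiable N S" and j: "in_hom C j P N"
  shows "classifiable P (\<lambda>k. S (k \<cdot> j))"
  unfolding classifiable_def
proof (intro allI impI)
  fix A l assume l: "in_hom C l A P"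
  then obtain Q i where "classifies Q A i (\<lambda>k. S (k \<cdot> l \<cdot> j))"
    using S hom1_Comp[OF l j] unfolding classifiable_def by blast
  then have "classifies Q A i (\<lambda>k. S ((k \<cdot> l) \<cdot> j))"
    by (rule classifies_cong) (simp only: Comp_assoc[OF _ l j])
  then show "\<exists>Q i. classifies Q A i (\<lambda>k. S ((k \<cdot> l) \<cdot> j))" by blast
qed

lemma classifiable_classifies:
  assumes "classifiable P S" "P \<in> Ob C"
  obtains Q i where "classifies Q P i S"
proof -
  have P: "in_hom C (Idn C P) P P" using assms(2) by (rule Idn_in_hom)
  then obtain Q i where "classifies Q P i (\<lambda>k. S (k \<cdot> Idn C P))"
    using assms(1) unfolding classifiable_def by blast
  then have "classifies Q P i S" by (rule classifies_cong) (simp only: Comp_Idn_right)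
  then show thesis by (rule that)
qed

lemma embedding_Idn: "A \<in> Ob C \<Longrightarrow> embedding C A A (Idn C A)"
proof unfold_locales
  fix B k k' \<phi> assume "in_hom C k B A" "in_hom C k' B A" "cell B A (k \<cdot> Idn C A) (k' \<cdot> Idn C A) \<phi>"
  then show "\<exists>\<psi>. cell B A k k' \<psi> \<and> \<psi> \<triangleleft> Idn C A = \<phi>"
    by (intro exI[of _ \<phi>]) (auto simp: cell_def in_hom_def)
qed (auto simp: cell_def in_hom_def)

lemma embedding_comp:
  assumes i: "embedding C R Q i" and j: "embedding C Q P j"
  shows "embedding C R P (i \<cdot> j)"
proof -
  interpret i: embedding C R Q i by (rule i)
  interpret j: embedding C Q P j by (rule j)
  show ?thesis
  proof unfold_locales
    show "in_hom C (i \<cdot> j) R P" using i.arr j.arr by blast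
  next
    fix B k k' assume k: "in_hom C k B R" "in_hom C k' B R" and eq: "k \<cdot> i \<cdot> j = k' \<cdot> i \<cdot> j"
    have "(k \<cdot> i) \<cdot> j = (k' \<cdot> i) \<cdot> j"
      unfolding Comp_assoc[OF k(1) i.arr j.arr] Comp_assoc[OF k(2) i.arr j.arr] by (rule eq)
    then show "k = k'" using k i.arr i.eqI j.eqI by blast
  next
    fix B k k' \<phi> assume k: "in_hom C k B R" "in_hom C k' B R"
      and \<phi>: "cell B P (k \<cdot> i \<cdot> j) (k' \<cdot> i \<cdot> j) \<phi>"
    obtain \<chi> where \<chi>: "cell B Q (k \<cdot> i) (k' \<cdot> i) \<chi>" "\<chi> \<triangleleft> j = \<phi>"
      using j.lift_cell[of "k \<cdot> i" B "k' \<cdot> i" \<phi>] \<phi> k i.arr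
        Comp_assoc[OF k(1) i.arr j.arr] Comp_assoc[OF k(2) i.arr j.arr] by auto
    then obtain \<psi> where "cell B R k k' \<psi>" "\<psi> \<triangleleft> i = \<chi>" using i.lift_cell k by blast
    then show "\<exists>\<psi>. cell B R k k' \<psi> \<and> \<psi> \<triangleleft> (i \<cdot> j) = \<phi>"
      using rwhisk_rwhisk[OF _ i.arr j.arr] \<chi>(2) by auto
  next
    fix B k k' \<psi> \<psi>' assume \<psi>: "cell B R k k' \<psi>" "cell B R k k' \<psi>'" "\<psi> \<triangleleft> (i \<cdot> j) = \<psi>' \<triangleleft> (i \<cdot> j)"
    then have "\<psi> \<triangleleft> i \<triangleleft> j = \<psi>' \<triangleleft> i \<triangleleft> j" using rwhisk_rwhisk[OF _ i.arr j.arr] by simp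
    then show "\<psi> = \<psi>'" using \<psi>(1,2) i.arr i.cell_eqI j.cell_eqI by blast
  qed
qed

text \<open>Fullness lifts the inverse, and faithfulness lifts the two equations that it
  satisfies.\<close>

lemma embedding_reflects_iso:
  assumes i: "embedding C Q P i" and \<psi>: "cell B Q k k' \<psi>" and iso: "is_iso (Cells C) (\<psi> \<triangleleft> i)"
  shows "is_iso (Cells C) \<psi>"
proof -
  interpret i: embedding C Q P i by (rule i)
  have k: "in_hom C k B Q" "in_hom C k' B Q" using \<psi> by (auto simp: cell_def)
  obtain \<phi> where \<phi>: "cell B P (k' \<cdot> i) (k \<cdot> i) \<phi>" "(\<psi> \<triangleleft> i) \<bullet> \<phi> = id2 (k \<cdot> i)"
    "\<phi> \<bullet> (\<psi> \<triangleleft> i) = id2 (k' \<cdot> i)"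
    using iso_cell_inverse[OF iso cell_rwhisk[OF \<psi> i.arr]] by metis
  obtain \<chi> where \<chi>: "cell B Q k' k \<chi>" "\<chi> \<triangleleft> i = \<phi>" using i.lift_cell[OF k(2,1) \<phi>(1)] by blast
  have "\<psi> \<bullet> \<chi> = id2 k"
    by (rule i.cell_eqI[OF cell_vcomp[OF \<psi> \<chi>(1)] cell_id2[OF k(1)]])
      (simp only: cell_vcomp_rwhisk[OF \<psi> \<chi>(1) i.arr] rwhisk_id2_hom[OF k(1) i.arr] \<chi>(2) \<phi>)
  moreover have "\<chi> \<bullet> \<psi> = id2 k'"
    by (rule i.cell_eqI[OF cell_vcomp[OF \<chi>(1) \<psi>] cell_id2[OF k(2)]])
      (simp only: cell_vcomp_rwhisk[OF \<chi>(1) \<psi> i.arr] rwhisk_id2_hom[OF k(2) i.arr] \<chi>(2) \<phi>)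
  ultimately show ?thesis using \<psi> \<chi>(1) vert.is_isoI unfolding cell_def by blast
qed

lemma classifiable_True: "classifiable P (\<lambda>k. True)"
  unfolding classifiable_def
proof (intro allI impI)
  fix A j assume "in_hom C j A P"
  then have A: "A \<in> Ob C" by (auto simp: in_hom_def)
  have "classifies A A (Idn C A) (\<lambda>k. True)"
    using embedding_Idn[OF A] Comp_Idn_right by (intro classifiesI) blast+
  then show "\<exists>Q i. classifies Q A i (\<lambda>k. True)" by blast
qed

text \<open>The second condition is restricted to the classifier \<open>Q\<close> of the first and
  classified there; the composite of the two embeddings classifies both.\<close>

lemma classifiable_conj:
  assumes S: "classifiable P S" and S': "classifiable P S'"
  shows "classifiable P (\<lambda>k. S k \<and> S' k)"
  unfolding classifiable_def
proof (intro allI impI)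
  fix A j assume j: "in_hom C j A P"
  obtain Q i where i: "classifies Q A i (\<lambda>k. S (k \<cdot> j))"
    using S j unfolding classifiable_def by blast
  note iA = classifiesD(2)[OF i]
  obtain R r where r: "classifies R Q r (\<lambda>k. S' (k \<cdot> i \<cdot> j))"
    using S' hom1_Comp[OF iA j] unfolding classifiable_def by blast
  note rQ = classifiesD(2)[OF r]
  have "classifies R A (r \<cdot> i) (\<lambda>k. S (k \<cdot> j) \<and> S' (k \<cdot> j))"
  proof (rule classifiesI)
    show "embedding C R A (r \<cdot> i)"
      using embedding_comp classifiesD(1)[OF i] classifiesD(1)[OF r] by blast
  next
    fix B k assume k: "in_hom C k B A" and SS: "S (k \<cdot> j) \<and> S' (k \<cdot> j)"
    obtain k1 where k1: "in_hom C k1 B Q" "k1 \<cdot> i = k" using classifiesD(3)[OF i k] SS by blast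
    have "S' (k1 \<cdot> i \<cdot> j)" using SS Comp_assoc[OF k1(1) iA j] k1(2) by simp
    then obtain k2 where k2: "in_hom C k2 B R" "k2 \<cdot> r = k1" using classifiesD(3)[OF r k1(1)] by blast
    then show "\<exists>k'. in_hom C k' B R \<and> k' \<cdot> r \<cdot> i = k"
      using Comp_assoc[OF k2(1) rQ iA] k1(2) by auto
  next
    fix B k assume k: "in_hom C k B R"
    have "S ((k \<cdot> r) \<cdot> i \<cdot> j)" "S' ((k \<cdot> r) \<cdot> i \<cdot> j)"
      using classifiesD(4)[OF i hom1_Comp[OF k rQ]] classifiesD(4)[OF r k]
        Comp_assoc[OF hom1_Comp[OF k rQ] iA j] by simp_all
    then show "S ((k \<cdot> r \<cdot> i) \<cdot> j) \<and> S' ((k \<cdot> r \<cdot> i) \<cdot> j)"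
      using Comp_assoc[OF hom1_Comp[OF k rQ] iA j] Comp_assoc[OF k rQ iA] by simp
  qed
  then show "\<exists>Q i. classifies Q A i (\<lambda>k. S (k \<cdot> j) \<and> S' (k \<cdot> j))" by blast
qed

lemma classifiable_Ball:
  assumes "finite N" and "\<And>n. n \<in> N \<Longrightarrow> classifiable P (S n)"
  shows "classifiable P (\<lambda>k. \<forall>n \<in> N. S n k)"
  using assms by (induction N) (simp_all add: classifiable_True classifiable_conj)

end

section \<open>Products, inserters, equifiers and inverters in a pita 2-category\<close>

locale pita_category = two_category C for C :: "('o, 'm, 'c) twocat" +
  assumes pita: "pita C"
begin

lemma terminal_object:
  obtains T where "T \<in> Ob C" "\<And>A. A \<in> Ob C \<Longrightarrow> \<exists>f. in_hom C f A T"
    "\<And>A f g. in_hom C f A T \<Longrightarrow> in_hom C g A T \<Longrightarrow> f = g"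
    "\<And>A f g \<phi> \<psi>. cell A T f g \<phi> \<Longrightarrow> cell A T f g \<psi> \<Longrightarrow> \<phi> = \<psi>"
proof -
  obtain T where T: "T \<in> Ob C" "\<And>A. A \<in> Ob C \<Longrightarrow> one_morphism_category (hom_cat C A T)"
    using pita unfolding pita_def strict_terminal_def by blast
  have *: "\<exists>f. {f. in_hom C f A T} = {f}" "\<exists>a. Ar (hom_cat C A T) = {a}" if "A \<in> Ob C" for A
    using T(2)[OF that] unfolding one_morphism_category_def by auto
  show thesis
  proof (rule that[of T])
    show "T \<in> Ob C" by (rule T)
    show "\<exists>f. in_hom C f A T" if "A \<in> Ob C" for A using *(1)[OF that] by blast
    show "f = g" if "in_hom C f A T" "in_hom C g A T" for A f g
    proof -
      have "A \<in> Ob C" using that by (auto simp: in_hom_def)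
      then obtain x where "{f. in_hom C f A T} = {x}" using *(1) by metis
      then show ?thesis using that by (simp add: set_eq_iff)
    qed
    show "\<phi> = \<psi>" if c: "cell A T f g \<phi>" "cell A T f g \<psi>" for A f g \<phi> \<psi>
    proof -
      have "A \<in> Ob C" using c by (auto simp: cell_def in_hom_def)
      then obtain a where "Ar (hom_cat C A T) = {a}" using *(2) by metis
      moreover have "\<phi> \<in> Ar (hom_cat C A T)" "\<psi> \<in> Ar (hom_cat C A T)"
        using c by (auto simp: Ar_hom_cat) (auto simp: cell_def in_hom_def)
      ultimately show ?thesis by auto
    qed
  qed
qed

lemma isofibration_pullback:
  assumes "isofibration C f" "in_hom C f Y Z" "in_hom C g A Z"
  obtains P p q where "strict_pullback C (p, q, f, g)" "in_hom C p P Y" "in_hom C q P A"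
    "p \<cdot> f = q \<cdot> g" "Dom C p = P" "Dom C f = Y" "Dom C g = A"
proof -
  obtain p q where pb: "strict_pullback C (p, q, f, g)"
  proof -
    have "g \<in> Ar C" "Cod C g = Cod C f" using assms by (auto simp: in_hom_def)
    then show thesis using pita assms(1) that unfolding pita_def by blast
  qed
  then have sq: "commutative_square C (p, q, f, g)" by (simp add: strict_pullback_def)
  show thesis
    using sq assms by (intro that[OF pb, of "Dom C p"]) (auto simp: commutative_square_def in_hom_def)
qed

text \<open>A product is a pullback over the terminal object. The map from \<open>U\<close> to it is
  an isofibration because every 2-cell into a terminal object is an identity, so an identity of
  \<open>k\<close> lifts it. The compatibility required of pairs of 1-cells or 2-cells is automatic
  there.\<close>

lemma product_exists:
  assumes U: "U \<in> Ob C" and V: "V \<in> Ob C"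
  obtains P p q where "binary_product C U V P p q"
proof -
  obtain T where T: "\<And>A. A \<in> Ob C \<Longrightarrow> \<exists>f. in_hom C f A T"
    "\<And>A f g. in_hom C f A T \<Longrightarrow> in_hom C g A T \<Longrightarrow> f = g"
    "\<And>A f g \<phi> \<psi>. cell A T f g \<phi> \<Longrightarrow> cell A T f g \<psi> \<Longrightarrow> \<phi> = \<psi>"
    using terminal_object by metis
  obtain f g where f: "in_hom C f U T" and g: "in_hom C g V T" using T(1) U V by blast
  have "isofibration C f"
  proof (rule isofibrationI[OF f])
    fix A k l b assume k: "in_hom C k A U" and b: "cell A T (k \<cdot> f) l b"
    have "l = k \<cdot> f" using b T(2) unfolding cell_def by blast
    moreover have "cell A T (k \<cdot> f) (k \<cdot> f) (id2 k \<triangleleft> f)" using k f by blast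
    ultimately have "id2 k \<triangleleft> f = b" using b T(3) by blast
    moreover have "is_iso (Cells C) (id2 k)"
      using k by (intro vert.is_isoI[of _ k k "id2 k"]) (auto simp: in_hom_def)
    ultimately show "\<exists>k' a. cell A U k k' a \<and> is_iso (Cells C) a \<and> a \<triangleleft> f = b" using k by blast
  qed
  then obtain P p q where pb: "strict_pullback C (p, q, f, g)" and D: "Dom C p = P" "Dom C f = U" "Dom C g = V"
    and p: "in_hom C p P U" and q: "in_hom C q P V"
    using isofibration_pullback[OF _ f g] by metis
  have "binary_product C U V P p q"
  proof unfold_locales
    show "in_hom C p P U" "in_hom C q P V" by fact+
  next
    fix B x y assume xy: "in_hom C x B U" "in_hom C y B V"
    then have "x \<cdot> f = y \<cdot> g" using f g T(2) by blast
    then show "\<exists>h. in_hom C h B P \<and> h \<cdot> p = x \<and> h \<cdot> q = y"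
      using strict_pullback_lift[OF pb, of x B y] xy unfolding D by blast
  next
    fix B h h' assume "in_hom C h B P" "in_hom C h' B P" "h \<cdot> p = h' \<cdot> p" "h \<cdot> q = h' \<cdot> q"
    then show "h = h'" using strict_pullback_eqI[OF pb, of h B h'] unfolding D by blast
  next
    fix B h h' \<phi> \<psi>
    assume h: "in_hom C h B P" "in_hom C h' B P"
      and c: "cell B U (h \<cdot> p) (h' \<cdot> p) \<phi>" "cell B V (h \<cdot> q) (h' \<cdot> q) \<psi>"
    have "h \<cdot> p \<cdot> f = h \<cdot> q \<cdot> g" "h' \<cdot> p \<cdot> f = h' \<cdot> q \<cdot> g"
      using T(2) h p q f g by blast+
    then have "cell B T (h \<cdot> q \<cdot> g) (h' \<cdot> q \<cdot> g) (\<phi> \<triangleleft> f)" "cell B T (h \<cdot> q \<cdot> g) (h' \<cdot> q \<cdot> g) (\<psi> \<triangleleft> g)"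
      using cell_rwhisk[OF c(1) f] cell_rwhisk[OF c(2) g] h p q f g by (simp_all add: in_hom_def)
    then have "\<phi> \<triangleleft> f = \<psi> \<triangleleft> g" using T(3) by blast
    then show "\<exists>\<chi>. cell B P h h' \<chi> \<and> \<chi> \<triangleleft> p = \<phi> \<and> \<chi> \<triangleleft> q = \<psi>"
      using strict_pullback_cell[OF pb, of h B h' \<phi> \<psi>] h c unfolding D by blast
  next
    fix B h h' \<chi> \<chi>' assume c: "cell B P h h' \<chi>" "cell B P h h' \<chi>'"
      and eq: "\<chi> \<triangleleft> p = \<chi>' \<triangleleft> p" "\<chi> \<triangleleft> q = \<chi>' \<triangleleft> q"
    show "\<chi> = \<chi>'"
      using strict_pullback_cell_eqI[OF pb, of B h h' \<chi> \<chi>'] c eq unfolding D by blast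
  qed
  then show thesis by (rule that)
qed

text \<open>Invert the naturality square of \<chi>: the inverses \<open>u\<close> and
  \<open>v\<close> of its two ends again form a commuting square, hence come from a 2-cell \<psi>.
  Both composites of \<chi> and \<psi> have identity ends, and a 2-cell into an arrow object is
  determined by its ends.\<close>

lemma is_iso_arrow_object:
  assumes Y: "strict_arrow_object C X Y \<delta>" and \<delta>: "cell Y X s t \<delta>"
    and \<chi>: "cell B Y h h' \<chi>" and iso: "is_iso (Cells C) (\<chi> \<triangleleft> s)" "is_iso (Cells C) (\<chi> \<triangleleft> t)"
  shows "is_iso (Cells C) \<chi>"
proof -
  have st: "in_hom C s Y X" "in_hom C t Y X" and h: "in_hom C h B Y" "in_hom C h' B Y"
    using \<delta> \<chi> by (auto simp: cell_def)
  note cs = cell_rwhisk[OF \<chi> st(1)] and ct = cell_rwhisk[OF \<chi> st(2)]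
  obtain u where u: "cell B X (h' \<cdot> s) (h \<cdot> s) u" "(\<chi> \<triangleleft> s) \<bullet> u = id2 (h \<cdot> s)" "u \<bullet> (\<chi> \<triangleleft> s) = id2 (h' \<cdot> s)"
    using iso_cell_inverse[OF iso(1) cs] by metis
  obtain v where v: "cell B X (h' \<cdot> t) (h \<cdot> t) v" "(\<chi> \<triangleleft> t) \<bullet> v = id2 (h \<cdot> t)" "v \<bullet> (\<chi> \<triangleleft> t) = id2 (h' \<cdot> t)"
    using iso_cell_inverse[OF iso(2) ct] by metis
  have ch: "cell B X (h \<cdot> s) (h \<cdot> t) (h \<triangleright> \<delta>)" "cell B X (h' \<cdot> s) (h' \<cdot> t) (h' \<triangleright> \<delta>)"
    using h \<delta> by blast+
  have ex: "(\<chi> \<triangleleft> s) \<bullet> (h' \<triangleright> \<delta>) = (h \<triangleright> \<delta>) \<bullet> (\<chi> \<triangleleft> t)" by (rule whisk_exchange[OF \<chi> \<delta>])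
  have "(h' \<triangleright> \<delta>) \<bullet> v = u \<bullet> (\<chi> \<triangleleft> s) \<bullet> (h' \<triangleright> \<delta>) \<bullet> v"
    using u v(1) cs ch by (simp add: cell_def in_hom_def flip: vert.Comp_assoc_simp)
  also have "\<dots> = u \<bullet> ((\<chi> \<triangleleft> s) \<bullet> (h' \<triangleright> \<delta>)) \<bullet> v"
    using u(1) v(1) cs ch by (simp add: cell_def in_hom_def)
  also have "\<dots> = u \<bullet> (h \<triangleright> \<delta>) \<bullet> (\<chi> \<triangleleft> t) \<bullet> v"
    unfolding ex using u(1) v(1) ct ch by (simp add: cell_def in_hom_def)
  also have "\<dots> = u \<bullet> (h \<triangleright> \<delta>)"
    unfolding v(2) using ch by (simp add: cell_def in_hom_def)
  finally have "u \<bullet> (h \<triangleright> \<delta>) = (h' \<triangleright> \<delta>) \<bullet> v" ..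
  then obtain \<psi> where \<psi>: "cell B Y h' h \<psi>" "\<psi> \<triangleleft> s = u" "\<psi> \<triangleleft> t = v"
    using strict_arrow_object_cell[OF Y \<delta> h(2,1) u(1) v(1)] by blast
  have eqI: "\<alpha> = \<beta>" if "cell B Y k k' \<alpha>" "cell B Y k k' \<beta>" "\<alpha> \<triangleleft> s = \<beta> \<triangleleft> s" "\<alpha> \<triangleleft> t = \<beta> \<triangleleft> t" for k k' \<alpha> \<beta>
  proof -
    have k: "in_hom C k B Y" "in_hom C k' B Y" using that by (auto simp: cell_def)
    show ?thesis
      using strict_arrow_object_cell[OF Y \<delta> k cell_rwhisk[OF that(1) st(1)]
        cell_rwhisk[OF that(1) st(2)] whisk_exchange[OF that(1) \<delta>]] that by auto
  qed
  have "\<chi> \<bullet> \<psi> = id2 h"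
    by (rule eqI[OF cell_vcomp[OF \<chi> \<psi>(1)] cell_id2[OF h(1)]])
      (simp_all only: cell_vcomp_rwhisk[OF \<chi> \<psi>(1) st(1)] cell_vcomp_rwhisk[OF \<chi> \<psi>(1) st(2)]
        rwhisk_id2_hom[OF h(1) st(1)] rwhisk_id2_hom[OF h(1) st(2)] \<psi>(2,3) u(2) v(2))
  moreover have "\<psi> \<bullet> \<chi> = id2 h'"
    by (rule eqI[OF cell_vcomp[OF \<psi>(1) \<chi>] cell_id2[OF h(2)]])
      (simp_all only: cell_vcomp_rwhisk[OF \<psi>(1) \<chi> st(1)] cell_vcomp_rwhisk[OF \<psi>(1) \<chi> st(2)]
        rwhisk_id2_hom[OF h(2) st(1)] rwhisk_id2_hom[OF h(2) st(2)] \<psi>(2,3) u(3) v(3))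
  ultimately show ?thesis using \<chi> \<psi>(1) vert.is_isoI unfolding cell_def by blast
qed

text \<open>The pullback is that of \<open>d = (s, t)\<close> from the arrow object to
  \<open>X \<times> X\<close> along \<open>e = (f, g)\<close>. A 1-cell into it is some
  \<open>k\<close> into \<open>A\<close> together with a classified 2-cell whose ends are
  \<open>k \<cdot> f\<close> and \<open>k \<cdot> g\<close>.\<close>

lemma inserter_exists:
  assumes f: "in_hom C f A X" and g: "in_hom C g A X"
  obtains I i \<theta> where "inserter C A X f g I i \<theta>"
proof -
  have X: "X \<in> Ob C" using f by (auto simp: in_hom_def)
  obtain Y \<delta> where Y: "strict_arrow_object C X Y \<delta>" using pita X unfolding pita_def by blast
  define s t where "s = Dom (Cells C) \<delta>" and "t = Cod (Cells C) \<delta>"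
  have \<delta>: "cell Y X s t \<delta>" using Y by (simp add: strict_arrow_object_def Ar_hom_cat s_def t_def)
  have s: "in_hom C s Y X" and t: "in_hom C t Y X" using \<delta> by (auto simp: cell_def)
  obtain P \<pi> \<rho> where P: "binary_product C X X P \<pi> \<rho>" using product_exists[OF X X] .
  note \<pi> = binary_product.fst[OF P] and \<rho> = binary_product.snd[OF P]
  obtain d where d: "in_hom C d Y P" "d \<cdot> \<pi> = s" "d \<cdot> \<rho> = t" using binary_product.lift[OF P s t] by blast
  obtain e where e: "in_hom C e A P" "e \<cdot> \<pi> = f" "e \<cdot> \<rho> = g" using binary_product.lift[OF P f g] by blast
  have "isofibration C d"
  proof (rule isofibrationI[OF d(1)])
    fix B k l b assume k: "in_hom C k B Y" and b: "cell B P (k \<cdot> d) l b" "is_iso (Cells C) b"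
    have kd: "(k \<cdot> d) \<cdot> \<pi> = k \<cdot> s" "(k \<cdot> d) \<cdot> \<rho> = k \<cdot> t"
      using Comp_assoc[OF k d(1) \<pi>] Comp_assoc[OF k d(1) \<rho>] d by simp_all
    have l: "in_hom C l B P" using b by (simp add: cell_def)
    define u v where "u = b \<triangleleft> \<pi>" and "v = b \<triangleleft> \<rho>"
    have u: "cell B X (k \<cdot> s) (l \<cdot> \<pi>) u" and v: "cell B X (k \<cdot> t) (l \<cdot> \<rho>) v"
      using cell_rwhisk[OF b(1) \<pi>] cell_rwhisk[OF b(1) \<rho>] by (simp_all add: kd u_def v_def)
    have iso: "is_iso (Cells C) u" "is_iso (Cells C) v"
      unfolding u_def v_def using is_iso_rwhisk[OF b(2,1)] \<pi> \<rho> by blast+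
    obtain w where w: "cell B X (l \<cdot> \<pi>) (k \<cdot> s) w" "u \<bullet> w = id2 (k \<cdot> s)"
      using iso_cell_inverse[OF iso(1) u] by metis
    have c: "cell B X (k \<cdot> s) (k \<cdot> t) (k \<triangleright> \<delta>)" using k \<delta> by blast
    \<comment> \<open>An invertible \<open>b\<close> consists of invertible \<open>u\<close> and
      \<open>v\<close> at the two ends. Conjugating the classified 2-cell by them gives the new one,
      and \<open>(u, v)\<close> is then a commuting square between the two, that is, a 2-cell \<chi>
      over \<open>b\<close>.\<close>
    have "cell B X (l \<cdot> \<pi>) (l \<cdot> \<rho>) (w \<bullet> (k \<triangleright> \<delta>) \<bullet> v)" using w(1) c v by blast
    then obtain k' where k': "in_hom C k' B Y" "k' \<triangleright> \<delta> = w \<bullet> (k \<triangleright> \<delta>) \<bullet> v"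
      and c': "cell B X (l \<cdot> \<pi>) (l \<cdot> \<rho>) (k' \<triangleright> \<delta>)"
      using strict_arrow_object_lift[OF Y] by metis
    have k'st: "k' \<cdot> s = l \<cdot> \<pi>" "k' \<cdot> t = l \<cdot> \<rho>"
      using cell_unique_ends[OF c' cell_lwhisk[OF k'(1) \<delta>]] by simp_all
    have "u \<bullet> (k' \<triangleright> \<delta>) = (u \<bullet> w) \<bullet> (k \<triangleright> \<delta>) \<bullet> v"
      unfolding k'(2) using u v w(1) c by (simp add: cell_def in_hom_def)
    also have "\<dots> = (k \<triangleright> \<delta>) \<bullet> v" unfolding w(2) using c v by (simp add: cell_def in_hom_def)
    finally obtain \<chi> where \<chi>: "cell B Y k k' \<chi>" "\<chi> \<triangleleft> s = u" "\<chi> \<triangleleft> t = v"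
      using strict_arrow_object_cell[OF Y \<delta> k k'(1)] u v k'st by metis
    have "k' \<cdot> d = l"
    proof (rule binary_product.eqI[OF P _ l])
      show "in_hom C (k' \<cdot> d) B P" using k' d by blast
      show "(k' \<cdot> d) \<cdot> \<pi> = l \<cdot> \<pi>" "(k' \<cdot> d) \<cdot> \<rho> = l \<cdot> \<rho>"
        using Comp_assoc[OF k'(1) d(1) \<pi>] Comp_assoc[OF k'(1) d(1) \<rho>] d k'st by simp_all
    qed
    then have "cell B P (k \<cdot> d) l (\<chi> \<triangleleft> d)" using cell_rwhisk[OF \<chi>(1) d(1)] by simp
    moreover have "\<chi> \<triangleleft> d \<triangleleft> \<pi> = b \<triangleleft> \<pi>" "\<chi> \<triangleleft> d \<triangleleft> \<rho> = b \<triangleleft> \<rho>"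
      using rwhisk_rwhisk[OF \<chi>(1) d(1) \<pi>] rwhisk_rwhisk[OF \<chi>(1) d(1) \<rho>] d \<chi>
      by (simp_all add: u_def v_def)
    ultimately have "\<chi> \<triangleleft> d = b" using binary_product.cell_eqI[OF P] b(1) by blast
    moreover have "is_iso (Cells C) \<chi>"
      using is_iso_arrow_object[OF Y \<delta> \<chi>(1)] iso \<chi> by simp
    ultimately show "\<exists>k' a. cell B Y k k' a \<and> is_iso (Cells C) a \<and> a \<triangleleft> d = b" using \<chi>(1) by blast
  qed
  then obtain I p q where pb: "strict_pullback C (p, q, d, e)" and p: "in_hom C p I Y"
    and q: "in_hom C q I A" and pq: "p \<cdot> d = q \<cdot> e" and D: "Dom C p = I" "Dom C d = Y" "Dom C e = A"
    using isofibration_pullback[OF _ d(1) e(1)] by metis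
  have ps: "p \<cdot> s = q \<cdot> f" "p \<cdot> t = q \<cdot> g"
    using Comp_assoc[OF p d(1) \<pi>] Comp_assoc[OF p d(1) \<rho>] Comp_assoc[OF q e(1) \<pi>]
      Comp_assoc[OF q e(1) \<rho>] d e pq by simp_all
  have hps: "(h \<cdot> p) \<cdot> s = (h \<cdot> q) \<cdot> f" "(h \<cdot> p) \<cdot> t = (h \<cdot> q) \<cdot> g" if "in_hom C h B I" for h B
    using Comp_assoc[OF that p s] Comp_assoc[OF that p t] Comp_assoc[OF that q f]
      Comp_assoc[OF that q g] ps by simp_all
  have hp\<delta>: "h \<triangleright> p \<triangleright> \<delta> = (h \<cdot> p) \<triangleright> \<delta>" if "in_hom C h B I" for h B
    using lwhisk_lwhisk[OF \<delta> that p] .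
  have "inserter C A X f g I q (p \<triangleright> \<delta>)"
  proof unfold_locales
    show "in_hom C q I A" by (rule q)
    show "cell I X (q \<cdot> f) (q \<cdot> g) (p \<triangleright> \<delta>)" using cell_lwhisk[OF p \<delta>] ps by simp
  next
    fix B k \<alpha> assume k: "in_hom C k B A" and \<alpha>: "cell B X (k \<cdot> f) (k \<cdot> g) \<alpha>"
    obtain y where y: "in_hom C y B Y" "y \<triangleright> \<delta> = \<alpha>" using strict_arrow_object_lift[OF Y \<alpha>] by blast
    have "y \<cdot> s = k \<cdot> f" "y \<cdot> t = k \<cdot> g"
      using cell_unique_ends[OF \<alpha>] cell_lwhisk[OF y(1) \<delta>] y(2) by auto
    then have "y \<cdot> d = k \<cdot> e"
      using binary_product.eqI[OF P hom1_Comp[OF y(1) d(1)] hom1_Comp[OF k e(1)]] Comp_assoc[OF y(1) d(1) \<pi>]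
        Comp_assoc[OF y(1) d(1) \<rho>] Comp_assoc[OF k e(1) \<pi>] Comp_assoc[OF k e(1) \<rho>] d e by simp
    then obtain h where "in_hom C h B I" "h \<cdot> p = y" "h \<cdot> q = k"
      using strict_pullback_lift[OF pb, of y B k] y(1) k unfolding D by blast
    then show "\<exists>h. in_hom C h B I \<and> h \<cdot> q = k \<and> h \<triangleright> p \<triangleright> \<delta> = \<alpha>" using hp\<delta> y(2) by auto
  next
    fix B h h' assume h: "in_hom C h B I" "in_hom C h' B I"
      and eq: "h \<cdot> q = h' \<cdot> q" "h \<triangleright> p \<triangleright> \<delta> = h' \<triangleright> p \<triangleright> \<delta>"
    have "h \<cdot> p = h' \<cdot> p"
      using strict_arrow_object_lift[OF Y cell_lwhisk[OF hom1_Comp[OF h(1) p] \<delta>]]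
        hp\<delta>[OF h(1)] hp\<delta>[OF h(2)] eq hom1_Comp[OF h(1) p] hom1_Comp[OF h(2) p] by auto
    then show "h = h'" using strict_pullback_eqI[OF pb, of h B h'] h eq unfolding D by blast
  next
    fix B h h' \<phi> assume h: "in_hom C h B I" "in_hom C h' B I" and \<phi>: "cell B A (h \<cdot> q) (h' \<cdot> q) \<phi>"
      and nat: "(\<phi> \<triangleleft> f) \<bullet> (h' \<triangleright> p \<triangleright> \<delta>) = (h \<triangleright> p \<triangleright> \<delta>) \<bullet> (\<phi> \<triangleleft> g)"
    note hp = hom1_Comp[OF h(1) p] hom1_Comp[OF h(2) p]
    obtain \<psi> where \<psi>: "cell B Y (h \<cdot> p) (h' \<cdot> p) \<psi>" "\<psi> \<triangleleft> s = \<phi> \<triangleleft> f" "\<psi> \<triangleleft> t = \<phi> \<triangleleft> g"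
      using strict_arrow_object_cell[OF Y \<delta> hp, of "\<phi> \<triangleleft> f" "\<phi> \<triangleleft> g"] cell_rwhisk[OF \<phi> f]
        cell_rwhisk[OF \<phi> g] hps[OF h(1)] hps[OF h(2)] hp\<delta>[OF h(1)] hp\<delta>[OF h(2)] nat by auto
    \<comment> \<open>A 2-cell into the pullback needs matching components in \<open>Y\<close> and
      \<open>A\<close>; their images in the product agree because both projections do.\<close>
    have eq: "(h \<cdot> p) \<cdot> d = (h \<cdot> q) \<cdot> e" "(h' \<cdot> p) \<cdot> d = (h' \<cdot> q) \<cdot> e"
      using Comp_assoc[OF h(1) p d(1)] Comp_assoc[OF h(2) p d(1)] Comp_assoc[OF h(1) q e(1)]
        Comp_assoc[OF h(2) q e(1)] pq by simp_all
    have "\<psi> \<triangleleft> d = \<phi> \<triangleleft> e"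
    proof (rule binary_product.cell_eqI[OF P])
      show "cell B P ((h \<cdot> q) \<cdot> e) ((h' \<cdot> q) \<cdot> e) (\<psi> \<triangleleft> d)" using cell_rwhisk[OF \<psi>(1) d(1)] eq by simp
      show "cell B P ((h \<cdot> q) \<cdot> e) ((h' \<cdot> q) \<cdot> e) (\<phi> \<triangleleft> e)" by (rule cell_rwhisk[OF \<phi> e(1)])
      show "\<psi> \<triangleleft> d \<triangleleft> \<pi> = \<phi> \<triangleleft> e \<triangleleft> \<pi>" "\<psi> \<triangleleft> d \<triangleleft> \<rho> = \<phi> \<triangleleft> e \<triangleleft> \<rho>"
        using rwhisk_rwhisk[OF \<psi>(1) d(1) \<pi>] rwhisk_rwhisk[OF \<psi>(1) d(1) \<rho>]
          rwhisk_rwhisk[OF \<phi> e(1) \<pi>] rwhisk_rwhisk[OF \<phi> e(1) \<rho>] \<psi> d e by simp_all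
    qed
    then show "\<exists>\<chi>. cell B I h h' \<chi> \<and> \<chi> \<triangleleft> q = \<phi>"
      using strict_pullback_cell[OF pb, of h B h' \<psi> \<phi>] h \<psi>(1) \<phi> unfolding D by blast
  next
    fix B h h' \<chi> \<chi>' assume \<chi>: "cell B I h h' \<chi>" "cell B I h h' \<chi>'" and eq: "\<chi> \<triangleleft> q = \<chi>' \<triangleleft> q"
    \<comment> \<open>The component in the arrow object is determined by its two ends, and these are
      whiskerings of the component in \<open>A\<close>.\<close>
    have \<chi>ps: "\<alpha> \<triangleleft> p \<triangleleft> s = \<alpha> \<triangleleft> q \<triangleleft> f" "\<alpha> \<triangleleft> p \<triangleleft> t = \<alpha> \<triangleleft> q \<triangleleft> g" if "cell B I h h' \<alpha>" for \<alpha>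
      using rwhisk_rwhisk[OF that p s] rwhisk_rwhisk[OF that p t] rwhisk_rwhisk[OF that q f]
        rwhisk_rwhisk[OF that q g] ps by simp_all
    have h: "in_hom C (h \<cdot> p) B Y" "in_hom C (h' \<cdot> p) B Y" using \<chi>(1) p by (auto simp: cell_def)
    have "\<chi> \<triangleleft> p = \<chi>' \<triangleleft> p"
      using strict_arrow_object_cell[OF Y \<delta> h cell_rwhisk[OF cell_rwhisk[OF \<chi>(1) p] s]
        cell_rwhisk[OF cell_rwhisk[OF \<chi>(1) p] t] whisk_exchange[OF cell_rwhisk[OF \<chi>(1) p] \<delta>]]
        cell_rwhisk[OF \<chi>(1) p] cell_rwhisk[OF \<chi>(2) p] \<chi>ps[OF \<chi>(1)] \<chi>ps[OF \<chi>(2)] eq by auto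
    then show "\<chi> = \<chi>'"
      using strict_pullback_cell_eqI[OF pb, of B h h' \<chi> \<chi>'] \<chi> eq unfolding D by blast
  qed
  then show thesis by (rule that)
qed

text \<open>Repleteness turns the embedding into an isofibration: the target of an invertible 2-cell
  out of the image lies in the image, fullness lifts the 2-cell, and embeddings reflect
  invertibility. Its pullback along any \<open>j\<close> then exists and is again an embedding,
  because the component in \<open>M\<close> is determined by the component in
  \<open>A\<close>.\<close>

lemma replete_classifiable:
  assumes m: "classifies M N m S"
    and replete: "\<And>B k k' \<phi>. cell B N k k' \<phi> \<Longrightarrow> is_iso (Cells C) \<phi> \<Longrightarrow> S k \<Longrightarrow> S k'"
  shows "classifiable N S"
  unfolding classifiable_def
proof (intro allI impI)
  fix A j assume j: "in_hom C j A N"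
  interpret m: embedding C M N m by (rule classifiesD(1)[OF m])
  have "isofibration C m"
  proof (rule isofibrationI[OF m.arr])
    fix B k l b assume k: "in_hom C k B M" and b: "cell B N (k \<cdot> m) l b" "is_iso (Cells C) b"
    have "S l" using replete[OF b] classifiesD(4)[OF m k] by blast
    moreover have "in_hom C l B N" using b(1) by (simp add: cell_def)
    ultimately obtain k' where k': "in_hom C k' B M" "k' \<cdot> m = l" using classifiesD(3)[OF m] by blast
    then obtain a where "cell B M k k' a" "a \<triangleleft> m = b" using m.lift_cell[OF k k'(1)] b(1) by blast
    then show "\<exists>k' a. cell B M k k' a \<and> is_iso (Cells C) a \<and> a \<triangleleft> m = b"
      using embedding_reflects_iso[OF classifiesD(1)[OF m]] b(2) by blast
  qed
  then obtain E p q where pb: "strict_pullback C (p, q, m, j)" and p: "in_hom C p E M"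
    and q: "in_hom C q E A" and pq: "p \<cdot> m = q \<cdot> j" and D: "Dom C p = E" "Dom C m = M" "Dom C j = A"
    using isofibration_pullback[OF _ m.arr j] by metis
  have kpq: "(k \<cdot> p) \<cdot> m = (k \<cdot> q) \<cdot> j" if "in_hom C k B E" for k B
    using Comp_assoc[OF that p m.arr] Comp_assoc[OF that q j] pq by simp
  have "embedding C E A q"
  proof unfold_locales
    show "in_hom C q E A" by (rule q)
  next
    fix B k k' assume k: "in_hom C k B E" "in_hom C k' B E" and eq: "k \<cdot> q = k' \<cdot> q"
    have "k \<cdot> p = k' \<cdot> p"
      using m.eqI[OF hom1_Comp[OF k(1) p] hom1_Comp[OF k(2) p]] kpq[OF k(1)] kpq[OF k(2)] eq by simp
    then show "k = k'" using strict_pullback_eqI[OF pb, of k B k'] k eq unfolding D by blast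
  next
    fix B k k' \<phi> assume k: "in_hom C k B E" "in_hom C k' B E" and \<phi>: "cell B A (k \<cdot> q) (k' \<cdot> q) \<phi>"
    have "cell B N ((k \<cdot> p) \<cdot> m) ((k' \<cdot> p) \<cdot> m) (\<phi> \<triangleleft> j)"
      using cell_rwhisk[OF \<phi> j] kpq[OF k(1)] kpq[OF k(2)] by simp
    then obtain \<psi> where "cell B M (k \<cdot> p) (k' \<cdot> p) \<psi>" "\<psi> \<triangleleft> m = \<phi> \<triangleleft> j"
      using m.lift_cell[OF hom1_Comp[OF k(1) p] hom1_Comp[OF k(2) p]] by blast
    then show "\<exists>\<psi>. cell B E k k' \<psi> \<and> \<psi> \<triangleleft> q = \<phi>"
      using strict_pullback_cell[OF pb, of k B k' \<psi> \<phi>] k \<phi> unfolding D by blast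
  next
    fix B k k' \<psi> \<psi>' assume \<psi>: "cell B E k k' \<psi>" "cell B E k k' \<psi>'" and eq: "\<psi> \<triangleleft> q = \<psi>' \<triangleleft> q"
    have *: "\<chi> \<triangleleft> p \<triangleleft> m = \<chi> \<triangleleft> q \<triangleleft> j" if "cell B E k k' \<chi>" for \<chi>
      using rwhisk_rwhisk[OF that p m.arr] rwhisk_rwhisk[OF that q j] pq by simp
    have "\<psi> \<triangleleft> p = \<psi>' \<triangleleft> p"
      using m.cell_eqI[OF cell_rwhisk[OF \<psi>(1) p] cell_rwhisk[OF \<psi>(2) p]] *[OF \<psi>(1)] *[OF \<psi>(2)] eq
      by simp
    then show "\<psi> = \<psi>'" using strict_pullback_cell_eqI[OF pb, of B k k' \<psi> \<psi>'] \<psi> eq unfolding D by blast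
  qed
  then have "classifies E A q (\<lambda>k. S (k \<cdot> j))"
  proof (rule classifiesI)
    fix B k assume k: "in_hom C k B A" and S: "S (k \<cdot> j)"
    obtain k' where "in_hom C k' B M" "k' \<cdot> m = k \<cdot> j" using classifiesD(3)[OF m hom1_Comp[OF k j] S] by blast
    then show "\<exists>k'. in_hom C k' B E \<and> k' \<cdot> q = k"
      using strict_pullback_lift[OF pb, of k' B k] k unfolding D by blast
  next
    fix B k' assume k': "in_hom C k' B E"
    show "S ((k' \<cdot> q) \<cdot> j)" using classifiesD(4)[OF m hom1_Comp[OF k' p]] kpq[OF k'] by simp
  qed
  then show "\<exists>Q i. classifies Q A i (\<lambda>k. S (k \<cdot> j))" by blast
qed

text \<open>The diagonal \<open>d\<close> from the arrow object to the object of parallel pairs of 2-cells (an inserter)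
  is a replete embedding, whose pullback along a parallel pair of 2-cells is their equifier.\<close>

lemma classifiable_equifier:
  assumes \<alpha>: "cell P X f g \<alpha>" and \<beta>: "cell P X f g \<beta>"
  shows "classifiable P (\<lambda>k. k \<triangleright> \<alpha> = k \<triangleright> \<beta>)"
proof -
  have X: "X \<in> Ob C" using \<alpha> by (auto simp: cell_def in_hom_def)
  obtain Y \<delta> where Y: "strict_arrow_object C X Y \<delta>" using pita X unfolding pita_def by blast
  define s t where "s = Dom (Cells C) \<delta>" and "t = Cod (Cells C) \<delta>"
  have \<delta>: "cell Y X s t \<delta>" using Y by (simp add: strict_arrow_object_def Ar_hom_cat s_def t_def)
  have s: "in_hom C s Y X" and t: "in_hom C t Y X" using \<delta> by (auto simp: cell_def)
  \<comment> \<open>A 1-cell into \<open>I\<close> is a parallel pair of 2-cells: the one classified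
    by its \<open>i\<close>-component, and the one restricted from \<theta>. The condition
    \<open>S\<close> below says that the two agree.\<close>
  obtain I i \<theta> where I: "inserter C Y X s t I i \<theta>" using inserter_exists[OF s t] .
  interpret I: inserter C Y X s t I i \<theta> by (rule I)
  have Y1: "in_hom C (Idn C Y) Y Y" using s by (auto simp: in_hom_def)
  \<comment> \<open>\<open>d\<close> repeats \<delta> as both members of the pair. It is a section
    of \<open>i\<close>, which makes it injective on 1-cells and faithful.\<close>
  obtain d where d: "in_hom C d Y I" "d \<cdot> i = Idn C Y" "d \<triangleright> \<theta> = \<delta>"
    using I.lift[OF Y1, of \<delta>] \<delta> s t by (auto simp: in_hom_def)
  have kdi: "(k \<cdot> d) \<cdot> i = k" if "in_hom C k B Y" for k B
    using Comp_assoc[OF that d(1) I.proj] d(2) Comp_Idn_right[OF that] by simp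
  define S where "S k \<longleftrightarrow> (k \<cdot> i) \<triangleright> \<delta> = k \<triangleright> \<theta>" for k
  have "classifies Y I d S"
  proof (rule classifiesI)
    show "embedding C Y I d"
    proof unfold_locales
      show "in_hom C d Y I" by (rule d(1))
    next
      fix B k k' assume "in_hom C k B Y" "in_hom C k' B Y" "k \<cdot> d = k' \<cdot> d"
      then show "k = k'" using kdi by metis
    next
      fix B k k' \<phi> assume k: "in_hom C k B Y" "in_hom C k' B Y" and \<phi>: "cell B I (k \<cdot> d) (k' \<cdot> d) \<phi>"
      \<comment> \<open>As \<open>d\<close> is a section of \<open>i\<close>, the only candidate for
        a lift of \<phi> is \<open>\<phi> \<triangleleft> i\<close>; it works because 2-cells into
        an inserter are determined by their projection along \<open>i\<close>.\<close>
      have \<psi>: "cell B Y k k' (\<phi> \<triangleleft> i)" using cell_rwhisk[OF \<phi> I.proj] kdi k by simp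
      have "\<phi> \<triangleleft> i \<triangleleft> d \<triangleleft> i = \<phi> \<triangleleft> i"
        using rwhisk_rwhisk[OF \<psi> d(1) I.proj] d(2) \<psi> by (simp add: cell_def in_hom_def)
      then have "\<phi> \<triangleleft> i \<triangleleft> d = \<phi>" using I.cell_eqI[OF cell_rwhisk[OF \<psi> d(1)] \<phi>] by simp
      then show "\<exists>\<psi>. cell B Y k k' \<psi> \<and> \<psi> \<triangleleft> d = \<phi>" using \<psi> by blast
    next
      fix B k k' \<psi> \<psi>' assume \<psi>: "cell B Y k k' \<psi>" "cell B Y k k' \<psi>'" and eq: "\<psi> \<triangleleft> d = \<psi>' \<triangleleft> d"
      have "\<chi> \<triangleleft> d \<triangleleft> i = \<chi>" if "cell B Y k k' \<chi>" for \<chi>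
        using rwhisk_rwhisk[OF that d(1) I.proj] d(2) that by (simp add: cell_def in_hom_def)
      then show "\<psi> = \<psi>'" using \<psi> eq by metis
    qed
  next
    fix B k assume k: "in_hom C k B I" and S: "S k"
    have "(k \<cdot> i) \<cdot> d = k"
    proof (rule I.eqI[OF _ k])
      show "in_hom C ((k \<cdot> i) \<cdot> d) B I" using k I.proj d(1) by blast
      show "((k \<cdot> i) \<cdot> d) \<cdot> i = k \<cdot> i" by (rule kdi[OF hom1_Comp[OF k I.proj]])
      show "((k \<cdot> i) \<cdot> d) \<triangleright> \<theta> = k \<triangleright> \<theta>"
        using lwhisk_lwhisk[OF I.inserted hom1_Comp[OF k I.proj] d(1)] d(3) S by (simp add: S_def)
    qed
    then show "\<exists>k'. in_hom C k' B Y \<and> k' \<cdot> d = k" using k I.proj by blast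
  next
    fix B k' assume k': "in_hom C k' B Y"
    show "S (k' \<cdot> d)"
      unfolding S_def kdi[OF k'] using lwhisk_lwhisk[OF I.inserted k' d(1)] d(3) by simp
  qed
  then have S: "classifiable I S"
  proof (rule replete_classifiable)
    fix B k k' \<phi> assume \<phi>: "cell B I k k' \<phi>" "is_iso (Cells C) \<phi>" and S: "S k"
    have k: "in_hom C k B I" "in_hom C k' B I" using \<phi> by (auto simp: cell_def)
    note \<phi>i = cell_rwhisk[OF \<phi>(1) I.proj] and ki = hom1_Comp[OF k(1) I.proj] hom1_Comp[OF k(2) I.proj]
    note \<phi>is = cell_rwhisk[OF \<phi>i s]
    \<comment> \<open>Repleteness: \<phi> is natural with respect to both members of the pair. If
      they agree at \<open>k\<close>, they agree at \<open>k'\<close> after composition with an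
      invertible 2-cell, which cancels.\<close>
    have "(\<phi> \<triangleleft> i \<triangleleft> s) \<bullet> ((k' \<cdot> i) \<triangleright> \<delta>) = ((k \<cdot> i) \<triangleright> \<delta>) \<bullet> (\<phi> \<triangleleft> i \<triangleleft> t)"
      by (rule whisk_exchange[OF \<phi>i \<delta>])
    also have "\<dots> = (k \<triangleright> \<theta>) \<bullet> (\<phi> \<triangleleft> i \<triangleleft> t)" using S by (simp add: S_def)
    also have "\<dots> = (\<phi> \<triangleleft> i \<triangleleft> s) \<bullet> (k' \<triangleright> \<theta>)"
      using whisk_exchange[OF \<phi>(1) I.inserted] rwhisk_rwhisk[OF \<phi>(1) I.proj s]
        rwhisk_rwhisk[OF \<phi>(1) I.proj t] by simp
    finally have eq: "(\<phi> \<triangleleft> i \<triangleleft> s) \<bullet> ((k' \<cdot> i) \<triangleright> \<delta>) = (\<phi> \<triangleleft> i \<triangleleft> s) \<bullet> (k' \<triangleright> \<theta>)" .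
    have iso: "is_iso (Cells C) (\<phi> \<triangleleft> i \<triangleleft> s)"
      by (rule is_iso_rwhisk[OF is_iso_rwhisk[OF \<phi>(2,1) I.proj] \<phi>i s])
    have "cell B X ((k' \<cdot> i) \<cdot> s) ((k' \<cdot> i) \<cdot> t) ((k' \<cdot> i) \<triangleright> \<delta>)" by (rule cell_lwhisk[OF ki(2) \<delta>])
    moreover have "cell B X ((k' \<cdot> i) \<cdot> s) ((k' \<cdot> i) \<cdot> t) (k' \<triangleright> \<theta>)"
      using cell_lwhisk[OF k(2) I.inserted] Comp_assoc[OF k(2) I.proj s] Comp_assoc[OF k(2) I.proj t] by simp
    ultimately show "S k'"
      unfolding S_def using vert.iso_cancel_left[OF iso _ _ eq] \<phi>is by (simp add: cell_def in_hom_def)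
  qed
  obtain a where a: "in_hom C a P Y" "a \<triangleright> \<delta> = \<alpha>" using strict_arrow_object_lift[OF Y \<alpha>] by blast
  have "cell P X (a \<cdot> s) (a \<cdot> t) \<beta>"
    using cell_unique_ends[OF \<alpha>] cell_lwhisk[OF a(1) \<delta>] a(2) \<beta> by metis
  \<comment> \<open>\<open>b\<close> classifies the pair consisting of \<alpha> and \<beta>;
    restricting \<open>S\<close> along it gives the condition to be classified.\<close>
  then obtain b where b: "in_hom C b P I" "b \<cdot> i = a" "b \<triangleright> \<theta> = \<beta>" using I.lift[OF a(1)] by blast
  show ?thesis
  proof (rule classifiable_cong[OF classifiable_precomp[OF S b(1)]])
    fix B k assume k: "in_hom C k B P"
    show "S (k \<cdot> b) \<longleftrightarrow> k \<triangleright> \<alpha> = k \<triangleright> \<beta>"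
      unfolding S_def Comp_assoc[OF k b(1) I.proj] b(2) lwhisk_lwhisk[OF \<delta> k a(1), symmetric] a(2)
        lwhisk_lwhisk[OF I.inserted k b(1), symmetric] b(3) ..
  qed
qed

text \<open>Adding an inverse adds no data. Inverses are unique, so the projection to
  \<open>A\<close> is injective on 1-cells; and a 2-cell into \<open>A\<close>, which is natural
  with respect to \<alpha> by exchange, is also natural with respect to the inverses of \<alpha>, so
  it lifts.\<close>

lemma inverter_exists:
  assumes \<alpha>: "cell A X f g \<alpha>"
  shows "\<exists>Q i. classifies Q A i (\<lambda>k. is_iso (Cells C) (k \<triangleright> \<alpha>))"
proof -
  have f: "in_hom C f A X" and g: "in_hom C g A X" using \<alpha> by (auto simp: cell_def)
  \<comment> \<open>\<open>g\<close> comes before \<open>f\<close>: the inserted 2-cell runs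
    opposite to \<alpha>, as a candidate inverse.\<close>
  obtain I i \<theta> where I: "inserter C A X g f I i \<theta>" using inserter_exists[OF g f] .
  interpret I: inserter C A X g f I i \<theta> by (rule I)
  have i\<alpha>: "cell I X (i \<cdot> f) (i \<cdot> g) (i \<triangleright> \<alpha>)" by (rule cell_lwhisk[OF I.proj \<alpha>])
  have if1: "in_hom C (i \<cdot> f) I X" "in_hom C (i \<cdot> g) I X" using I.proj f g by blast+
  have I_ob: "I \<in> Ob C" using I.proj by (auto simp: in_hom_def)
  have cl: "classifiable I (\<lambda>k. k \<triangleright> ((i \<triangleright> \<alpha>) \<bullet> \<theta>) = k \<triangleright> id2 (i \<cdot> f) \<and> k \<triangleright> (\<theta> \<bullet> (i \<triangleright> \<alpha>)) = k \<triangleright> id2 (i \<cdot> g))"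
    by (intro classifiable_conj
      classifiable_equifier[OF cell_vcomp[OF i\<alpha> I.inserted] cell_id2[OF if1(1)]]
      classifiable_equifier[OF cell_vcomp[OF I.inserted i\<alpha>] cell_id2[OF if1(2)]])
  obtain R r where R: "classifies R I r
      (\<lambda>k. k \<triangleright> ((i \<triangleright> \<alpha>) \<bullet> \<theta>) = k \<triangleright> id2 (i \<cdot> f) \<and> k \<triangleright> (\<theta> \<bullet> (i \<triangleright> \<alpha>)) = k \<triangleright> id2 (i \<cdot> g))"
    (is "classifies R I r ?S") using classifiable_classifies[OF cl I_ob] .
  interpret r: embedding C R I r by (rule classifiesD(1)[OF R])
  have S: "?S h \<longleftrightarrow> ((h \<cdot> i) \<triangleright> \<alpha>) \<bullet> (h \<triangleright> \<theta>) = id2 ((h \<cdot> i) \<cdot> f) \<and>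
      (h \<triangleright> \<theta>) \<bullet> ((h \<cdot> i) \<triangleright> \<alpha>) = id2 ((h \<cdot> i) \<cdot> g)" if h: "in_hom C h B I" for h B
    unfolding cell_vcomp_lwhisk[OF i\<alpha> I.inserted h] cell_vcomp_lwhisk[OF I.inserted i\<alpha> h]
      lwhisk_lwhisk[OF \<alpha> h I.proj] lwhisk_id2_hom[OF h if1(1)] lwhisk_id2_hom[OF h if1(2)]
      Comp_assoc[OF h I.proj f] Comp_assoc[OF h I.proj g] ..
  have c\<theta>: "cell B X ((h \<cdot> i) \<cdot> g) ((h \<cdot> i) \<cdot> f) (h \<triangleright> \<theta>)" if h: "in_hom C h B I" for h B
    using cell_lwhisk[OF h I.inserted] Comp_assoc[OF h I.proj f] Comp_assoc[OF h I.proj g] by simp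
  have kr: "(k \<cdot> r) \<cdot> i = k \<cdot> r \<cdot> i" "in_hom C (k \<cdot> r) B I" if "in_hom C k B R" for k B
    using Comp_assoc[OF that r.arr I.proj] that r.arr by auto
  have "embedding C R A (r \<cdot> i)"
  proof unfold_locales
    show "in_hom C (r \<cdot> i) R A" using r.arr I.proj by blast
  next
    fix B k k' assume k: "in_hom C k B R" "in_hom C k' B R" and eq: "k \<cdot> r \<cdot> i = k' \<cdot> r \<cdot> i"
    note h = kr(2)[OF k(1)] kr(2)[OF k(2)]
    have hi: "(k \<cdot> r) \<cdot> i = (k' \<cdot> r) \<cdot> i" using kr k eq by simp
    have inv: "((k \<cdot> r) \<cdot> i \<triangleright> \<alpha>) \<bullet> ((k' \<cdot> r) \<triangleright> \<theta>) = id2 (((k \<cdot> r) \<cdot> i) \<cdot> f)"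
      "((k \<cdot> r) \<triangleright> \<theta>) \<bullet> ((k \<cdot> r) \<cdot> i \<triangleright> \<alpha>) = id2 (((k \<cdot> r) \<cdot> i) \<cdot> g)"
      using classifiesD(4)[OF R k(1)] classifiesD(4)[OF R k(2)]
      unfolding S[OF h(1)] S[OF h(2)] hi by blast+
    have "(k \<cdot> r) \<triangleright> \<theta> = (k' \<cdot> r) \<triangleright> \<theta>"
    proof (rule vert.inverse_unique[OF _ _ inv(2) _ inv(1)])
      show "in_hom (Cells C) ((k \<cdot> r) \<cdot> i \<triangleright> \<alpha>) (((k \<cdot> r) \<cdot> i) \<cdot> f) (((k \<cdot> r) \<cdot> i) \<cdot> g)"
        using cell_lwhisk[OF hom1_Comp[OF h(1) I.proj] \<alpha>] by (simp add: cell_def)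
      show "in_hom (Cells C) ((k \<cdot> r) \<triangleright> \<theta>) (((k \<cdot> r) \<cdot> i) \<cdot> g) (((k \<cdot> r) \<cdot> i) \<cdot> f)"
        using c\<theta>[OF h(1)] by (simp add: cell_def)
      show "in_hom (Cells C) ((k' \<cdot> r) \<triangleright> \<theta>) (((k \<cdot> r) \<cdot> i) \<cdot> g) (((k \<cdot> r) \<cdot> i) \<cdot> f)"
        using c\<theta>[OF h(2)] hi by (simp add: cell_def)
    qed
    then have "k \<cdot> r = k' \<cdot> r" using I.eqI h hi by blast
    then show "k = k'" using r.eqI k by blast
  next
    fix B k k' \<phi> assume k: "in_hom C k B R" "in_hom C k' B R"
      and "cell B A (k \<cdot> r \<cdot> i) (k' \<cdot> r \<cdot> i) \<phi>"
    then have \<phi>: "cell B A ((k \<cdot> r) \<cdot> i) ((k' \<cdot> r) \<cdot> i) \<phi>" using kr by simp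
    note h = kr(2)[OF k(1)] kr(2)[OF k(2)]
    have inv: "((k' \<cdot> r) \<cdot> i \<triangleright> \<alpha>) \<bullet> ((k' \<cdot> r) \<triangleright> \<theta>) = id2 (((k' \<cdot> r) \<cdot> i) \<cdot> f)"
      "((k \<cdot> r) \<triangleright> \<theta>) \<bullet> ((k \<cdot> r) \<cdot> i \<triangleright> \<alpha>) = id2 (((k \<cdot> r) \<cdot> i) \<cdot> g)"
      using classifiesD(4)[OF R k(1)] classifiesD(4)[OF R k(2)]
      unfolding S[OF h(1)] S[OF h(2)] by blast+
    note cs = c\<theta>[OF h(1)] c\<theta>[OF h(2)] cell_rwhisk[OF \<phi> f] cell_rwhisk[OF \<phi> g]
      cell_lwhisk[OF hom1_Comp[OF h(1) I.proj] \<alpha>] cell_lwhisk[OF hom1_Comp[OF h(2) I.proj] \<alpha>]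
    note hcs = cs[unfolded cell_def, THEN conjunct2, THEN conjunct2]
    \<comment> \<open>Naturality passes to the inverses: insert \<open>\<alpha>\<close> followed by
      its inverse on the right, move \<phi> across \<alpha> by exchange, and cancel the inverse pair
      on the left.\<close>
    have "((k \<cdot> r) \<triangleright> \<theta>) \<bullet> (\<phi> \<triangleleft> f) =
        ((k \<cdot> r) \<triangleright> \<theta>) \<bullet> (\<phi> \<triangleleft> f) \<bullet> ((k' \<cdot> r) \<cdot> i \<triangleright> \<alpha>) \<bullet> ((k' \<cdot> r) \<triangleright> \<theta>)"
      unfolding inv(1) using vert.Comp_Idn_right[OF hcs(3)] by simp
    also have "\<dots> = ((k \<cdot> r) \<triangleright> \<theta>) \<bullet> ((\<phi> \<triangleleft> f) \<bullet> ((k' \<cdot> r) \<cdot> i \<triangleright> \<alpha>)) \<bullet> ((k' \<cdot> r) \<triangleright> \<theta>)"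
      unfolding vert.Comp_assoc[OF hcs(3,6,2)] ..
    also have "\<dots> = ((k \<cdot> r) \<triangleright> \<theta>) \<bullet> (((k \<cdot> r) \<cdot> i \<triangleright> \<alpha>) \<bullet> (\<phi> \<triangleleft> g)) \<bullet> ((k' \<cdot> r) \<triangleright> \<theta>)"
      unfolding whisk_exchange[OF \<phi> \<alpha>] ..
    also have "\<dots> = (((k \<cdot> r) \<triangleright> \<theta>) \<bullet> ((k \<cdot> r) \<cdot> i \<triangleright> \<alpha>)) \<bullet> ((\<phi> \<triangleleft> g) \<bullet> ((k' \<cdot> r) \<triangleright> \<theta>))"
      unfolding vert.Comp_assoc[OF hcs(5,4,2)]
        vert.Comp_assoc[OF hcs(1,5) vert.Comp_in_hom[OF hcs(4,2)]] ..
    also have "\<dots> = (\<phi> \<triangleleft> g) \<bullet> ((k' \<cdot> r) \<triangleright> \<theta>)"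
      unfolding inv(2) by (rule vert.Comp_Idn_left[OF vert.Comp_in_hom[OF hcs(4,2)]])
    finally obtain \<chi> where \<chi>: "cell B I (k \<cdot> r) (k' \<cdot> r) \<chi>" "\<chi> \<triangleleft> i = \<phi>"
      using I.lift_cell[OF h \<phi>] by metis
    then obtain \<psi> where "cell B R k k' \<psi>" "\<psi> \<triangleleft> r = \<chi>" using r.lift_cell[OF k] by blast
    then show "\<exists>\<psi>. cell B R k k' \<psi> \<and> \<psi> \<triangleleft> (r \<cdot> i) = \<phi>"
      using rwhisk_rwhisk[OF _ r.arr I.proj] \<chi>(2) by auto
  next
    fix B k k' \<psi> \<psi>' assume \<psi>: "cell B R k k' \<psi>" "cell B R k k' \<psi>'" and "\<psi> \<triangleleft> (r \<cdot> i) = \<psi>' \<triangleleft> (r \<cdot> i)"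
    then have "\<psi> \<triangleleft> r \<triangleleft> i = \<psi>' \<triangleleft> r \<triangleleft> i" using rwhisk_rwhisk[OF _ r.arr I.proj] by simp
    then have "\<psi> \<triangleleft> r = \<psi>' \<triangleleft> r" using I.cell_eqI cell_rwhisk[OF \<psi>(1) r.arr] cell_rwhisk[OF \<psi>(2) r.arr] by blast
    then show "\<psi> = \<psi>'" using r.cell_eqI \<psi> by blast
  qed
  then have "classifies R A (r \<cdot> i) (\<lambda>k. is_iso (Cells C) (k \<triangleright> \<alpha>))"
  proof (rule classifiesI)
    fix B k assume k: "in_hom C k B A" and iso: "is_iso (Cells C) (k \<triangleright> \<alpha>)"
    obtain \<beta> where \<beta>: "cell B X (k \<cdot> g) (k \<cdot> f) \<beta>" "(k \<triangleright> \<alpha>) \<bullet> \<beta> = id2 (k \<cdot> f)" "\<beta> \<bullet> (k \<triangleright> \<alpha>) = id2 (k \<cdot> g)"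
      using iso_cell_inverse[OF iso cell_lwhisk[OF k \<alpha>]] by metis
    obtain h where h: "in_hom C h B I" "h \<cdot> i = k" "h \<triangleright> \<theta> = \<beta>" using I.lift[OF k \<beta>(1)] by blast
    have "?S h" unfolding S[OF h(1)] h(2,3) using \<beta> by blast
    then obtain k' where k': "in_hom C k' B R" "k' \<cdot> r = h" using classifiesD(3)[OF R h(1)] by blast
    then show "\<exists>k'. in_hom C k' B R \<and> k' \<cdot> r \<cdot> i = k" using kr(1)[OF k'(1)] h(2) by auto
  next
    fix B k' assume k': "in_hom C k' B R"
    note h = kr(2)[OF k']
    have "is_iso (Cells C) (((k' \<cdot> r) \<cdot> i) \<triangleright> \<alpha>)"
      using classifiesD(4)[OF R k'] c\<theta>[OF h] cell_lwhisk[OF hom1_Comp[OF h I.proj] \<alpha>] vert.is_isoI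
      unfolding S[OF h] cell_def by blast
    then show "is_iso (Cells C) ((k' \<cdot> r \<cdot> i) \<triangleright> \<alpha>)" using kr(1)[OF k'] by simp
  qed
  then show ?thesis by blast
qed

text \<open>Inverters are available over every object, so base change along \<open>j\<close> only
  means taking the inverter of \<open>j \<triangleright> \<alpha>\<close>.\<close>

lemma classifiable_inverter:
  assumes \<alpha>: "cell P X f g \<alpha>"
  shows "classifiable P (\<lambda>k. is_iso (Cells C) (k \<triangleright> \<alpha>))"
  unfolding classifiable_def
proof (intro allI impI)
  fix A j assume j: "in_hom C j A P"
  obtain Q i where "classifies Q A i (\<lambda>k. is_iso (Cells C) (k \<triangleright> j \<triangleright> \<alpha>))"
    using inverter_exists[OF cell_lwhisk[OF j \<alpha>]] by blast
  then have "classifies Q A i (\<lambda>k. is_iso (Cells C) ((k \<cdot> j) \<triangleright> \<alpha>))"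
    by (rule classifies_cong) (use lwhisk_lwhisk[OF \<alpha> _ j] in simp)
  then show "\<exists>Q i. classifies Q A i (\<lambda>k. is_iso (Cells C) ((k \<cdot> j) \<triangleright> \<alpha>))" by blast
qed

section \<open>Objects of diagrams\<close>

text \<open>The power of \<open>X\<close> indexed by \<open>V\<close>, starting from the terminal
  object and multiplying by one copy of \<open>X\<close> per vertex. Without edges the naturality
  condition on 2-cells is empty.\<close>

lemma vertex_diagram_object_exists:
  assumes "finite V" and X: "X \<in> Ob C"
  shows "\<exists>P m c. diagram_object C K V {} X P m c"
  using assms(1)
proof (induction V)
  case empty
  obtain T where T: "T \<in> Ob C" "\<And>A. A \<in> Ob C \<Longrightarrow> \<exists>f. in_hom C f A T"
    "\<And>A f g. in_hom C f A T \<Longrightarrow> in_hom C g A T \<Longrightarrow> f = g"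
    "\<And>A f g \<phi> \<psi>. cell A T f g \<phi> \<Longrightarrow> cell A T f g \<psi> \<Longrightarrow> \<phi> = \<psi>"
    using terminal_object by metis
  have "diagram_object C K {} {} X T m c" for m c
  proof unfold_locales
    fix B k k' assume k: "in_hom C k B T" "in_hom C k' B T"
    have "k = k'" by (rule T(3)[OF k])
    then have "cell B T k k' (id2 k)" using k by blast
    then show "\<exists>\<chi>. cell B T k k' \<chi> \<and> (\<forall>x \<in> {}. \<chi> \<triangleleft> m x = \<sigma> x)" for \<sigma> by blast
  qed (use T in auto)
  then show ?case by blast
next
  case (insert y V)
  then obtain P m c where P: "diagram_object C K V {} X P m c" by blast
  interpret P: diagram_object C K V "{}" X P m c by (rule P)
  obtain Q p q where Q: "binary_product C P X Q p q" using product_exists[OF P.obj X] .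
  interpret Q: binary_product C P X Q p q by (rule Q)
  define n where "n x = (if x = y then q else p \<cdot> m x)" for x
  have n: "n y = q" "\<And>x. x \<in> V \<Longrightarrow> n x = p \<cdot> m x" using insert(2) by (auto simp: n_def)
  have kn: "k \<cdot> n x = (k \<cdot> p) \<cdot> m x" if "in_hom C k B Q" "x \<in> V" for k B x
    using Comp_assoc[OF that(1) Q.fst P.vertex[OF that(2)]] n that by simp
  have \<chi>n: "\<chi> \<triangleleft> n x = \<chi> \<triangleleft> p \<triangleleft> m x" if "cell B Q k k' \<chi>" "x \<in> V" for \<chi> k k' B x
    using rwhisk_rwhisk[OF that(1) Q.fst P.vertex[OF that(2)]] n that by simp
  have "diagram_object C K (insert y V) {} X Q n c"
  proof unfold_locales
    show "Q \<in> Ob C" using Q.fst by (auto simp: in_hom_def)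
  next
    fix x assume "x \<in> insert y V"
    then show "in_hom C (n x) Q X" using n Q.snd hom1_Comp[OF Q.fst P.vertex] by auto
  next
    fix B m' c' assume B: "B \<in> Ob C" and m': "\<And>x. x \<in> insert y V \<Longrightarrow> in_hom C (m' x) B X"
    obtain k where k: "in_hom C k B P" "\<forall>x \<in> V. k \<cdot> m x = m' x" using P.lift[OF B, of m' c'] m' by auto
    obtain h where h: "in_hom C h B Q" "h \<cdot> p = k" "h \<cdot> q = m' y" using Q.lift[OF k(1), of "m' y"] m' by blast
    have "\<forall>x \<in> insert y V. h \<cdot> n x = m' x" using h k kn[OF h(1)] n by auto
    then show "\<exists>k. in_hom C k B Q \<and> (\<forall>x \<in> insert y V. k \<cdot> n x = m' x) \<and> (\<forall>u \<in> {}. k \<triangleright> c u = c' u)"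
      using h(1) by blast
  next
    fix k B k' assume k: "in_hom C k B Q" "in_hom C k' B Q"
      and eq: "\<And>x. x \<in> insert y V \<Longrightarrow> k \<cdot> n x = k' \<cdot> n x"
    have "k \<cdot> p = k' \<cdot> p"
      using P.eqI[OF hom1_Comp[OF k(1) Q.fst] hom1_Comp[OF k(2) Q.fst]] eq kn[OF k(1)] kn[OF k(2)] by simp
    moreover have "k \<cdot> q = k' \<cdot> q" using eq[of y] n by simp
    ultimately show "k = k'" using Q.eqI k by blast
  next
    fix k B k' \<sigma> assume k: "in_hom C k B Q" "in_hom C k' B Q"
      and \<sigma>: "\<And>x. x \<in> insert y V \<Longrightarrow> cell B X (k \<cdot> n x) (k' \<cdot> n x) (\<sigma> x)"
    have "cell B X ((k \<cdot> p) \<cdot> m x) ((k' \<cdot> p) \<cdot> m x) (\<sigma> x)" if "x \<in> V" for x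
      using \<sigma>[of x] kn[OF k(1) that] kn[OF k(2) that] that by simp
    then obtain \<phi> where \<phi>: "cell B P (k \<cdot> p) (k' \<cdot> p) \<phi>" "\<forall>x \<in> V. \<phi> \<triangleleft> m x = \<sigma> x"
      using P.lift_cell[OF hom1_Comp[OF k(1) Q.fst] hom1_Comp[OF k(2) Q.fst], of \<sigma>] by blast
    obtain \<chi> where \<chi>: "cell B Q k k' \<chi>" "\<chi> \<triangleleft> p = \<phi>" "\<chi> \<triangleleft> q = \<sigma> y"
      using Q.lift_cell[OF k \<phi>(1), of "\<sigma> y"] \<sigma>[of y] n by auto
    have "\<forall>x \<in> insert y V. \<chi> \<triangleleft> n x = \<sigma> x" using \<chi> \<phi>(2) \<chi>n[OF \<chi>(1)] n by auto
    then show "\<exists>\<chi>. cell B Q k k' \<chi> \<and> (\<forall>x \<in> insert y V. \<chi> \<triangleleft> n x = \<sigma> x)" using \<chi>(1) by blast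
  next
    fix B k k' \<chi> \<chi>' assume \<chi>: "cell B Q k k' \<chi>" "cell B Q k k' \<chi>'"
      and eq: "\<And>x. x \<in> insert y V \<Longrightarrow> \<chi> \<triangleleft> n x = \<chi>' \<triangleleft> n x"
    have "\<chi> \<triangleleft> p = \<chi>' \<triangleleft> p"
      using P.cell_eqI[OF cell_rwhisk[OF \<chi>(1) Q.fst] cell_rwhisk[OF \<chi>(2) Q.fst]] eq
        \<chi>n[OF \<chi>(1)] \<chi>n[OF \<chi>(2)] by simp
    moreover have "\<chi> \<triangleleft> q = \<chi>' \<triangleleft> q" using eq[of y] n by simp
    ultimately show "\<chi> = \<chi>'" using Q.cell_eqI \<chi> by blast
  qed auto
  then show ?case by blast
qed

text \<open>An edge \<open>v\<close> is added by the inserter between the projections at its two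
  ends. The condition for a 2-cell to lift to that inserter is exactly naturality at
  \<open>v\<close>.\<close>

lemma diagram_object_exists:
  assumes "finite U" and V: "finite V" and X: "X \<in> Ob C"
    and "\<And>u. u \<in> U \<Longrightarrow> Dom K u \<in> V \<and> Cod K u \<in> V"
  shows "\<exists>P m c. diagram_object C K V U X P m c"
  using assms(1,4)
proof (induction U)
  case empty
  show ?case by (rule vertex_diagram_object_exists[OF V X])
next
  case (insert v U)
  then obtain P m c where P: "diagram_object C K V U X P m c" by auto
  interpret P: diagram_object C K V U X P m c by (rule P)
  have v: "Dom K v \<in> V" "Cod K v \<in> V" using insert.prems by auto
  have ends: "Dom K u \<in> V" "Cod K u \<in> V" if "u \<in> U" for u using insert.prems that by auto
  note mv = P.vertex[OF v(1)] P.vertex[OF v(2)]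
  obtain I i \<theta> where I: "inserter C P X (m (Dom K v)) (m (Cod K v)) I i \<theta>"
    using inserter_exists[OF mv] .
  interpret I: inserter C P X "m (Dom K v)" "m (Cod K v)" I i \<theta> by (rule I)
  define n where "n x = i \<cdot> m x" for x
  define d where "d u = (if u = v then \<theta> else i \<triangleright> c u)" for u
  have d: "d v = \<theta>" "\<And>u. u \<in> U \<Longrightarrow> d u = i \<triangleright> c u" using insert(2) by (auto simp: d_def)
  have kn: "k \<cdot> n x = (k \<cdot> i) \<cdot> m x" if "in_hom C k B I" "x \<in> V" for k B x
    using Comp_assoc[OF that(1) I.proj P.vertex[OF that(2)]] by (simp add: n_def)
  have kd: "k \<triangleright> d u = (k \<cdot> i) \<triangleright> c u" if "in_hom C k B I" "u \<in> U" for k B u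
    using lwhisk_lwhisk[OF P.edge[OF that(2)] that(1) I.proj] d that by simp
  have \<chi>n: "\<chi> \<triangleleft> n x = \<chi> \<triangleleft> i \<triangleleft> m x" if "cell B I k k' \<chi>" "x \<in> V" for \<chi> k k' B x
    using rwhisk_rwhisk[OF that(1) I.proj P.vertex[OF that(2)]] by (simp add: n_def)
  have "diagram_object C K V (insert v U) X I n d"
  proof unfold_locales
    show "I \<in> Ob C" using I.proj by (auto simp: in_hom_def)
  next
    fix x assume "x \<in> V"
    then show "in_hom C (n x) I X" using hom1_Comp[OF I.proj P.vertex] by (auto simp: n_def)
  next
    fix u assume "u \<in> insert v U"
    then show "cell I X (n (Dom K u)) (n (Cod K u)) (d u)"
      using d I.inserted cell_lwhisk[OF I.proj P.edge] by (auto simp: n_def)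
  next
    fix B m' c' assume B: "B \<in> Ob C" and m': "\<And>x. x \<in> V \<Longrightarrow> in_hom C (m' x) B X"
      and c': "\<And>u. u \<in> insert v U \<Longrightarrow> cell B X (m' (Dom K u)) (m' (Cod K u)) (c' u)"
    obtain k where k: "in_hom C k B P" "\<forall>x \<in> V. k \<cdot> m x = m' x" "\<forall>u \<in> U. k \<triangleright> c u = c' u"
      using P.lift[OF B, of m' c'] m' c' by auto
    obtain h where h: "in_hom C h B I" "h \<cdot> i = k" "h \<triangleright> \<theta> = c' v"
      using I.lift[OF k(1), of "c' v"] c'[of v] k(2) v by auto
    have "\<forall>x \<in> V. h \<cdot> n x = m' x" "\<forall>u \<in> insert v U. h \<triangleright> d u = c' u"
      using h k kn[OF h(1)] kd[OF h(1)] d by auto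
    then show "\<exists>k. in_hom C k B I \<and> (\<forall>x \<in> V. k \<cdot> n x = m' x) \<and> (\<forall>u \<in> insert v U. k \<triangleright> d u = c' u)"
      using h(1) by blast
  next
    fix k B k' assume k: "in_hom C k B I" "in_hom C k' B I"
      and eq: "\<And>x. x \<in> V \<Longrightarrow> k \<cdot> n x = k' \<cdot> n x" "\<And>u. u \<in> insert v U \<Longrightarrow> k \<triangleright> d u = k' \<triangleright> d u"
    have "k \<cdot> i = k' \<cdot> i"
    proof (rule P.eqI[OF hom1_Comp[OF k(1) I.proj] hom1_Comp[OF k(2) I.proj]])
      show "(k \<cdot> i) \<cdot> m x = (k' \<cdot> i) \<cdot> m x" if "x \<in> V" for x
        using eq(1)[OF that] kn[OF k(1) that] kn[OF k(2) that] by simp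
      show "(k \<cdot> i) \<triangleright> c u = (k' \<cdot> i) \<triangleright> c u" if "u \<in> U" for u
        using eq(2)[of u] kd[OF k(1) that] kd[OF k(2) that] that by simp
    qed
    moreover have "k \<triangleright> \<theta> = k' \<triangleright> \<theta>" using eq(2)[of v] d by simp
    ultimately show "k = k'" using I.eqI k by blast
  next
    fix k B k' \<sigma> assume k: "in_hom C k B I" "in_hom C k' B I"
      and \<sigma>: "\<And>x. x \<in> V \<Longrightarrow> cell B X (k \<cdot> n x) (k' \<cdot> n x) (\<sigma> x)"
      and nat: "\<And>u. u \<in> insert v U \<Longrightarrow> (k \<triangleright> d u) \<bullet> \<sigma> (Cod K u) = \<sigma> (Dom K u) \<bullet> (k' \<triangleright> d u)"
    have "\<exists>\<phi>. cell B P (k \<cdot> i) (k' \<cdot> i) \<phi> \<and> (\<forall>x \<in> V. \<phi> \<triangleleft> m x = \<sigma> x)"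
    proof (rule P.lift_cell[OF hom1_Comp[OF k(1) I.proj] hom1_Comp[OF k(2) I.proj]])
      show "cell B X ((k \<cdot> i) \<cdot> m x) ((k' \<cdot> i) \<cdot> m x) (\<sigma> x)" if "x \<in> V" for x
        using \<sigma>[OF that] kn[OF k(1) that] kn[OF k(2) that] by simp
      show "((k \<cdot> i) \<triangleright> c u) \<bullet> \<sigma> (Cod K u) = \<sigma> (Dom K u) \<bullet> ((k' \<cdot> i) \<triangleright> c u)" if "u \<in> U" for u
        using nat[of u] kd[OF k(1) that] kd[OF k(2) that] that by simp
    qed
    then obtain \<phi> where \<phi>: "cell B P (k \<cdot> i) (k' \<cdot> i) \<phi>" "\<forall>x \<in> V. \<phi> \<triangleleft> m x = \<sigma> x" by blast
    obtain \<chi> where \<chi>: "cell B I k k' \<chi>" "\<chi> \<triangleleft> i = \<phi>"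
      using I.lift_cell[OF k \<phi>(1)] nat[of v] \<phi>(2) v d(1) by auto
    have "\<forall>x \<in> V. \<chi> \<triangleleft> n x = \<sigma> x" using \<chi> \<phi>(2) \<chi>n[OF \<chi>(1)] by auto
    then show "\<exists>\<chi>. cell B I k k' \<chi> \<and> (\<forall>x \<in> V. \<chi> \<triangleleft> n x = \<sigma> x)" using \<chi>(1) by blast
  next
    fix B k k' \<chi> \<chi>' assume \<chi>: "cell B I k k' \<chi>" "cell B I k k' \<chi>'"
      and eq: "\<And>x. x \<in> V \<Longrightarrow> \<chi> \<triangleleft> n x = \<chi>' \<triangleleft> n x"
    have "\<chi> \<triangleleft> i = \<chi>' \<triangleleft> i"
      using P.cell_eqI[OF cell_rwhisk[OF \<chi>(1) I.proj] cell_rwhisk[OF \<chi>(2) I.proj]] eq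
        \<chi>n[OF \<chi>(1)] \<chi>n[OF \<chi>(2)] by simp
    then show "\<chi> = \<chi>'" using I.cell_eqI \<chi> by blast
  qed
  then show ?case by blast
qed

section \<open>Stable pullbacks and terminal objects\<close>

lemma map_square_precomp_comp:
  assumes s: "commutative_square (hom_cat C B X) s" and k: "in_hom C k A B" and l: "in_hom C l A' A"
  shows "map_square (precomp C l) (map_square (precomp C k) s) = map_square (precomp C (l \<cdot> k)) s"
proof (cases s)
  case (fields p q f g)
  have "l \<triangleright> k \<triangleright> \<phi> = (l \<cdot> k) \<triangleright> \<phi>" if "\<phi> \<in> {p, q, f, g}" for \<phi>
  proof -
    have "\<phi> \<in> Ar (hom_cat C B X)" using s that by (auto simp: fields commutative_square_def)
    then show ?thesis using lwhisk_lwhisk[OF _ l k] unfolding Ar_hom_cat by blast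
  qed
  then show ?thesis by (simp add: fields map_square_def)
qed

text \<open>A square is a stable pullback after restriction along \<open>k\<close> iff the comparison with a chosen
  pullback of its cospan, which is stable, becomes invertible.\<close>

lemma classifiable_stable_pullback:
  assumes lim: "has_finite_limits C X" and Q: "Q \<in> Ob C" and s: "commutative_square (hom_cat C Q X) s"
  shows "classifiable Q (\<lambda>k. stable_pullback_square C (Dom C k) X (map_square (precomp C k) s))"
proof -
  obtain p q f g where s_eq: "s = (p, q, f, g)" by (cases s)
  have sq: "commutative_square (hom_cat C Q X) (p, q, f, g)" using s s_eq by simp
  then have fg: "in_hom (hom_cat C Q X) f (Dom (Cells C) f) (Cod (Cells C) f)"
    "in_hom (hom_cat C Q X) g (Dom (Cells C) g) (Cod (Cells C) f)"
    by (auto simp: commutative_square_def in_hom_def[of "hom_cat C Q X"] simp del: in_hom_hom_cat)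
  have "cat_has_finite_limits (hom_cat C Q X)" using lim Q unfolding has_finite_limits_def by blast
  from pullback_exists[OF category_hom_cat this fg] obtain p0 q0 where
    pb: "pullback_square (hom_cat C Q X) (p0, q0, f, g)" and
    pres: "\<And>(E :: ('m, 'c) cat) G. category E \<and> is_functor (hom_cat C Q X) E G \<and>
      preserves_finite_limits (hom_cat C Q X) E G \<Longrightarrow> pullback_square E (map_square G (p0, q0, f, g))"
    by blast
  note sq0 = pullback_square_commutes[OF pb]
  \<comment> \<open>The comparison is formed once, over \<open>Q\<close>. Since the chosen pullback
    is preserved by restriction, \<open>k \<triangleright> h\<close> is the comparison after
    restriction along \<open>k\<close>.\<close>
  obtain h where h: "cell Q X (Dom (Cells C) p) (Dom (Cells C) p0) h" "h \<bullet> p0 = p" "h \<bullet> q0 = q"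
    using pullback_square_universal[OF pb sq] by auto
  have key: "pullback_square (hom_cat C B X) (map_square (precomp C k) s) \<longleftrightarrow> is_iso (Cells C) (k \<triangleright> h)"
    if k: "in_hom C k B Q" for k B
  proof -
    have B: "B \<in> Ob C" using k by (auto simp: in_hom_def)
    have kpb: "pullback_square (hom_cat C B X) (k \<triangleright> p0, k \<triangleright> q0, k \<triangleright> f, k \<triangleright> g)"
      using pres[of "hom_cat C B X" "precomp C k"] category_hom_cat is_functor_precomp[OF k] lim B Q k
      unfolding has_finite_limits_def by (simp add: map_square_def)
    have ksq: "commutative_square (hom_cat C B X) (k \<triangleright> p, k \<triangleright> q, k \<triangleright> f, k \<triangleright> g)"
      using functor_commutative_square[OF is_functor_precomp[OF k] sq] by (simp add: map_square_def)
    have cells: "cell Q X (Dom (Cells C) a) (Cod (Cells C) a) a" if "a \<in> {p, q, p0, q0}" for a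
      using sq sq0 that by (auto simp: commutative_square_def Ar_hom_cat)
    have D: "Dom (Cells C) q0 = Dom (Cells C) p0"
      using sq0 by (simp add: commutative_square_def)
    have Dk: "Dom (Cells C) (k \<triangleright> p) = k \<cdot> Dom (Cells C) p" "Dom (Cells C) (k \<triangleright> p0) = k \<cdot> Dom (Cells C) p0"
      using cell_lwhisk[OF k cells[of p]] cell_lwhisk[OF k cells[of p0]]
      by (simp_all add: cell_def in_hom_def)
    have kh: "cell B X (k \<cdot> Dom (Cells C) p) (k \<cdot> Dom (Cells C) p0) (k \<triangleright> h)" by (rule cell_lwhisk[OF k h(1)])
    have "(k \<triangleright> h) \<bullet> (k \<triangleright> p0) = k \<triangleright> p" "(k \<triangleright> h) \<bullet> (k \<triangleright> q0) = k \<triangleright> q"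
      using cell_vcomp_lwhisk[OF h(1) cells[of p0] k] h(2)
        cell_vcomp_lwhisk[OF h(1) cells[of q0, unfolded D] k] h(3) by simp_all
    then have "pullback_square (hom_cat C B X) (k \<triangleright> p, k \<triangleright> q, k \<triangleright> f, k \<triangleright> g) \<longleftrightarrow>
        is_iso (hom_cat C B X) (k \<triangleright> h)"
      using pullback_iff_iso[OF category_hom_cat kpb ksq, of "k \<triangleright> h"] kh Dk by simp
    also have "\<dots> \<longleftrightarrow> is_iso (Cells C) (k \<triangleright> h)"
      using kh by (auto simp: is_iso_hom_cat) (auto simp: cell_def in_hom_def)
    finally show ?thesis by (simp add: s_eq map_square_def)
  qed
  show ?thesis
  proof (rule classifiable_cong[OF classifiable_inverter[OF h(1)]])
    fix B k assume k: "in_hom C k B Q"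
    have kD: "Dom C k = B" using k by (simp add: in_hom_def)
    \<comment> \<open>Invertibility survives further restriction, so a square that is a pullback
      after restriction along \<open>k\<close> is already a stable one.\<close>
    have "is_iso (Cells C) ((l \<cdot> k) \<triangleright> h)" if "is_iso (Cells C) (k \<triangleright> h)" "in_hom C l A B" for l A
      using is_iso_lwhisk[OF that(1) cell_lwhisk[OF k h(1)] that(2)] lwhisk_lwhisk[OF h(1) that(2) k] by simp
    then show "is_iso (Cells C) (k \<triangleright> h) \<longleftrightarrow>
        stable_pullback_square C (Dom C k) X (map_square (precomp C k) s)"
      unfolding stable_pullback_square_def kD key[OF k]
      using map_square_precomp_comp[OF s k] key[OF hom1_Comp[OF _ k]] by auto
  qed
qed

text \<open>The same argument as for pullbacks, with the unique 2-cell from \<open>t\<close> to a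
  chosen terminal object \<open>t0\<close> as comparison.\<close>

lemma classifiable_stable_terminal:
  assumes lim: "has_finite_limits C X" and t: "in_hom C t Q X"
  shows "classifiable Q (\<lambda>k. stable_terminal C (Dom C k) X (k \<cdot> t))"
proof -
  have Q: "Q \<in> Ob C" using t by (auto simp: in_hom_def)
  have "cat_has_finite_limits (hom_cat C Q X)" using lim Q unfolding has_finite_limits_def by blast
  from terminal_exists[OF this] obtain t0 where t0: "is_terminal (hom_cat C Q X) t0" and
    pres: "\<And>(E :: ('m, 'c) cat) G. preserves_finite_limits (hom_cat C Q X) E G \<Longrightarrow> is_terminal E (fob G t0)"
    by blast
  obtain h where h: "cell Q X t t0 h" using t0 t unfolding is_terminal_def by auto
  have key: "is_terminal (hom_cat C B X) (k \<cdot> t) \<longleftrightarrow> is_iso (Cells C) (k \<triangleright> h)" if k: "in_hom C k B Q" for k B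
  proof -
    have B: "B \<in> Ob C" using k by (auto simp: in_hom_def)
    have "is_terminal (hom_cat C B X) (k \<cdot> t0)"
      using pres[of "hom_cat C B X" "precomp C k"] lim B Q k unfolding has_finite_limits_def by simp
    then have "is_terminal (hom_cat C B X) (k \<cdot> t) \<longleftrightarrow> is_iso (hom_cat C B X) (k \<triangleright> h)"
      using terminal_iff_iso[OF category_hom_cat] cell_lwhisk[OF k h] by simp
    also have "\<dots> \<longleftrightarrow> is_iso (Cells C) (k \<triangleright> h)"
      using cell_lwhisk[OF k h] by (auto simp: is_iso_hom_cat) (auto simp: cell_def in_hom_def)
    finally show ?thesis .
  qed
  show ?thesis
  proof (rule classifiable_cong[OF classifiable_inverter[OF h]])
    fix B k assume k: "in_hom C k B Q"
    have kD: "Dom C k = B" using k by (simp add: in_hom_def)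
    have "is_iso (Cells C) ((l \<cdot> k) \<triangleright> h)" if "is_iso (Cells C) (k \<triangleright> h)" "in_hom C l A B" for l A
      using is_iso_lwhisk[OF that(1) cell_lwhisk[OF k h] that(2)] lwhisk_lwhisk[OF h that(2) k] by simp
    then show "is_iso (Cells C) (k \<triangleright> h) \<longleftrightarrow> stable_terminal C (Dom C k) X (k \<cdot> t)"
      unfolding stable_terminal_def kD key[OF k]
      using Comp_assoc[OF _ k t] key[OF hom1_Comp[OF _ k]] by auto
  qed
qed

end

section \<open>The cotensor\<close>

context two_category
begin

text \<open>The universal diagram given by \<open>m\<close> and \<open>c\<close>, restricted along
  \<open>k\<close>. Making it extensional turns equality with an element of \<open>functors\<close>
  into a meaningful condition.\<close>

definition induced :: "('j, 'k) cat \<Rightarrow> ('j \<Rightarrow> 'm) \<Rightarrow> ('k \<Rightarrow> 'c) \<Rightarrow> 'm \<Rightarrow> ('j, 'm, 'k, 'c) ftor" where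
  "induced K m c k = \<lparr>fob = (\<lambda>x \<in> Ob K. k \<cdot> m x), far = (\<lambda>u \<in> Ar K. k \<triangleright> c u)\<rparr>"

lemma induced_simps [simp]:
  "x \<in> Ob K \<Longrightarrow> fob (induced K m c k) x = k \<cdot> m x"
  "u \<in> Ar K \<Longrightarrow> far (induced K m c k) u = k \<triangleright> c u"
  by (simp_all add: induced_def)

end

section \<open>Functors on the sketch as 1-cells into the object of graph diagrams\<close>

locale full_diagram_object = diagram_object C K "Ob K" "Ar K" X P m c + K: category K
  for C :: "('o, 'm, 'c) twocat" and K :: "('j, 'k) cat" and X P m c
begin

abbreviation ind :: "'m \<Rightarrow> ('j, 'm, 'k, 'c) ftor" where "ind \<equiv> induced K m c"

text \<open>Each law is phrased as the agreement of two fixed 2-cells on \<open>P\<close> after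
  restriction along \<open>k\<close>, which is the form that equifiers classify; there are finitely
  many laws when \<open>K\<close> is finite.\<close>

definition functorial :: "'m \<Rightarrow> bool" where
  "functorial k \<longleftrightarrow> (\<forall>x \<in> Ob K. k \<triangleright> c (Idn K x) = k \<triangleright> id2 (m x)) \<and>
    (\<forall>(a, b) \<in> {(a, b) \<in> Ar K \<times> Ar K. Cod K a = Dom K b}. k \<triangleright> c (Comp K a b) = k \<triangleright> (c a \<bullet> c b))"

lemma ftor_comp_ind:
  assumes k: "in_hom C k B P" and l: "in_hom C l A B"
  shows "ftor_comp K (ind k) (precomp C l) = ind (l \<cdot> k)"
proof -
  have "l \<cdot> k \<cdot> m x = (l \<cdot> k) \<cdot> m x" if "x \<in> Ob K" for x
    using Comp_assoc[OF l k vertex[OF that]] by simp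
  moreover have "l \<triangleright> k \<triangleright> c u = (l \<cdot> k) \<triangleright> c u" if "u \<in> Ar K" for u
    by (rule lwhisk_lwhisk[OF edge[OF that] l k])
  ultimately show ?thesis
    by (auto simp: ftor_comp_def induced_def fun_eq_iff restrict_def)
qed

text \<open>The typing of the values is already guaranteed by \<open>vertex\<close> and
  \<open>edge\<close>, so only the laws remain, and whiskering along \<open>k\<close> preserves
  identities and composites.\<close>

lemma ind_functor_iff:
  assumes k: "in_hom C k B P"
  shows "is_functor K (hom_cat C B X) (ind k) \<longleftrightarrow> functorial k"
proof -
  have "k \<triangleright> id2 (m x) = id2 (k \<cdot> m x)" if "x \<in> Ob K" for x
    by (rule lwhisk_id2_hom[OF k vertex[OF that]])
  moreover have "k \<triangleright> (c a \<bullet> c b) = (k \<triangleright> c a) \<bullet> (k \<triangleright> c b)"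
    if "a \<in> Ar K" "b \<in> Ar K" "Cod K a = Dom K b" for a b
    using cell_vcomp_lwhisk[OF edge[OF that(1)] _ k, of "m (Cod K b)" "c b"] edge[OF that(2)] that(3) by simp
  moreover have "cell B X (k \<cdot> m (Dom K u)) (k \<cdot> m (Cod K u)) (k \<triangleright> c u)" if "u \<in> Ar K" for u
    by (rule cell_lwhisk[OF k edge[OF that]])
  moreover have "in_hom C (k \<cdot> m x) B X" if "x \<in> Ob K" for x
    by (rule hom1_Comp[OF k vertex[OF that]])
  ultimately show ?thesis
    unfolding is_functor_def functorial_def by auto
qed

lemma ind_eqI:
  assumes "in_hom C k B P" "in_hom C k' B P" "ind k = ind k'"
  shows "k = k'"
proof (rule eqI[OF assms(1,2)])
  show "k \<cdot> m x = k' \<cdot> m x" if "x \<in> Ob K" for x using assms(3) induced_simps(1)[OF that] by metis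
  show "k \<triangleright> c u = k' \<triangleright> c u" if "u \<in> Ar K" for u using assms(3) induced_simps(2)[OF that] by metis
qed

lemma ind_lift:
  assumes B: "B \<in> Ob C" and M: "M \<in> functors K (hom_cat C B X)"
  shows "\<exists>k. in_hom C k B P \<and> ind k = M"
proof -
  have hom: "cell B X (fob M (Dom K u)) (fob M (Cod K u)) (far M u)" if "u \<in> Ar K" for u
    using M that by (simp add: functors_def is_functor_def)
  have ob: "in_hom C (fob M x) B X" if "x \<in> Ob K" for x
    using M that by (simp add: functors_def is_functor_def)
  obtain k where k: "in_hom C k B P" "\<forall>x \<in> Ob K. k \<cdot> m x = fob M x" "\<forall>u \<in> Ar K. k \<triangleright> c u = far M u"
    using lift[OF B, of "fob M" "far M"] hom ob by blast
  \<comment> \<open>The choice of \<open>k\<close> fixes values on objects and arrows of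
    \<open>K\<close> only; extensionality of both functors makes them literally equal.\<close>
  have "fob M \<in> extensional (Ob K)" "far M \<in> extensional (Ar K)" using M by (simp_all add: functors_def)
  then have "fob (ind k) = fob M" "far (ind k) = far M"
    using k(2,3) by (auto simp: induced_def fun_eq_iff restrict_def extensional_def)
  then have "ind k = M" by simp
  then show ?thesis using k(1) by blast
qed

end

section \<open>Stable models and the comparison functor\<close>

locale sketch_diagram_object = pita_category C + full_diagram_object C "sk_cat J" X P m c
  for C :: "('o, 'm, 'c) twocat" and J :: "('j, 'k) sketch" and X P m c +
  assumes sketch: "finite_pbt_sketch J" and limits: "has_finite_limits C X"
begin

abbreviation K where "K \<equiv> sk_cat J"

lemma finite_K: "finite (Ob K)" "finite (Ar K)"
  using sketch by (simp_all add: finite_pbt_sketch_def finite_category_def)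

lemma square_arrows:
  assumes "s \<in> sk_squares J"
  shows "commutative_square K s" "s \<in> Ar K \<times> Ar K \<times> Ar K \<times> Ar K"
proof -
  show s: "commutative_square K s" using sketch assms by (simp add: finite_pbt_sketch_def pbt_sketch_def)
  then show "s \<in> Ar K \<times> Ar K \<times> Ar K \<times> Ar K" by (cases s) (simp add: commutative_square_def)
qed

lemma terminals: "sk_terminals J \<subseteq> Ob K"
  using sketch by (simp add: finite_pbt_sketch_def pbt_sketch_def)

lemma stable_model_ind_iff:
  assumes k: "in_hom C k B P"
  shows "stable_model C J B X (ind k) \<longleftrightarrow> functorial k \<and>
    (\<forall>s \<in> sk_squares J. stable_pullback_square C B X (map_square (ind k) s)) \<and>
    (\<forall>t \<in> sk_terminals J. stable_terminal C B X (fob (ind k) t))"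
  unfolding stable_model_def is_model_def ind_functor_iff[OF k]
  by (auto simp: stable_pullback_square_def stable_terminal_def)

lemma classifiable_functorial: "classifiable P functorial"
  unfolding functorial_def
proof (intro classifiable_conj classifiable_Ball)
  show "finite (Ob K)" by (rule finite_K)
  show "finite {(a, b) \<in> Ar K \<times> Ar K. Cod K a = Dom K b}"
    by (rule finite_subset[of _ "Ar K \<times> Ar K"]) (use finite_K in auto)
  fix x assume x: "x \<in> Ob K"
  have "cell P X (m x) (m x) (c (Idn K x))" using edge[of "Idn K x"] x by simp
  then show "classifiable P (\<lambda>k. k \<triangleright> c (Idn K x) = k \<triangleright> id2 (m x))"
    using classifiable_equifier cell_id2[OF vertex[OF x]] by blast
next
  fix ab assume "ab \<in> {(a, b) \<in> Ar K \<times> Ar K. Cod K a = Dom K b}"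
  then obtain a b where ab: "ab = (a, b)" "a \<in> Ar K" "b \<in> Ar K" "Cod K a = Dom K b" by auto
  have "cell P X (m (Dom K a)) (m (Cod K b)) (c (Comp K a b))" using edge[of "Comp K a b"] ab by simp
  moreover have "cell P X (m (Dom K a)) (m (Cod K b)) (c a \<bullet> c b)"
    using cell_vcomp[OF edge[OF ab(2)]] edge[OF ab(3)] ab(4) by simp
  ultimately show "classifiable P (\<lambda>k. case ab of (a, b) \<Rightarrow> k \<triangleright> c (Comp K a b) = k \<triangleright> (c a \<bullet> c b))"
    using classifiable_equifier ab(1) by simp
qed

text \<open>Two stages are used. The squares of the sketch commute in the diagram over
  \<open>Q\<close>, where the functor laws hold, and this is what the comparison 2-cells require.
  The second classifier therefore lives over \<open>Q\<close>, and the composite embedding into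
  \<open>P\<close> is the one wanted.\<close>

lemma stable_models_classified:
  "\<exists>R e. classifies R P e (\<lambda>k. stable_model C J (Dom C k) X (ind k))"
proof -
  obtain Q i where Q: "classifies Q P i functorial"
    using classifiable_classifies[OF classifiable_functorial obj] .
  note i = classifiesD(2)[OF Q]
  have Q_ob: "Q \<in> Ob C" using i by (auto simp: in_hom_def)
  \<comment> \<open>The identity of \<open>Q\<close> composed with \<open>i\<close> factors through
    \<open>i\<close>, so the diagram over \<open>Q\<close> itself obeys the laws.\<close>
  have "functorial i" using classifiesD(4)[OF Q Idn_in_hom[OF Q_ob]] Comp_Idn_left[OF i] by simp
  then have F: "is_functor K (hom_cat C Q X) (ind i)" using ind_functor_iff[OF i] by blast
  \<comment> \<open>The model conditions are stated for restrictions of the fixed diagram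
    \<open>ind i\<close>, to match the classifiability lemmas; \<open>S_iff\<close> identifies them
    with stability of the model \<open>ind (k \<cdot> i)\<close>.\<close>
  define S where "S k \<longleftrightarrow>
    (\<forall>s \<in> sk_squares J. stable_pullback_square C (Dom C k) X (map_square (precomp C k) (map_square (ind i) s))) \<and>
    (\<forall>t \<in> sk_terminals J. stable_terminal C (Dom C k) X (k \<cdot> fob (ind i) t))" for k
  have "classifiable Q S"
    unfolding S_def
  proof (intro classifiable_conj classifiable_Ball)
    show "finite (sk_squares J)"
      by (rule finite_subset[of _ "Ar K \<times> Ar K \<times> Ar K \<times> Ar K"]) (use square_arrows(2) finite_K in auto)
    show "finite (sk_terminals J)" using finite_subset[OF terminals] finite_K by blast
  next
    fix s assume "s \<in> sk_squares J"
    then show "classifiable Q (\<lambda>k. stable_pullback_square C (Dom C k) X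
        (map_square (precomp C k) (map_square (ind i) s)))"
      using classifiable_stable_pullback[OF limits Q_ob]
        functor_commutative_square[OF F] square_arrows(1) by blast
  next
    fix t assume "t \<in> sk_terminals J"
    then have "in_hom C (fob (ind i) t) Q X"
      using F terminals unfolding is_functor_def by auto
    then show "classifiable Q (\<lambda>k. stable_terminal C (Dom C k) X (k \<cdot> fob (ind i) t))"
      by (rule classifiable_stable_terminal[OF limits])
  qed
  then obtain R r where R: "classifies R Q r S" using classifiable_classifies Q_ob by metis
  note r = classifiesD(2)[OF R]
  have S_iff: "S k \<longleftrightarrow> stable_model C J B X (ind (k \<cdot> i))" if k: "in_hom C k B Q" for k B
  proof -
    have "map_square (ind (k \<cdot> i)) s = map_square (precomp C k) (map_square (ind i) s)"
      if s: "s \<in> sk_squares J" for s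
    proof -
      have "(k \<cdot> i) \<triangleright> c u = k \<triangleright> i \<triangleright> c u" if "u \<in> Ar K" for u
        using lwhisk_lwhisk[OF edge[OF that] k i] by simp
      then show ?thesis using square_arrows(2)[OF s] by (auto simp: map_square_def)
    qed
    moreover have "fob (ind (k \<cdot> i)) t = k \<cdot> fob (ind i) t" if "t \<in> sk_terminals J" for t
    proof -
      have "t \<in> Ob K" using that terminals by blast
      then show ?thesis using Comp_assoc[OF k i vertex] by simp
    qed
    moreover have "functorial (k \<cdot> i)" by (rule classifiesD(4)[OF Q k])
    moreover have "Dom C k = B" using k by (simp add: in_hom_def)
    ultimately show ?thesis
      unfolding stable_model_ind_iff[OF hom1_Comp[OF k i]] S_def by simp
  qed
  have "classifies R P (r \<cdot> i) (\<lambda>k. stable_model C J (Dom C k) X (ind k))"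
  proof (rule classifiesI)
    show "embedding C R P (r \<cdot> i)"
      by (rule embedding_comp[OF classifiesD(1)[OF R] classifiesD(1)[OF Q]])
  next
    fix B k assume k: "in_hom C k B P" and "stable_model C J (Dom C k) X (ind k)"
    then have sm: "stable_model C J B X (ind k)" by (simp add: in_hom_def)
    then have "functorial k" using stable_model_ind_iff[OF k] by blast
    then obtain k1 where k1: "in_hom C k1 B Q" "k1 \<cdot> i = k" using classifiesD(3)[OF Q k] by blast
    then have "S k1" using S_iff sm by simp
    then obtain k2 where k2: "in_hom C k2 B R" "k2 \<cdot> r = k1" using classifiesD(3)[OF R k1(1)] by blast
    then show "\<exists>k'. in_hom C k' B R \<and> k' \<cdot> r \<cdot> i = k" using Comp_assoc[OF k2(1) r i] k1(2) by auto
  next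
    fix B k assume k: "in_hom C k B R"
    have kr: "in_hom C (k \<cdot> r) B Q" and D: "Dom C (k \<cdot> r \<cdot> i) = B"
      using k r i by (auto simp: in_hom_def)
    have "stable_model C J B X (ind ((k \<cdot> r) \<cdot> i))" using S_iff[OF kr] classifiesD(4)[OF R k] by blast
    then show "stable_model C J (Dom C (k \<cdot> r \<cdot> i)) X (ind (k \<cdot> r \<cdot> i))"
      unfolding D using Comp_assoc[OF k r i] by simp
  qed
  then show ?thesis by blast
qed

lemma in_hom_stable_model_cat:
  "in_hom (stable_model_cat C J A X) \<tau> M N \<longleftrightarrow>
    in_hom (Fun_cat K (hom_cat C A X)) \<tau> M N \<and> stable_model C J A X M \<and> stable_model C J A X N"
  unfolding in_hom_def stable_model_cat_def full_subcat_def Fun_cat_def by auto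

text \<open>The evaluation model is \<open>ind e\<close>. On objects, a stable model is a unique
  1-cell into \<open>P\<close>, which factors uniquely through \<open>e\<close>. On arrows, a
  natural family is a unique 2-cell into \<open>P\<close>, which lifts uniquely along the fully
  faithful \<open>e\<close>.\<close>

lemma strict_cotensor_exists: "\<exists>XJ ev. strict_cotensor C X J XJ ev"
proof -
  obtain R e where R: "classifies R P e (\<lambda>k. stable_model C J (Dom C k) X (ind k))"
    using stable_models_classified by blast
  interpret e: embedding C R P e by (rule classifiesD(1)[OF R])
  note e = e.arr
  have R_ob: "R \<in> Ob C" using e by (auto simp: in_hom_def)
  have sm: "stable_model C J A X (ind (f \<cdot> e))" if "in_hom C f A R" for f A
  proof -
    have "Dom C (f \<cdot> e) = A" using that e by (simp add: in_hom_def)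
    then show ?thesis using classifiesD(4)[OF R that] by simp
  qed
  have ind_fun: "ind (f \<cdot> e) \<in> functors K (hom_cat C A X)" if "in_hom C f A R" for f A
    using sm[OF that] by (simp add: functors_def stable_model_def is_model_def induced_def)
  have fob_ev: "ftor_comp K (ind e) (precomp C f) = ind (f \<cdot> e)" if "in_hom C f A R" for f A
    by (rule ftor_comp_ind[OF e that])
  define F where "F = cotensor_comparison C J (ind e)"
  have Fob: "fob F f = ind (f \<cdot> e)" if "in_hom C f A R" for f A
    using fob_ev[OF that] by (simp add: F_def cotensor_comparison_def)
  \<comment> \<open>Whiskering is split into \<open>e\<close> followed by \<open>m j\<close>, so
    that the universal properties of the embedding and of \<open>P\<close> can be applied
    separately.\<close>
  have Far: "far F \<phi> = \<lparr>nt_dom = ind (f \<cdot> e), nt_at = (\<lambda>j \<in> Ob K. \<phi> \<triangleleft> e \<triangleleft> m j), nt_cod = ind (g \<cdot> e)\<rparr>"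
    if \<phi>: "cell A R f g \<phi>" for \<phi> f g A
  proof -
    have "\<phi> \<triangleleft> (e \<cdot> m j) = \<phi> \<triangleleft> e \<triangleleft> m j" if "j \<in> Ob K" for j
      using rwhisk_rwhisk[OF \<phi> e vertex[OF that]] by simp
    then have "(\<lambda>j \<in> Ob K. \<phi> \<triangleleft> fob (ind e) j) = (\<lambda>j \<in> Ob K. \<phi> \<triangleleft> e \<triangleleft> m j)"
      by (auto simp: fun_eq_iff restrict_def)
    then show ?thesis
      using \<phi> fob_ev by (simp add: F_def cotensor_comparison_def cell_def in_hom_def)
  qed
  have "is_cat_iso (hom_cat C A R) (stable_model_cat C J A X) F" if A: "A \<in> Ob C" for A
  proof (rule is_cat_isoI[OF category_hom_cat])
    have Ob_sm: "Ob (stable_model_cat C J A X) =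
        {M \<in> functors K (hom_cat C A X). stable_model C J A X M}"
      by (simp add: stable_model_cat_def full_subcat_def)
    show "is_functor (hom_cat C A R) (stable_model_cat C J A X) F"
      unfolding is_functor_def
    proof (intro conjI ballI impI)
      fix f assume "f \<in> Ob (hom_cat C A R)"
      then have f: "in_hom C f A R" by simp
      show "fob F f \<in> Ob (stable_model_cat C J A X)"
        unfolding Ob_sm Fob[OF f] using sm[OF f] ind_fun[OF f] by blast
      have "id2 f \<triangleleft> e \<triangleleft> m j = id2 ((f \<cdot> e) \<cdot> m j)" if "j \<in> Ob K" for j
        using rwhisk_id2_hom[OF f e] rwhisk_id2_hom[OF hom1_Comp[OF f e] vertex[OF that]] by simp
      then show "far F (Idn (hom_cat C A R) f) = Idn (stable_model_cat C J A X) (fob F f)"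
        using Far[OF cell_id2[OF f]] Fob[OF f]
        by (auto simp: stable_model_cat_def full_subcat_def Fun_cat_def fun_eq_iff restrict_def)
    next
      fix \<phi> assume "\<phi> \<in> Ar (hom_cat C A R)"
      then obtain f g where \<phi>: "cell A R f g \<phi>" and D: "Dom (Cells C) \<phi> = f" "Cod (Cells C) \<phi> = g"
        by (simp add: Ar_hom_cat)
      have f: "in_hom C f A R" "in_hom C g A R" using \<phi> by (simp_all add: cell_def)
      note \<phi>e = cell_rwhisk[OF \<phi> e]
      show "in_hom (stable_model_cat C J A X) (far F \<phi>)
          (fob F (Dom (hom_cat C A R) \<phi>)) (fob F (Cod (hom_cat C A R) \<phi>))"
        unfolding in_hom_stable_model_cat hom_cat_simps D Fob[OF f(1)] Fob[OF f(2)] Far[OF \<phi>]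
        using sm[OF f(1)] sm[OF f(2)] ind_fun[OF f(1)] ind_fun[OF f(2)] cell_rwhisk[OF \<phi>e vertex]
          whisk_exchange[OF \<phi>e edge]
        by (simp add: Fun_cat_def in_hom_def[of "\<lparr>Ob = _, Ar = _, Dom = _, Cod = _, Idn = _, Comp = _\<rparr>"])
    next
      fix \<phi> \<psi> assume "\<phi> \<in> Ar (hom_cat C A R)" "\<psi> \<in> Ar (hom_cat C A R)"
        and "Cod (hom_cat C A R) \<phi> = Dom (hom_cat C A R) \<psi>"
      then obtain f g h where \<phi>: "cell A R f g \<phi>" and \<psi>: "cell A R g h \<psi>"
        by (simp add: Ar_hom_cat)
      have "(\<phi> \<bullet> \<psi>) \<triangleleft> e \<triangleleft> m j = (\<phi> \<triangleleft> e \<triangleleft> m j) \<bullet> (\<psi> \<triangleleft> e \<triangleleft> m j)" if "j \<in> Ob K" for j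
        using cell_vcomp_rwhisk[OF \<phi> \<psi> e]
          cell_vcomp_rwhisk[OF cell_rwhisk[OF \<phi> e] cell_rwhisk[OF \<psi> e] vertex[OF that]] by simp
      then show "far F (Comp (hom_cat C A R) \<phi> \<psi>) = Comp (stable_model_cat C J A X) (far F \<phi>) (far F \<psi>)"
        using Far[OF cell_vcomp[OF \<phi> \<psi>]] Far[OF \<phi>] Far[OF \<psi>]
        by (auto simp: stable_model_cat_def full_subcat_def Fun_cat_def fun_eq_iff restrict_def)
    qed
    show "Dom (stable_model_cat C J A X) b \<in> Ob (stable_model_cat C J A X) \<and>
        Cod (stable_model_cat C J A X) b \<in> Ob (stable_model_cat C J A X)"
      if "b \<in> Ar (stable_model_cat C J A X)" for b
      using that by (auto simp: stable_model_cat_def full_subcat_def)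
    show "\<exists>!f. f \<in> Ob (hom_cat C A R) \<and> fob F f = M" if "M \<in> Ob (stable_model_cat C J A X)" for M
    proof -
      have M: "M \<in> functors K (hom_cat C A X)" "stable_model C J A X M" using that Ob_sm by auto
      obtain k where k: "in_hom C k A P" "ind k = M" using ind_lift[OF A M(1)] by blast
      have "Dom C k = A" using k(1) by (simp add: in_hom_def)
      then obtain f where f: "in_hom C f A R" "f \<cdot> e = k" using classifiesD(3)[OF R k(1)] M(2) k(2) by auto
      have "g = f" if "in_hom C g A R" "ind (g \<cdot> e) = M" for g
        using ind_eqI[OF hom1_Comp[OF that(1) e] k(1)] e.eqI[OF that(1) f(1)] that k f by simp
      then have "g = f" if "in_hom C g A R" "fob F g = M" for g using that Fob[OF that(1)] by simp
      moreover have "fob F f = M" using Fob[OF f(1)] f(2) k(2) by simp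
      ultimately show ?thesis using f(1) unfolding hom_cat_simps mem_Collect_eq by blast
    qed
    fix f g b assume "f \<in> Ob (hom_cat C A R)" "g \<in> Ob (hom_cat C A R)"
      and b: "in_hom (stable_model_cat C J A X) b (fob F f) (fob F g)"
    then have f: "in_hom C f A R" and g: "in_hom C g A R" by simp_all
    have b': "nt_dom b = ind (f \<cdot> e)" "nt_cod b = ind (g \<cdot> e)" "nt_at b \<in> extensional (Ob K)"
      and c: "\<And>j. j \<in> Ob K \<Longrightarrow> cell A X ((f \<cdot> e) \<cdot> m j) ((g \<cdot> e) \<cdot> m j) (nt_at b j)"
      and nat: "\<And>u. u \<in> Ar K \<Longrightarrow> ((f \<cdot> e) \<triangleright> c u) \<bullet> nt_at b (Cod K u) = nt_at b (Dom K u) \<bullet> ((g \<cdot> e) \<triangleright> c u)"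
      using b unfolding in_hom_stable_model_cat Fob[OF f] Fob[OF g]
      by (auto simp: Fun_cat_def in_hom_def[of "\<lparr>Ob = _, Ar = _, Dom = _, Cod = _, Idn = _, Comp = _\<rparr>"])
    obtain \<chi> where \<chi>: "cell A P (f \<cdot> e) (g \<cdot> e) \<chi>" "\<forall>j \<in> Ob K. \<chi> \<triangleleft> m j = nt_at b j"
      using lift_cell[OF hom1_Comp[OF f e] hom1_Comp[OF g e] c nat] by blast
    obtain \<psi> where \<psi>: "cell A R f g \<psi>" "\<psi> \<triangleleft> e = \<chi>" using e.lift_cell[OF f g \<chi>(1)] by blast
    have "(\<lambda>j \<in> Ob K. \<psi> \<triangleleft> e \<triangleleft> m j) = nt_at b"
      using b'(3) \<chi>(2) \<psi>(2) by (auto simp: fun_eq_iff restrict_def extensional_def)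
    then have "far F \<psi> = b" using Far[OF \<psi>(1)] b' by simp
    moreover have "\<psi>' = \<psi>" if \<psi>': "cell A R f g \<psi>'" "far F \<psi>' = b" for \<psi>'
    proof -
      have "nt_at b = (\<lambda>j \<in> Ob K. \<psi>' \<triangleleft> e \<triangleleft> m j)" using Far[OF \<psi>'(1)] \<psi>'(2) by auto
      then have "\<psi>' \<triangleleft> e = \<psi> \<triangleleft> e"
        using cell_eqI[OF cell_rwhisk[OF \<psi>'(1) e] cell_rwhisk[OF \<psi>(1) e]] \<chi>(2) \<psi>(2) by simp
      then show ?thesis using e.cell_eqI \<psi>' \<psi> by blast
    qed
    ultimately show "\<exists>!a. in_hom (hom_cat C A R) a f g \<and> far F a = b"
      using \<psi>(1) unfolding in_hom_hom_cat by blast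
  qed
  \<comment> \<open>The evaluation model corresponds to the identity of \<open>R\<close>.\<close>
  moreover have "stable_model C J R X (ind e)"
    using sm[OF Idn_in_hom[OF R_ob]] Comp_Idn_left[OF e] by simp
  ultimately show ?thesis unfolding strict_cotensor_def F_def using R_ob by blast
qed

end

theorem propositionA0p1:
  fixes C :: "('o, 'm, 'c) twocat"
    and X :: 'o
    and J :: "('j, 'k) sketch"
  assumes "pita C"
    and "X \<in> Ob C"
    and "has_finite_limits C X"
    and "finite_pbt_sketch J"
  shows "\<exists>XJ ev. strict_cotensor C X J XJ ev"
proof -
  interpret pita_category C
    using assms(1) by (simp add: pita_category_def pita_category_axioms_def pita_def)
  have K: "category (sk_cat J)" "finite (Ob (sk_cat J))" "finite (Ar (sk_cat J))"
    using assms(4) by (simp_all add: finite_pbt_sketch_def finite_category_def)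
  interpret K: category "sk_cat J" by (rule K)
  obtain P m c where P: "diagram_object C (sk_cat J) (Ob (sk_cat J)) (Ar (sk_cat J)) X P m c"
    using diagram_object_exists[OF K(3,2) assms(2), of "sk_cat J"] K.Dom_Ob K.Cod_Ob by blast
  interpret sketch_diagram_object C J X P m c
    by (intro sketch_diagram_object.intro full_diagram_object.intro pita_category_axioms P K(1)
      sketch_diagram_object_axioms.intro assms(3,4))
  show ?thesis by (rule strict_cotensor_exists)
qed

end
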